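(* Let $A\ne B$ be complex numbers with $|A|>1$, $|B|>1$ and such that $0$ does not lie on the segment $[1/A,1/B]$. Let $f(z)=\left[\left(A-\frac1{\varphi(z)}\right)\left(B-\frac1{\varphi(z)}\right)\right]^{-1/2}$ be a holomorphic branch in $\overline{\mathbb C}\setminus[-1,1]$ and let $f_\infty$ be its germ at $z=\infty$. For $n\in\mathbb N$ let $Q_{n,0},Q_{n,1},Q_{n,2},Q_{n,3}\not\equiv0$ be polynomials of degree at most $n$ with $$(Q_{n,0}+Q_{n,1}f_\infty+Q_{n,2}f_\infty^2+Q_{n,3}f_\infty^3)(z)=O\left(\frac1{z^{3n+3}}\right),\quad z\to\infty.$$ Let $E'$ be the projection to $\overline{\mathbb C}$ of the boundary between the third and fourth sheets of the Nuttall partition of the Riemann surface $\mathfrak R_4(f)$ (see the context). Then, for each $j=0,1,2,3$, the compact set $E'$ attracts as $n\to\infty$ all zeros of the polynomials $Q_{n,j}$, except possibly a finite number (independent of $n$) of zeros. Moreover, as $n\to\infty$, $$\frac{Q_{n,2}}{Q_{n,3}}(z)\overset{\mathrm{cap}}\longrightarrow-\left[f(z^{(1)})+f(z^{(2)})+f(z^{(3)})\right],\quad z\in\overline{\mathbb C}\setminus E',$$ where $z^{(1)},\dots,z^{(4)}$ are the points over $z$ on the sheets of the Nuttall partition.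
   Context: $\varphi(z)=z+(z^2-1)^{1/2}$ for $z\in\overline{\mathbb C}\setminus[-1,1]$, with the branch such that $(z^2-1)^{1/2}/z\to1$ as $z\to\infty$ (so $|\varphi|>1$). Riemann surface: let $\tilde F=[1/A,1/B]$ be the closed segment in the $\zeta$-plane, and let $\tilde f$ be the holomorphic branch of $[(A-1/\zeta)(B-1/\zeta)]^{-1/2}$ in $\overline{\mathbb C}_\zeta\setminus\tilde F$ with $\tilde f(\varphi(z))=f(z)$. The surface $\mathfrak R_4(f)$ is obtained from two copies of $\overline{\mathbb C}_\zeta$ cut along $\tilde F$, glued crosswise along the cut. The projection $\pi_4:\mathfrak R_4(f)\to\overline{\mathbb C}$ is $z=\frac12(\zeta+1/\zeta)$ on both copies (a four-sheeted covering, of genus $0$). $f$ is the single-valued meromorphic function on $\mathfrak R_4(f)$ equal to $\tilde f$ on the first copy and $-\tilde f$ on the second. Nuttall partition: let $g_{\tilde F}(\zeta,\infty)$ be the Green function of $\overline{\mathbb C}\setminus\tilde F$ with singularity at $\infty$. Let $u$ be the function on $\mathfrak R_4(f)$ equal to $-2g_{\tilde F}(\zeta,\infty)-\log|\zeta|$ on the first copy and $2g_{\tilde F}(\zeta,\infty)-\log|\zeta|$ on the second. It is harmonic except at the four points over $z=\infty$: at $\infty^{(1)}$ (the point $\zeta=\infty$ of the first copy) $u=-3\log|z|+O(1)$, and at the other three $u=\log|z|+O(1)$. The sheets are defined by ordering the four points over $z$ so that $u(z^{(1)})<u(z^{(2)})<u(z^{(3)})<u(z^{(4)})$. The projections to $\overline{\mathbb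 C}$ of the boundaries between consecutive sheets are $E=\{z:u(z^{(1)})=u(z^{(2)})\}$, $F=\{z:u(z^{(2)})=u(z^{(3)})\}$, $E'=\{z:u(z^{(3)})=u(z^{(4)})\}$ (values ordered increasingly). The sum $f(z^{(1)})+f(z^{(2)})+f(z^{(3)})$ is understood as extended by continuity to $\overline{\mathbb C}\setminus E'$. "Attracts all zeros except possibly a finite number independent of $n$" means: there is $N$ such that for every neighbourhood $U$ of the compact set, for all large $n$ at most $N$ zeros (with multiplicity) lie outside $U$. $h_n\overset{\mathrm{cap}}\longrightarrow h$ in a domain $D$ means convergence in logarithmic capacity on compact subsets: for every compact $K\subset D$ and $\varepsilon>0$, $\mathrm{cap}\{z\in K:|h_n(z)-h(z)|\ge\varepsilon\}\to0$ (near $\infty$, in a local coordinate). *)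

theory Defs
  imports
    "HOL-Complex_Analysis.Complex_Analysis"
    "HOL-Probability.Probability_Measure"
    "HOL-Library.Landau_Symbols"
begin

subsection \<open>The Riemann sphere\<close>

text \<open>\<^term>\<open>None\<close> is the point at infinity.\<close>

definition riemann_sphere :: "complex option topology" where
  "riemann_sphere = Alexandroff_compactification euclidean"

definition chart_at_infinity :: "complex \<Rightarrow> complex option" where
  "chart_at_infinity w = (if w = 0 then None else Some (1 / w))"

definition sphere_holomorphic_on :: "(complex option \<Rightarrow> complex) \<Rightarrow> complex option set \<Rightarrow> bool" where
  "sphere_holomorphic_on f S \<longleftrightarrow>
     openin riemann_sphere S \<and>
     (f \<circ> Some) holomorphic_on (Some -` S) \<and>
     (f \<circ> chart_at_infinity) holomorphic_on (chart_at_infinity -` S)"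


subsection \<open>Green functions\<close>

definition harmonic_on :: "(complex \<Rightarrow> real) \<Rightarrow> complex set \<Rightarrow> bool" where
  "harmonic_on u S \<longleftrightarrow> open S \<and>
     (\<exists>ux uy uxx uxy uyx uyy.
        (\<forall>z\<in>S. (u has_derivative (\<lambda>h. ux z * Re h + uy z * Im h)) (at z) \<and>
               (ux has_derivative (\<lambda>h. uxx z * Re h + uxy z * Im h)) (at z) \<and>
               (uy has_derivative (\<lambda>h. uyx z * Re h + uyy z * Im h)) (at z) \<and>
               uxx z + uyy z = 0) \<and>
        continuous_on S uxx \<and> continuous_on S uxy \<and> continuous_on S uyx \<and> continuous_on S uyy)"

text \<open>
  The Green function with pole at infinity of the complement (in the sphere) of a compact
  set \<open>F\<close> that is regular for the Dirichlet problem, extended by zero to \<open>F\<close>.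
  The limit at infinity in the second clause is the Robin constant.
\<close>

definition is_green_function :: "complex set \<Rightarrow> (complex \<Rightarrow> real) \<Rightarrow> bool" where
  "is_green_function F g \<longleftrightarrow>
     harmonic_on g (- F) \<and>
     (\<exists>\<gamma>. ((\<lambda>\<zeta>. g \<zeta> - ln (cmod \<zeta>)) \<longlongrightarrow> \<gamma>) at_infinity) \<and>
     (\<forall>a\<in>F. (g \<longlongrightarrow> 0) (at a within - F) \<and> g a = 0)"

definition green_function :: "complex set \<Rightarrow> complex \<Rightarrow> real" where
  "green_function F = (THE g. is_green_function F g)"


subsection \<open>The function \<open>f\<close> and its branch in the \<open>\<zeta>\<close>-plane\<close>

text \<open>
  The product of the two principal roots is the branch of \<open>(z\<^sup>2 - 1)\<^sup>1\<^sup>/\<^sup>2\<close> that is holomorphic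
  off \<open>[-1, 1]\<close> and asymptotic to \<open>z\<close> at infinity: on \<open>z < -1\<close> the sign changes of the two
  factors cancel.
\<close>

definition phi :: "complex \<Rightarrow> complex" where
  "phi z = z + csqrt (z - 1) * csqrt (z + 1)"

definition branch_off_interval :: "complex \<Rightarrow> complex \<Rightarrow> (complex option \<Rightarrow> complex) \<Rightarrow> bool" where
  "branch_off_interval A B f \<longleftrightarrow>
     sphere_holomorphic_on f (- Some ` closed_segment (-1) 1) \<and>
     (\<forall>z. z \<notin> closed_segment (-1) 1 \<longrightarrow>
        (f (Some z))\<^sup>2 * ((A - 1 / phi z) * (B - 1 / phi z)) = 1)"

definition cut :: "complex \<Rightarrow> complex \<Rightarrow> complex set" where
  "cut A B = closed_segment (1 / A) (1 / B)"

text \<open>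
  The point \<open>\<zeta> = 0\<close> is left out of the second clause because \<open>1 / 0 = 0\<close> in HOL; there the
  value of the branch (namely 0) is fixed by holomorphy.
\<close>

definition branch_off_cut ::
  "complex \<Rightarrow> complex \<Rightarrow> (complex option \<Rightarrow> complex) \<Rightarrow> (complex option \<Rightarrow> complex) \<Rightarrow> bool" where
  "branch_off_cut A B f f_tilde \<longleftrightarrow>
     sphere_holomorphic_on f_tilde (- Some ` cut A B) \<and>
     (\<forall>\<zeta>. \<zeta> \<notin> cut A B \<and> \<zeta> \<noteq> 0 \<longrightarrow>
        (f_tilde (Some \<zeta>))\<^sup>2 * ((A - 1 / \<zeta>) * (B - 1 / \<zeta>)) = 1) \<and>
     (\<forall>z. z \<notin> closed_segment (-1) 1 \<longrightarrow> f_tilde (Some (phi z)) = f (Some z))"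


subsection \<open>The four-sheeted surface and its Nuttall partition\<close>

datatype copy = Copy1 | Copy2

text \<open>
  The pair \<open>(\<zeta>, k)\<close> is the point \<open>\<zeta>\<close> of the \<open>k\<close>-th copy of the cut \<open>\<zeta>\<close>-sphere. For \<open>\<zeta>\<close> on the
  cut the two pairs stand for the two points of the surface over \<open>\<zeta>\<close> (for the branch point,
  taken twice, if \<open>\<zeta>\<close> is an end of the cut). The fibre over a finite \<open>z\<close> is
  taken with ramification multiplicities, so it always has four elements: its \<open>\<zeta>\<close> are the
  solutions of \<open>(\<zeta> + 1 / \<zeta>) / 2 = z\<close>, that is, of \<open>1 - 2 z \<zeta> + \<zeta>\<^sup>2 = 0\<close>.
\<close>

definition surface_fibre :: "complex \<Rightarrow> (complex \<times> copy) multiset" where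
  "surface_fibre z =
     image_mset (\<lambda>\<zeta>. (\<zeta>, Copy1)) (proots [:1, - 2 * z, 1:]) +
     image_mset (\<lambda>\<zeta>. (\<zeta>, Copy2)) (proots [:1, - 2 * z, 1:])"

text \<open>Used only for points that do not lie over the cut.\<close>

fun surface_f :: "(complex option \<Rightarrow> complex) \<Rightarrow> complex \<times> copy \<Rightarrow> complex" where
  "surface_f f_tilde (\<zeta>, Copy1) = f_tilde (Some \<zeta>)"
| "surface_f f_tilde (\<zeta>, Copy2) = - f_tilde (Some \<zeta>)"

fun nuttall_u :: "complex \<Rightarrow> complex \<Rightarrow> complex \<times> copy \<Rightarrow> real" where
  "nuttall_u A B (\<zeta>, Copy1) = - 2 * green_function (cut A B) \<zeta> - ln (cmod \<zeta>)"
| "nuttall_u A B (\<zeta>, Copy2) = 2 * green_function (cut A B) \<zeta> - ln (cmod \<zeta>)"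

text \<open>The points of the fibre over \<open>z\<close> on the four sheets, first to fourth.\<close>

definition sheet_points :: "complex \<Rightarrow> complex \<Rightarrow> complex \<Rightarrow> (complex \<times> copy) list \<Rightarrow> bool" where
  "sheet_points A B z ps \<longleftrightarrow>
     mset ps = surface_fibre z \<and> sorted_wrt (<) (map (nuttall_u A B) ps)"

text \<open>The four values of \<open>u\<close> over \<open>z\<close> in increasing order, repeated if they coincide.\<close>

definition u_values :: "complex \<Rightarrow> complex \<Rightarrow> complex \<Rightarrow> real list" where
  "u_values A B z = sorted_list_of_multiset (image_mset (nuttall_u A B) (surface_fibre z))"

text \<open>
  The list is indexed from 0, so the third and fourth values have indices 2 and 3. Over
  \<open>z = \<infinity>\<close> they are both infinite, having the same singularity \<open>log |z|\<close>; whether they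
  coincide there is decided by their difference, extended by continuity.
\<close>

definition boundary_34 :: "complex \<Rightarrow> complex \<Rightarrow> complex option set" where
  "boundary_34 A B =
     {Some z | z. u_values A B z ! 2 = u_values A B z ! 3} \<union>
     {p. p = None \<and> ((\<lambda>z. u_values A B z ! 3 - u_values A B z ! 2) \<longlongrightarrow> 0) at_infinity}"

text \<open>
  \<open>h\<close> is the sum of the values of \<open>f\<close> on the first three sheets, which is defined over those
  \<open>z\<close> where the four values of \<open>u\<close> are distinct, extended by continuity to all points of the
  sphere outside the boundary of the third and fourth sheets. The extension is unique because
  the set of such \<open>z\<close> is dense.
\<close>

definition is_first_three_sheets_sum ::
  "complex \<Rightarrow> complex \<Rightarrow> (complex option \<Rightarrow> complex) \<Rightarrow> (complex option \<Rightarrow> complex) \<Rightarrow> bool" where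
  "is_first_three_sheets_sum A B f_tilde h \<longleftrightarrow>
     continuous_map (subtopology riemann_sphere (- boundary_34 A B)) euclidean h \<and>
     (\<forall>z p1 p2 p3 p4. sheet_points A B z [p1, p2, p3, p4] \<longrightarrow>
        h (Some z) = surface_f f_tilde p1 + surface_f f_tilde p2 + surface_f f_tilde p3)"


subsection \<open>Logarithmic capacity\<close>

text \<open>
  \<open>\<integral>\<integral> log (1 / |z - w|) d\<mu>(z) d\<mu>(w)\<close> as positive part minus negative part; the latter is finite
  for a compactly supported \<open>\<mu>\<close>. The diagonal is treated separately because \<open>ln 0 = 0\<close> in HOL.
\<close>

definition log_energy :: "complex measure \<Rightarrow> ereal" where
  "log_energy \<mu> =
     enn2ereal (\<integral>\<^sup>+ p. (if fst p = snd p then \<infinity> else ennreal (- ln (dist (fst p) (snd p)))) \<partial>(\<mu> \<Otimes>\<^sub>M \<mu>)) -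
     enn2ereal (\<integral>\<^sup>+ p. ennreal (ln (dist (fst p) (snd p))) \<partial>(\<mu> \<Otimes>\<^sub>M \<mu>))"

definition robin_constant :: "complex set \<Rightarrow> ereal" where
  "robin_constant S =
     (INF \<mu> \<in> {\<mu>. sets \<mu> = sets borel \<and> prob_space \<mu> \<and>
                 (\<exists>K. compact K \<and> K \<subseteq> S \<and> emeasure \<mu> K = 1)}. log_energy \<mu>)"

text \<open>Meaningful for bounded \<open>S\<close>, for which the Robin constant is not \<open>-\<infinity>\<close>.\<close>

definition log_capacity :: "complex set \<Rightarrow> real" where
  "log_capacity S =
     (if robin_constant S = \<infinity> then 0 else exp (- real_of_ereal (robin_constant S)))"

text \<open>
  A compact subset of the sphere is the union of one that omits \<open>\<infinity>\<close>, measured in the coordinate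
  \<open>z\<close>, and one that omits 0, measured in the coordinate \<open>1 / z\<close>. The values of \<open>h\<^sub>n\<close> at \<open>\<infinity>\<close> and
  at finitely many other points (poles) play no role since they do not affect the capacity.
\<close>

definition converges_in_capacity ::
  "complex option set \<Rightarrow> (nat \<Rightarrow> complex \<Rightarrow> complex) \<Rightarrow> (complex option \<Rightarrow> complex) \<Rightarrow> bool" where
  "converges_in_capacity D hn h \<longleftrightarrow>
     (\<forall>K \<epsilon>. compactin riemann_sphere K \<and> K \<subseteq> D \<and> \<epsilon> > 0 \<longrightarrow>
        (let bad = (\<lambda>n. {z. Some z \<in> K \<and> cmod (hn n z - h (Some z)) \<ge> \<epsilon>}) in
           (None \<notin> K \<longrightarrow> (\<lambda>n. log_capacity (bad n)) \<longlonglongrightarrow> 0) \<and>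
           (Some 0 \<notin> K \<longrightarrow> (\<lambda>n. log_capacity ((\<lambda>z. 1 / z) ` bad n)) \<longlonglongrightarrow> 0)))"


subsection \<open>Attraction of zeros\<close>

text \<open>
  \<^term>\<open>proots 0\<close> is empty in the library, whereas every point is a zero of the zero
  polynomial; hence the clause that \<open>P n\<close> is nonzero.
\<close>

definition attracts_almost_all_zeros :: "complex option set \<Rightarrow> (nat \<Rightarrow> complex poly) \<Rightarrow> bool" where
  "attracts_almost_all_zeros E P \<longleftrightarrow>
     (\<exists>N. \<forall>U. openin riemann_sphere U \<and> E \<subseteq> U \<longrightarrow>
        (\<forall>\<^sub>F n in sequentially. P n \<noteq> 0 \<and> size {#z \<in># proots (P n). Some z \<notin> U#} \<le> N))"

end

theory Submission
  imports Defs
begin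

text \<open>
  The theorem is explicit once the surface is uniformized. It has genus 0, and in the coordinate \<open>t\<close>
  in which the first copy of the cut \<open>\<zeta>\<close>-sphere is \<open>|t| > 1\<close> and the second one is \<open>|t| < 1\<close>, the Green
  function of the cut is \<open>|ln |t||\<close>. The functions \<open>f\<close> and \<open>z\<close> become rational in \<open>t\<close>, and
  \<open>exp (- u)\<close> becomes the modulus of a cubic polynomial, a constant times \<open>m\<close>.

  The remainder \<open>R = Q\<^sub>0 + Q\<^sub>1 f + Q\<^sub>2 f\<^sup>2 + Q\<^sub>3 f\<^sup>3\<close> is a rational function of \<open>t\<close> whose poles lie over
  \<open>z = \<infinity>\<close> and at the two branch points, where \<open>f\<close> has simple poles. The order of vanishing at
  \<open>\<infinity>\<^sup>(\<^sup>1\<^sup>)\<close> leaves only three free zeros: \<open>R = P / (m\<^sup>n (t\<^sup>2 - 1)\<^sup>3)\<close> with a cubic \<open>P\<close>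
  (\<open>degree_rempoly\<close>).

  The values of \<open>f\<close> on a fibre are \<open>\<plusminus>a, \<plusminus>b\<close>, and the four values of \<open>R\<close> determine the \<open>Q\<^sub>j\<close>
  (\<open>error_formula\<close>). Off \<open>E'\<close> the point \<open>z\<^sup>(\<^sup>4\<^sup>)\<close> on the fourth sheet has the strictly smallest \<open>|m|\<close>,
  so its contribution dominates the other three exponentially (\<open>local_estimate\<close>). Up to fixed factors,
  \<open>m\<^sup>n Q\<^sub>j\<close> is therefore close to \<open>P\<close> at \<open>z\<^sup>(\<^sup>4\<^sup>)\<close>. After normalization the cubics \<open>P\<close> form a compact
  family. Hence the number of zeros of \<open>Q\<^sub>j\<close> away from \<open>E'\<close> is bounded by the number of zeros of \<open>P\<close>
  and of the fixed factors (\<open>attracts\<close>). The quotient \<open>Q\<^sub>2 / Q\<^sub>3\<close> tends to \<open>f (z\<^sup>(\<^sup>4\<^sup>))\<close>, along subsequences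
  uniformly away from small discs about finitely many points, whose capacity is small (\<open>converges\<close>). Since the
  values of \<open>f\<close> on a fibre add up to 0, this limit is minus the sum over the first three sheets.

  The rest is the identification of the complement of \<open>E'\<close> with the fourth sheet. The Green function
  is unique by the maximum principle (\<open>green_function_eqI\<close>). The sheet is an open
  subset \<open>\<Omega>\<close> of the unit disc, which the projection maps homeomorphically onto the complement
  of \<open>E'\<close> (\<open>homeomorphic_map_zproj\<close>, \<open>boundary_eq\<close>).
\<close>

section \<open>Capacity of finite unions of small discs\<close>

text \<open>
  If \<open>\<mu>\<close> lives on a union of \<open>card Z\<close> discs, one of them has mass at least \<open>1 / card Z\<close>. The pairs
  of points in that disc have distance at most \<open>2 \<delta>\<close> and already make the energy large, while the
  negative part of the energy is bounded by the logarithm of the diameter.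
\<close>

lemma log_energy_lower_bound:
  fixes \<mu> :: "complex measure"
  assumes sets: "sets \<mu> = sets borel" and "prob_space \<mu>"
    and K: "compact K" "K \<subseteq> S" "emeasure \<mu> K = 1"
    and fin: "finite Z" and cover: "S \<subseteq> (\<Union>z\<in>Z. cball z \<delta>)"
    and \<delta>: "0 < \<delta>" "2 * \<delta> < 1" and bnd: "S \<subseteq> cball 0 R" "1 \<le> R"
  shows "ereal (ln (1 / (2 * \<delta>)) / (real (card Z))\<^sup>2 - ln (2 * R)) \<le> log_energy \<mu>"
proof -
  interpret prob_space \<mu> by fact
  interpret PP: pair_prob_space \<mu> \<mu> ..
  have Kset: "K \<in> sets \<mu>" using K(1) sets by (simp add: borel_compact)
  have Kne: "K \<noteq> {}" using K(3) by auto
  have mK: "measure \<mu> K = 1" using K(3) by (simp add: measure_def)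
  have cK: "K \<subseteq> (\<Union>z\<in>Z. cball z \<delta>)" using K cover by auto
  have Zne: "Z \<noteq> {}" using cK Kne by auto
  have kpos: "card Z > 0" using Zne fin by (simp add: card_gt_0_iff)
  have ballset: "cball z \<delta> \<in> sets \<mu>" for z using sets by simp
  have "\<exists>z\<in>Z. measure \<mu> (cball z \<delta>) \<ge> 1 / real (card Z)"
  proof (rule ccontr)
    assume "\<not> ?thesis"
    then have *: "\<And>z. z \<in> Z \<Longrightarrow> measure \<mu> (cball z \<delta>) < 1 / real (card Z)" by force
    have "1 \<le> measure \<mu> (\<Union>z\<in>Z. cball z \<delta>)"
      unfolding mK[symmetric] using cK fin ballset by (intro finite_measure_mono) auto
    also have "\<dots> \<le> (\<Sum>z\<in>Z. measure \<mu> (cball z \<delta>))"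
      using fin ballset by (intro finite_measure_subadditive_finite) auto
    also have "\<dots> < (\<Sum>z\<in>Z. 1 / real (card Z))"
      by (rule sum_strict_mono) (use fin Zne * in auto)
    also have "\<dots> = 1" using kpos by simp
    finally show False by simp
  qed
  then obtain z0 where z0: "measure \<mu> (cball z0 \<delta>) \<ge> 1 / real (card Z)" by blast
  define D where "D = cball z0 \<delta>"
  define L where "L = ln (1 / (2 * \<delta>))"
  have Lpos: "L > 0" using \<delta> by (simp add: L_def)
  have Dset: "D \<in> sets \<mu>" using ballset by (simp add: D_def)
  let ?pos = "\<lambda>p. if fst p = snd p then \<infinity> else ennreal (- ln (dist (fst p) (snd p :: complex)))"
  have pos: "ennreal (L / (real (card Z))\<^sup>2) \<le> (\<integral>\<^sup>+ p. ?pos p \<partial>(\<mu> \<Otimes>\<^sub>M \<mu>))"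
  proof -
    have "ennreal (L / (real (card Z))\<^sup>2) = ennreal L * ennreal (1 / real (card Z) * (1 / real (card Z)))"
      using Lpos by (simp add: ennreal_mult[symmetric] power2_eq_square)
    also have "\<dots> \<le> ennreal L * ennreal (measure \<mu> D * measure \<mu> D)"
      using z0 by (intro mult_left_mono ennreal_leI mult_mono) (auto simp: D_def)
    also have "\<dots> = ennreal L * emeasure (\<mu> \<Otimes>\<^sub>M \<mu>) (D \<times> D)"
      using Dset by (simp add: emeasure_pair_measure_Times ennreal_mult emeasure_eq_measure)
    also have "\<dots> = (\<integral>\<^sup>+ p. ennreal L * indicator (D \<times> D) p \<partial>(\<mu> \<Otimes>\<^sub>M \<mu>))"
      using Dset by (subst nn_integral_cmult_indicator) auto
    also have "\<dots> \<le> (\<integral>\<^sup>+ p. ?pos p \<partial>(\<mu> \<Otimes>\<^sub>M \<mu>))"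
    proof (rule nn_integral_mono)
      fix p :: "complex \<times> complex"
      show "ennreal L * indicator (D \<times> D) p \<le> ?pos p"
      proof (cases "p \<in> D \<times> D \<and> fst p \<noteq> snd p")
        case True
        then have d: "dist (fst p) (snd p) \<le> 2 * \<delta>"
          using dist_triangle[of "fst p" "snd p" z0] by (auto simp: D_def dist_commute)
        have "ln (dist (fst p) (snd p)) \<le> ln (2 * \<delta>)" using d True \<delta> by (subst ln_le_cancel_iff) auto
        then have "L \<le> - ln (dist (fst p) (snd p))" using \<delta> by (simp add: L_def ln_div)
        then show ?thesis using True by (auto simp: indicator_def intro: ennreal_leI)
      next
        case False
        then show ?thesis by (auto simp: indicator_def)
      qed
    qed
    finally show ?thesis .
  qed
  have AE: "AE p in \<mu> \<Otimes>\<^sub>M \<mu>. p \<in> K \<times> K"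
  proof -
    have "emeasure (\<mu> \<Otimes>\<^sub>M \<mu>) (K \<times> K) = 1"
      using Kset K(3) by (simp add: emeasure_pair_measure_Times)
    then show ?thesis using Kset
      by (intro PP.AE_prob_1) (auto simp: measure_def)
  qed
  have neg: "(\<integral>\<^sup>+ p. ennreal (ln (dist (fst p) (snd p))) \<partial>(\<mu> \<Otimes>\<^sub>M \<mu>)) \<le> ennreal (ln (2 * R))"
  proof -
    have "(\<integral>\<^sup>+ p. ennreal (ln (dist (fst p) (snd p))) \<partial>(\<mu> \<Otimes>\<^sub>M \<mu>))
        \<le> (\<integral>\<^sup>+ p. ennreal (ln (2 * R)) \<partial>(\<mu> \<Otimes>\<^sub>M \<mu>))"
    proof (rule nn_integral_mono_AE, rule AE_mp[OF AE], rule AE_I2, rule impI)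
      fix p :: "complex \<times> complex" assume "p \<in> K \<times> K"
      then have "norm (fst p) \<le> R" "norm (snd p) \<le> R" using K(2) bnd by force+
      then have "dist (fst p) (snd p) \<le> 2 * R"
        using norm_triangle_ineq4[of "fst p" "snd p"] by (simp add: dist_norm)
      moreover have "0 \<le> ln (2 * R)" using bnd by simp
      ultimately have "ln (dist (fst p) (snd p)) \<le> ln (2 * R)"
        by (cases "fst p = snd p") (use bnd in auto)
      then show "ennreal (ln (dist (fst p) (snd p))) \<le> ennreal (ln (2 * R))" by (rule ennreal_leI)
    qed
    also have "\<dots> = ennreal (ln (2 * R))" by (simp add: PP.emeasure_space_1)
    finally show ?thesis .
  qed
  have "ereal (L / (real (card Z))\<^sup>2 - ln (2 * R)) = ereal (L / (real (card Z))\<^sup>2) - ereal (ln (2 * R))"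
    by simp
  also have "\<dots> \<le> log_energy \<mu>" unfolding log_energy_def
  proof (rule ereal_minus_mono)
    show "ereal (L / (real (card Z))\<^sup>2) \<le> enn2ereal (\<integral>\<^sup>+ p. ?pos p \<partial>(\<mu> \<Otimes>\<^sub>M \<mu>))"
      using pos Lpos by (simp add: less_eq_ennreal.rep_eq)
    show "enn2ereal (\<integral>\<^sup>+ p. ennreal (ln (dist (fst p) (snd p))) \<partial>(\<mu> \<Otimes>\<^sub>M \<mu>)) \<le> ereal (ln (2 * R))"
      using neg bnd by (simp add: less_eq_ennreal.rep_eq)
  qed
  finally show ?thesis by (simp add: L_def)
qed

lemma log_capacity_le:
  assumes "finite Z" "S \<subseteq> (\<Union>z\<in>Z. cball z \<delta>)"
    and "0 < \<delta>" "2 * \<delta> < 1" "S \<subseteq> cball 0 R" "1 \<le> R"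
  shows "log_capacity S \<le> exp (ln (2 * R) - ln (1 / (2 * \<delta>)) / (real (card Z))\<^sup>2)"
proof -
  have *: "ereal (ln (1 / (2 * \<delta>)) / (real (card Z))\<^sup>2 - ln (2 * R)) \<le> robin_constant S"
    unfolding robin_constant_def
    by (rule INF_greatest) (use assms in \<open>auto intro!: log_energy_lower_bound\<close>)
  show ?thesis
  proof (cases "robin_constant S")
    case (real r)
    then show ?thesis using * by (simp add: log_capacity_def)
  next
    case PInf
    then show ?thesis by (simp add: log_capacity_def)
  next
    case MInf
    then show ?thesis using * by simp
  qed
qed

lemma log_capacity_nonneg: "log_capacity S \<ge> 0"
  by (simp add: log_capacity_def)

text \<open>
  The form in which smallness of capacity is used below: along subsequences the sets shrink into
  arbitrarily small discs about finitely many points, which may depend on the subsequence.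
\<close>

lemma log_capacity_tendsto_0:
  fixes S :: "nat \<Rightarrow> complex set"
  assumes bnd: "\<And>n. S n \<subseteq> cball 0 R"
    and cover: "\<And>r :: nat \<Rightarrow> nat. strict_mono r \<Longrightarrow> \<exists>s Z. strict_mono s \<and> finite Z \<and>
      (\<forall>\<delta>>0. \<forall>\<^sub>F n in sequentially. S (r (s n)) \<subseteq> (\<Union>z\<in>Z. cball z \<delta>))"
  shows "(\<lambda>n. log_capacity (S n)) \<longlonglongrightarrow> 0"
proof (rule ccontr)
  assume "\<not> ?thesis"
  then obtain \<epsilon> where \<epsilon>: "\<epsilon> > 0" and "\<not> (\<forall>\<^sub>F n in sequentially. dist (log_capacity (S n)) 0 < \<epsilon>)"
    unfolding tendsto_iff by blast
  then have "\<exists>\<^sub>F n in sequentially. log_capacity (S n) \<ge> \<epsilon>"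
    by (simp add: frequently_def log_capacity_nonneg not_le)
  then have inf: "infinite {n. log_capacity (S n) \<ge> \<epsilon>}"
    by (simp add: frequently_sequentially infinite_nat_iff_unbounded_le)
  define r where "r = enumerate {n. log_capacity (S n) \<ge> \<epsilon>}"
  have r: "strict_mono r" unfolding r_def using inf by (rule strict_mono_enumerate)
  have rS: "log_capacity (S (r n)) \<ge> \<epsilon>" for n
    using enumerate_in_set[OF inf] by (simp add: r_def)
  from cover[OF r] obtain s Z where sZ: "strict_mono s" "finite Z"
    and ev: "\<And>\<delta>. \<delta> > 0 \<Longrightarrow> \<forall>\<^sub>F n in sequentially. S (r (s n)) \<subseteq> (\<Union>z\<in>Z. cball z \<delta>)" by blast
  define R' where "R' = max 1 R"
  have R': "S n \<subseteq> cball 0 R'" for n using bnd[of n] by (auto simp: R'_def)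
  define k where "k = max 1 (real (card Z))"
  define M where "M = k\<^sup>2 * (ln (2 * R') - ln (\<epsilon> / 2))"
  define \<delta> where "\<delta> = min (1/4) (exp (- M) / 2)"
  have \<delta>: "\<delta> > 0" "2 * \<delta> < 1" by (auto simp: \<delta>_def)
  from ev[OF \<delta>(1)] obtain n where n: "S (r (s n)) \<subseteq> (\<Union>z\<in>Z. cball z \<delta>)"
    by (auto simp: eventually_sequentially)
  show False
  proof (cases "Z = {}")
    case True
    then have "S (r (s n)) = {}" using n by auto
    moreover have "log_capacity {} = 0"
    proof -
      have "{\<mu>::complex measure. sets \<mu> = sets borel \<and> prob_space \<mu> \<and>
                 (\<exists>K. compact K \<and> K \<subseteq> {} \<and> emeasure \<mu> K = 1)} = {}" by auto
      then have "robin_constant {} = \<infinity>" unfolding robin_constant_def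
        by (metis INF_empty top_ereal_def)
      then show ?thesis by (simp add: log_capacity_def)
    qed
    ultimately show False using rS[of "s n"] \<epsilon> by simp
  next
    case False
    then have k: "k = real (card Z)" "k > 0" using sZ(2) by (auto simp: k_def card_gt_0_iff Suc_le_eq)
    have "\<epsilon> \<le> log_capacity (S (r (s n)))" using rS .
    also have "\<dots> \<le> exp (ln (2 * R') - ln (1 / (2 * \<delta>)) / k\<^sup>2)"
      unfolding k(1) using sZ(2) n \<delta> R' by (intro log_capacity_le) (auto simp: R'_def)
    also have "\<dots> \<le> exp (ln (\<epsilon> / 2))"
    proof -
      have "2 * \<delta> \<le> exp (- M)" by (simp add: \<delta>_def)
      then have "ln (2 * \<delta>) \<le> - M" using \<delta> by (metis exp_gt_zero ln_exp ln_mono mult_pos_pos zero_less_numeral)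
      then have "M \<le> ln (1 / (2 * \<delta>))" using \<delta> by (simp add: ln_div)
      then have "k\<^sup>2 * (ln (2 * R') - ln (\<epsilon> / 2)) \<le> ln (1 / (2 * \<delta>))" by (simp add: M_def)
      then have "ln (2 * R') - ln (\<epsilon> / 2) \<le> ln (1 / (2 * \<delta>)) / k\<^sup>2"
        using k by (simp add: field_simps)
      then show ?thesis by simp
    qed
    also have "\<dots> = \<epsilon> / 2" using \<epsilon> by simp
    finally show False using \<epsilon> by simp
  qed
qed

section \<open>The inverse of the Joukowski map\<close>

lemma norm_add_ge_norm_diff:
  fixes p q :: complex
  assumes "Re p * Re q + Im p * Im q \<ge> 0"
  shows "cmod (p - q) \<le> cmod (p + q)"
proof -
  have "(cmod (p - q))\<^sup>2 \<le> (cmod (p + q))\<^sup>2"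
    unfolding cmod_power2 using assms by (simp add: power2_eq_square algebra_simps)
  then show ?thesis by simp
qed

text \<open>
  The other root of \<open>t + 1 / t = 2 z\<close>. Both roots are half a square, of the sum and of the difference
  of the two principal roots.
\<close>

definition phi_inv :: "complex \<Rightarrow> complex" where
  "phi_inv z = z - csqrt (z - 1) * csqrt (z + 1)"

lemma phi_eq_square: "phi z = (csqrt (z + 1) + csqrt (z - 1))\<^sup>2 / 2"
  and phi_inv_eq_square: "phi_inv z = (csqrt (z + 1) - csqrt (z - 1))\<^sup>2 / 2"
proof -
  have "(csqrt (z + 1))\<^sup>2 = z + 1" "(csqrt (z - 1))\<^sup>2 = z - 1" by simp_all
  then show "phi z = (csqrt (z + 1) + csqrt (z - 1))\<^sup>2 / 2"
    "phi_inv z = (csqrt (z + 1) - csqrt (z - 1))\<^sup>2 / 2"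
    unfolding phi_def phi_inv_def power2_sum power2_diff by (simp_all add: field_simps)
qed

lemma phi_mult_phi_inv: "phi z * phi_inv z = 1"
proof -
  have *: "(csqrt (z + 1))\<^sup>2 = z + 1" "(csqrt (z - 1))\<^sup>2 = z - 1" by simp_all
  have "phi z * phi_inv z = z\<^sup>2 - (csqrt (z + 1))\<^sup>2 * (csqrt (z - 1))\<^sup>2"
    unfolding phi_def phi_inv_def by algebra
  also have "\<dots> = 1" unfolding * by algebra
  finally show ?thesis .
qed

lemma phi_nonzero [simp]: "phi z \<noteq> 0"
  using phi_mult_phi_inv[of z] by auto

lemma phi_add_inverse: "phi z + 1 / phi z = 2 * z"
proof -
  have "1 / phi z = phi_inv z" using phi_mult_phi_inv[of z] by (simp add: field_simps)
  then show ?thesis by (simp add: phi_def phi_inv_def)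
qed

text \<open>
  The imaginary parts of \<open>z + 1\<close> and \<open>z - 1\<close> agree, so the two principal roots lie in a common closed
  quadrant, and their sum is at least as long as their difference.
\<close>

lemma norm_phi_ge_1: "cmod (phi z) \<ge> 1"
proof -
  let ?p = "csqrt (z + 1)" and ?q = "csqrt (z - 1)"
  have sgnp: "Re ?p \<ge> 0" "Re ?q \<ge> 0" by (metis csqrt_principal less_eq_real_def order_refl)+
  have im: "Im ?p * Im ?q \<ge> 0"
  proof (cases "Im z = 0")
    case True
    then show ?thesis
      using complex_Re_le_cmod[of "z + 1"] complex_Re_le_cmod[of "z - 1"] by simp
  next
    case False
    then show ?thesis
      using complex_Re_le_cmod[of "z + 1"] complex_Re_le_cmod[of "z - 1"]
      by (auto simp: zero_le_mult_iff sgn_if mult_le_0_iff)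
  qed
  have "cmod (?p - ?q) \<le> cmod (?p + ?q)"
    using sgnp im by (intro norm_add_ge_norm_diff) auto
  then have "cmod (phi_inv z) \<le> cmod (phi z)"
    unfolding phi_eq_square phi_inv_eq_square by (simp add: norm_divide norm_power power_mono)
  then have "cmod (phi z * phi_inv z) \<le> cmod (phi z) * cmod (phi z)"
    by (simp add: norm_mult mult_left_mono)
  then have "1 \<le> (cmod (phi z))\<^sup>2" unfolding phi_mult_phi_inv by (simp add: power2_eq_square)
  then show ?thesis using power2_le_imp_le[of 1 "cmod (phi z)"] by simp
qed

text \<open>
  The parallelogram identity for the two principal roots. It expresses the modulus of \<open>\<phi>\<close> by
  the sum of the distances to the foci, and so makes it continuous across the cut, where \<open>\<phi>\<close>
  itself jumps.
\<close>

lemma norm_phi_add_inverse: "cmod (phi z) + 1 / cmod (phi z) = cmod (z + 1) + cmod (z - 1)"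
proof -
  let ?p = "csqrt (z + 1)" and ?q = "csqrt (z - 1)"
  have "1 / cmod (phi z) = cmod (phi_inv z)"
    using arg_cong[OF phi_mult_phi_inv[of z], of cmod] by (simp add: norm_mult field_simps)
  then have "cmod (phi z) + 1 / cmod (phi z) = ((cmod (?p + ?q))\<^sup>2 + (cmod (?p - ?q))\<^sup>2) / 2"
    unfolding phi_eq_square phi_inv_eq_square by (simp add: norm_divide norm_power field_simps)
  also have "\<dots> = (cmod ?p)\<^sup>2 + (cmod ?q)\<^sup>2"
    unfolding cmod_power2 by (simp add: power2_eq_square algebra_simps)
  also have "\<dots> = cmod (?p\<^sup>2) + cmod (?q\<^sup>2)" by (simp add: norm_power)
  also have "\<dots> = cmod (z + 1) + cmod (z - 1)" by simp
  finally show ?thesis .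
qed

lemma norm_phi_eq_1_iff: "cmod (phi z) = 1 \<longleftrightarrow> z \<in> closed_segment (-1) 1"
proof -
  define x where "x = cmod (phi z)"
  have x: "x \<ge> 1" using norm_phi_ge_1 by (simp add: x_def)
  have "x = 1 \<longleftrightarrow> x + 1 / x = 2"
  proof
    assume "x + 1 / x = 2"
    then have "(x - 1)\<^sup>2 = 0" using x by (simp add: field_simps power2_eq_square)
    then show "x = 1" by simp
  qed simp
  also have "\<dots> \<longleftrightarrow> cmod (z + 1) + cmod (z - 1) = 2"
    using norm_phi_add_inverse[of z] by (simp add: x_def)
  also have "\<dots> \<longleftrightarrow> z \<in> closed_segment (-1) 1"
    unfolding between_mem_segment[symmetric] between
    by (auto simp: dist_norm norm_minus_commute add.commute)
  finally show ?thesis by (simp add: x_def)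
qed

lemma norm_phi_gt_1: "z \<notin> closed_segment (-1) 1 \<Longrightarrow> cmod (phi z) > 1"
  using norm_phi_ge_1[of z] norm_phi_eq_1_iff[of z] by linarith

lemma joukowski_roots:
  fixes s t z :: complex
  assumes "s \<noteq> 0" "t \<noteq> 0" "s + 1 / s = 2 * z" "t + 1 / t = 2 * z"
  shows "s = t \<or> s = 1 / t"
proof -
  have "(s - t) * (s * t - 1) = s * t * ((s + 1 / s) - (t + 1 / t))"
    using assms(1,2) by (simp add: field_simps)
  then have "(s - t) * (s * t - 1) = 0" using assms(3,4) by simp
  then have "s - t = 0 \<or> s * t - 1 = 0" by (simp only: mult_eq_0_iff)
  then show ?thesis using assms(1,2) by (auto simp: eq_divide_eq)
qed

lemma norm_phi_joukowski:
  assumes "t \<noteq> 0" "t + 1 / t = 2 * z" "cmod t \<ge> 1"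
  shows "cmod (phi z) = cmod t"
proof -
  have "phi z = t \<or> phi z = 1 / t"
    using joukowski_roots[of "phi z" t z] assms phi_add_inverse by auto
  then show ?thesis
  proof
    assume "phi z = 1 / t"
    then have "cmod (phi z) = 1 / cmod t" by (simp add: norm_divide)
    moreover have "1 / cmod t \<le> 1" using assms(3) by (subst divide_le_eq_1_pos) auto
    ultimately have "1 / cmod t = 1" using norm_phi_ge_1[of z] by linarith
    then show ?thesis using \<open>cmod (phi z) = 1 / cmod t\<close> assms(1) by (simp add: divide_eq_eq)
  qed simp
qed

lemma phi_joukowski:
  assumes "t + 1 / t = 2 * z" "cmod t > 1"
  shows "phi z = t"
proof -
  have t0: "t \<noteq> 0" using assms by auto
  have "phi z = t \<or> phi z = 1 / t"
    using joukowski_roots[of "phi z" t z] assms t0 phi_add_inverse by auto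
  moreover have "cmod (1 / t) < 1" using assms t0 by (simp add: norm_divide divide_less_eq)
  ultimately show ?thesis using norm_phi_ge_1[of z] by auto
qed

text \<open>
  The Joukowski map is injective outside the closed unit disc, and \<open>\<phi>\<close> is its inverse there; the
  branch cuts of the two square roots need not be discussed.
\<close>

lemma holomorphic_on_phi: "phi holomorphic_on (- closed_segment (-1) 1)"
proof -
  let ?S = "{t::complex. cmod t > 1}" and ?J = "\<lambda>t::complex. (t + 1 / t) / 2"
  have op: "open ?S" by (intro open_Collect_less continuous_intros)
  have hol: "?J holomorphic_on ?S" by (intro holomorphic_intros) auto
  have inj: "phi (?J t) = t" if "t \<in> ?S" for t
    by (rule phi_joukowski) (use that in auto)
  then have injJ: "inj_on ?J ?S" by (rule inj_on_inverseI)
  have "phi holomorphic_on ?J ` ?S"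
  proof (rule holomorphic_has_inverse[OF hol op injJ])
    fix g assume g: "g holomorphic_on ?J ` ?S" "\<And>t. t \<in> ?S \<Longrightarrow> g (?J t) = t"
    show "phi holomorphic_on ?J ` ?S"
      by (rule holomorphic_transform[OF g(1)]) (use g(2) inj in auto)
  qed
  moreover have "- closed_segment (-1) 1 \<subseteq> ?J ` ?S"
  proof
    fix z assume "z \<in> - closed_segment (-1) (1::complex)"
    then have "phi z \<in> ?S" using norm_phi_gt_1 by auto
    moreover have "z = ?J (phi z)" using phi_add_inverse[of z] by simp
    ultimately show "z \<in> ?J ` ?S" by blast
  qed
  ultimately show ?thesis by (rule holomorphic_on_subset)
qed

lemma norm_phi_eq_sqrt:
  "cmod (phi z) = (cmod (z + 1) + cmod (z - 1)) / 2 + sqrt (((cmod (z + 1) + cmod (z - 1)) / 2)\<^sup>2 - 1)"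
proof -
  define x where "x = cmod (phi z)"
  have x: "x \<ge> 1" using norm_phi_ge_1 by (simp add: x_def)
  have s: "(cmod (z + 1) + cmod (z - 1)) / 2 = (x + 1 / x) / 2"
    using norm_phi_add_inverse[of z] by (simp add: x_def)
  have "((x + 1 / x) / 2)\<^sup>2 - 1 = ((x - 1 / x) / 2)\<^sup>2" using x by (simp add: field_simps power2_eq_square)
  moreover have "(x - 1 / x) / 2 \<ge> 0" using x by (simp add: field_simps) (metis mult_mono' mult_1 zero_le_one)
  ultimately have "sqrt (((x + 1 / x) / 2)\<^sup>2 - 1) = (x - 1 / x) / 2" by simp
  then show ?thesis unfolding s x_def[symmetric] by (simp add: field_simps)
qed

lemma continuous_on_norm_phi: "continuous_on S (\<lambda>z. cmod (phi z))"
  unfolding norm_phi_eq_sqrt by (intro continuous_intros) auto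

lemma norm_phi_lower: "cmod (phi z) \<ge> 2 * cmod z - 1"
proof -
  have "2 * cmod z = cmod ((z + 1) + (z - 1))" by (simp add: norm_mult flip: mult_2)
  also have "\<dots> \<le> cmod (phi z) + 1 / cmod (phi z)"
    unfolding norm_phi_add_inverse by (rule norm_triangle_ineq)
  also have "1 / cmod (phi z) \<le> 1" using norm_phi_ge_1[of z] by (simp add: divide_le_eq)
  finally show ?thesis by simp
qed

lemma phi_at_infinity: "filterlim phi at_infinity at_infinity"
proof (rule filterlim_norm_at_top_imp_at_infinity)
  have "filterlim (\<lambda>z::complex. 2 * cmod z - 1) at_top at_infinity"
    using filterlim_norm_at_top
    by (intro filterlim_tendsto_add_at_top[of "\<lambda>_. -1" "-1::real" _ "\<lambda>z. 2 * cmod z", simplified]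
        filterlim_tendsto_pos_mult_at_top[of "\<lambda>_. 2" 2]) auto
  then show "filterlim (\<lambda>z. cmod (phi z)) at_top at_infinity"
    by (rule filterlim_at_top_mono) (use norm_phi_lower in auto)
qed

lemma phi_div_tendsto: "((\<lambda>z. phi z / z) \<longlongrightarrow> 2) at_infinity"
proof -
  have "((\<lambda>z. 1 / phi z / z) \<longlongrightarrow> 0) at_infinity"
  proof (rule Lim_null_comparison)
    show "\<forall>\<^sub>F z in at_infinity. norm (1 / phi z / z) \<le> norm (1 / z)"
    proof (rule always_eventually, rule allI)
      fix z
      have "1 / cmod (phi z) \<le> 1" using norm_phi_ge_1[of z] by (simp add: divide_le_eq)
      then have "1 / cmod (phi z) / cmod z \<le> 1 / cmod z" by (rule divide_right_mono) auto
      then show "norm (1 / phi z / z) \<le> norm (1 / z)" by (simp add: norm_divide norm_mult)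
    qed
    show "((\<lambda>z::complex. norm (1 / z)) \<longlongrightarrow> 0) at_infinity"
      using tendsto_norm[OF tendsto_inverse_0[where 'a=complex]] by (simp add: inverse_eq_divide)
  qed
  then have "((\<lambda>z. 2 - 1 / phi z / z) \<longlongrightarrow> 2 - 0) at_infinity" by (intro tendsto_intros)
  moreover have "\<forall>\<^sub>F z in at_infinity. 2 - 1 / phi z / z = phi z / z"
  proof -
    have "\<forall>\<^sub>F z::complex in at_infinity. z \<noteq> 0"
      by (rule eventually_not_equal_at_infinity)
    then show ?thesis
    proof eventually_elim
      case (elim z)
      have "1 / phi z = 2 * z - phi z" using phi_add_inverse[of z] by (simp add: algebra_simps)
      then show ?case using elim by (simp add: diff_divide_distrib)
    qed
  qed
  ultimately show ?thesis using tendsto_cong by force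
qed

section \<open>The Green function of a segment\<close>

lemma harmonic_on_ln_norm:
  assumes S: "open S" and p: "p holomorphic_on S" "\<And>z. z \<in> S \<Longrightarrow> p z \<noteq> 0"
  shows "harmonic_on (\<lambda>z. ln (cmod (p z))) S"
proof -
  define L where "L = (\<lambda>z. deriv p z / p z)"
  have L: "L holomorphic_on S" unfolding L_def
    using p S by (intro holomorphic_intros holomorphic_deriv) auto
  define M where "M = deriv L"
  have M: "continuous_on S M" unfolding M_def
    by (intro holomorphic_on_imp_continuous_on holomorphic_deriv L S)
  have dL: "(L has_field_derivative M z) (at z)" if "z \<in> S" for z
    unfolding M_def using L S that by (rule holomorphic_derivI)
  have dp: "(p has_field_derivative deriv p z) (at z)" if "z \<in> S" for z
    using p(1) S that by (rule holomorphic_derivI)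
  have du: "((\<lambda>z. ln (cmod (p z))) has_derivative (\<lambda>h. Re (L z) * Re h + - Im (L z) * Im h)) (at z)"
    if z: "z \<in> S" for z
  proof -
    have "((\<lambda>w. Ln (p w / p z)) has_field_derivative L z) (at z)"
      unfolding L_def using dp[OF z] p(2)[OF z]
      by (auto intro!: derivative_eq_intros simp: field_simps)
    then have "((\<lambda>w. Re (Ln (p w / p z)) + ln (cmod (p z))) has_derivative
        (\<lambda>h. Re (L z * h) + 0)) (at z)"
      unfolding has_field_derivative_def
      by (intro has_derivative_add has_derivative_const
          bounded_linear.has_derivative[OF bounded_linear_Re])
    then have "((\<lambda>w. Re (Ln (p w / p z)) + ln (cmod (p z))) has_derivative
        (\<lambda>h. Re (L z) * Re h + - Im (L z) * Im h)) (at z)" by simp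
    then show ?thesis
    proof (rule has_derivative_transform_within_open[OF _ S z])
      fix w assume "w \<in> S"
      then show "Re (Ln (p w / p z)) + ln (cmod (p z)) = ln (cmod (p w))"
        using p(2) z by (simp add: norm_divide ln_div)
    qed
  qed
  have dRe: "((\<lambda>z. Re (L z)) has_derivative (\<lambda>h. Re (M z) * Re h + - Im (M z) * Im h)) (at z)"
    if "z \<in> S" for z
    using bounded_linear.has_derivative[OF bounded_linear_Re dL[OF that, unfolded has_field_derivative_def]]
    by simp
  have dIm: "((\<lambda>z. - Im (L z)) has_derivative (\<lambda>h. - Im (M z) * Re h + - Re (M z) * Im h)) (at z)"
    if "z \<in> S" for z
    using has_derivative_minus[OF bounded_linear.has_derivative[OF bounded_linear_Im
        dL[OF that, unfolded has_field_derivative_def]]]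
    by (simp add: algebra_simps)
  show ?thesis unfolding harmonic_on_def
    apply (intro conjI S)
    apply (rule exI[of _ "\<lambda>z. Re (L z)"], rule exI[of _ "\<lambda>z. - Im (L z)"],
        rule exI[of _ "\<lambda>z. Re (M z)"], rule exI[of _ "\<lambda>z. - Im (M z)"],
        rule exI[of _ "\<lambda>z. - Im (M z)"], rule exI[of _ "\<lambda>z. - Re (M z)"])
    using du dRe dIm M by (auto intro!: continuous_intros)
qed

lemma second_derivative_test_no_max:
  fixes h h' :: "real \<Rightarrow> real"
  assumes "\<rho> > 0" and h: "\<And>s. \<bar>s\<bar> < \<rho> \<Longrightarrow> (h has_real_derivative h' s) (at s)"
    and h': "(h' has_real_derivative c) (at 0)" and "c > 0"
    and max: "\<And>s. \<bar>s\<bar> < \<rho> \<Longrightarrow> h s \<le> h 0"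
  shows False
proof -
  have "h' 0 = 0"
    by (rule DERIV_local_max[OF h[of 0] \<open>\<rho> > 0\<close>]) (use assms in auto)
  obtain \<delta> where \<delta>: "\<delta> > 0" "\<And>s. 0 < s \<Longrightarrow> s < \<delta> \<Longrightarrow> h' 0 < h' (0 + s)"
    using DERIV_pos_inc_right[OF h' \<open>c > 0\<close>] by auto
  define s where "s = min \<delta> \<rho> / 2"
  have s: "0 < s" "s < \<delta>" "s < \<rho>" using \<delta>(1) \<open>\<rho> > 0\<close> by (auto simp: s_def)
  have "h 0 < h s"
  proof (rule DERIV_pos_imp_increasing_open[where f = h and a = 0 and b = s])
    show "0 < s" by fact
    fix x assume "0 < x" "x < s"
    then show "\<exists>y. (h has_real_derivative y) (at x) \<and> 0 < y"
      using h[of x] \<delta>(2)[of x] s \<open>h' 0 = 0\<close> by (intro exI[of _ "h' x"]) auto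
  next
    show "continuous_on {0..s} h"
    proof (intro continuous_at_imp_continuous_on ballI)
      fix x assume "x \<in> {0..s}"
      then have "\<bar>x\<bar> < \<rho>" using s by auto
      then show "isCont h x" by (rule DERIV_isCont[OF h])
    qed
  qed
  then show False using max[of s] s by auto
qed

lemma harmonic_on_diff_scaled:
  assumes "harmonic_on u S" "harmonic_on v S"
  shows "harmonic_on (\<lambda>z. a * u z - b * v z) S"
proof -
  obtain ux uy uxx uxy uyx uyy where S: "open S" and
    u: "\<And>z. z\<in>S \<Longrightarrow> (u has_derivative (\<lambda>h. ux z * Re h + uy z * Im h)) (at z) \<and>
               (ux has_derivative (\<lambda>h. uxx z * Re h + uxy z * Im h)) (at z) \<and>
               (uy has_derivative (\<lambda>h. uyx z * Re h + uyy z * Im h)) (at z) \<and>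
               uxx z + uyy z = 0"
    and uc: "continuous_on S uxx" "continuous_on S uxy" "continuous_on S uyx" "continuous_on S uyy"
    using assms(1) unfolding harmonic_on_def by blast
  obtain vx vy vxx vxy vyx vyy where 
    v: "\<And>z. z\<in>S \<Longrightarrow> (v has_derivative (\<lambda>h. vx z * Re h + vy z * Im h)) (at z) \<and>
               (vx has_derivative (\<lambda>h. vxx z * Re h + vxy z * Im h)) (at z) \<and>
               (vy has_derivative (\<lambda>h. vyx z * Re h + vyy z * Im h)) (at z) \<and>
               vxx z + vyy z = 0"
    and vc: "continuous_on S vxx" "continuous_on S vxy" "continuous_on S vyx" "continuous_on S vyy"
    using assms(2) unfolding harmonic_on_def by blast
  have lin: "((\<lambda>z. a * p z - b * q z) has_derivative
      (\<lambda>h. (a * px - b * qx) * Re h + (a * py - b * qy) * Im h)) (at z)"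
    if "(p has_derivative (\<lambda>h. px * Re h + py * Im h)) (at z)"
      "(q has_derivative (\<lambda>h. qx * Re h + qy * Im h)) (at z)" for p q px py qx qy and z :: complex
  proof -
    have "((\<lambda>z. a * p z - b * q z) has_derivative
      (\<lambda>h. a * (px * Re h + py * Im h) - b * (qx * Re h + qy * Im h))) (at z)"
      using that by (intro has_derivative_diff has_derivative_mult_right)
    then show ?thesis by (simp add: algebra_simps)
  qed
  have sum0: "(a * uxx z - b * vxx z) + (a * uyy z - b * vyy z) = 0" if "z \<in> S" for z
  proof -
    have "uyy z = - uxx z" "vyy z = - vxx z" using u[OF that] v[OF that] by linarith+
    then show ?thesis by simp
  qed
  show ?thesis unfolding harmonic_on_def
    apply (intro conjI S)
    apply (rule exI[of _ "\<lambda>z. a * ux z - b * vx z"], rule exI[of _ "\<lambda>z. a * uy z - b * vy z"],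
        rule exI[of _ "\<lambda>z. a * uxx z - b * vxx z"], rule exI[of _ "\<lambda>z. a * uxy z - b * vxy z"],
        rule exI[of _ "\<lambda>z. a * uyx z - b * vyx z"], rule exI[of _ "\<lambda>z. a * uyy z - b * vyy z"])
    using u v uc vc sum0 by (auto intro!: continuous_intros lin)
qed

lemma harmonic_on_imp_continuous_on: "harmonic_on u S \<Longrightarrow> continuous_on S u"
  unfolding harmonic_on_def
  by (metis continuous_at_imp_continuous_on has_derivative_continuous)

text \<open>
  If \<open>u\<close> were positive somewhere, then so would be a maximum of \<open>v = u + \<delta> |z|\<^sup>2\<close> over a suitable
  superlevel set of \<open>u\<close>, which is compact by the boundary conditions. That maximum is interior when
  \<open>\<delta>\<close> is small, but \<open>v\<close> has a positive Laplacian.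
\<close>

lemma harmonic_maximum_principle_exterior:
  assumes u: "harmonic_on u (- F)" and F: "closed F"
    and bd: "\<And>a. a \<in> F \<Longrightarrow> (u \<longlongrightarrow> 0) (at a within - F)"
    and infty: "\<forall>\<^sub>F z in at_infinity. u z \<le> 0"
    and p: "p \<notin> F"
  shows "u p \<le> 0"
proof (rule ccontr)
  assume "\<not> u p \<le> 0"
  \<comment> \<open>The superlevel set of height \<open>u p / 2\<close> is closed because \<open>u\<close> tends to 0 at \<open>F\<close>.\<close>
  define s where "s = u p / 2"
  have s: "s > 0" "u p = 2 * s" using \<open>\<not> u p \<le> 0\<close> by (auto simp: s_def)
  obtain ux uy uxx uxy uyx uyy where 
    d: "\<And>z. z\<in>-F \<Longrightarrow> (u has_derivative (\<lambda>h. ux z * Re h + uy z * Im h)) (at z) \<and>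
               (ux has_derivative (\<lambda>h. uxx z * Re h + uxy z * Im h)) (at z) \<and>
               (uy has_derivative (\<lambda>h. uyx z * Re h + uyy z * Im h)) (at z) \<and>
               uxx z + uyy z = 0"
    using u unfolding harmonic_on_def by blast
  have cont: "continuous_on (-F) u" using u by (rule harmonic_on_imp_continuous_on)
  obtain R where R: "\<And>z. cmod z \<ge> R \<Longrightarrow> u z \<le> 0"
    using infty by (auto simp: eventually_at_infinity)
  define C where "C = {z \<in> - F. u z \<ge> s}"
  have CR: "cmod z < R" if "z \<in> C" for z using that R[of z] s by (force simp: C_def)
  have "closed C"
  proof (unfold closed_sequential_limits, intro allI impI, elim conjE)
    fix x l assume x: "\<forall>n. x n \<in> C" and l: "x \<longlonglongrightarrow> l"
    show "l \<in> C"
    proof (cases "l \<in> F")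
      case True
      have "filterlim x (at l within - F) sequentially"
        using x l True by (auto simp: filterlim_at C_def intro!: always_eventually)
      with bd[OF True] have "(\<lambda>n. u (x n)) \<longlonglongrightarrow> 0" by (rule filterlim_compose)
      then have "s \<le> 0" by (rule LIMSEQ_le_const) (use x in \<open>auto simp: C_def\<close>)
      then show ?thesis using s by simp
    next
      case False
      then have "isCont u l" using cont F by (simp add: continuous_on_eq_continuous_at open_Compl)
      then have "(\<lambda>n. u (x n)) \<longlonglongrightarrow> u l" using l by (rule isCont_tendsto_compose)
      then have "s \<le> u l" by (rule LIMSEQ_le_const) (use x in \<open>auto simp: C_def\<close>)
      then show ?thesis using False by (simp add: C_def)
    qed
  qed
  moreover have "bounded C" using CR by (meson boundedI less_imp_le)
  ultimately have "compact C" by (simp add: compact_eq_bounded_closed)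
  have pC: "p \<in> C" using p s by (simp add: C_def)
  have Rpos: "R > 0" using CR[OF pC] norm_ge_zero[of p] by linarith
  define \<delta> where "\<delta> = s / (2 * R\<^sup>2)"
  have \<delta>: "\<delta> > 0" "\<delta> * R\<^sup>2 < s" using s Rpos by (auto simp: \<delta>_def)
  define v where "v = (\<lambda>z. u z + \<delta> * ((Re z)\<^sup>2 + (Im z)\<^sup>2))"
  have "continuous_on C v" unfolding v_def
    using cont by (intro continuous_intros) (auto simp: C_def elim: continuous_on_subset)
  then obtain z0 where z0: "z0 \<in> C" "\<And>z. z \<in> C \<Longrightarrow> v z \<le> v z0"
    using continuous_attains_sup[OF \<open>compact C\<close>, of v] pC by blast
  have z0F: "z0 \<in> - F" using z0 by (simp add: C_def)
  have "u z0 > s"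
  proof -
    have "2 * s \<le> v p" using s \<delta> by (simp add: v_def)
    also have "\<dots> \<le> v z0" using z0 pC by blast
    also have "\<dots> = u z0 + \<delta> * (cmod z0)\<^sup>2" by (simp add: v_def cmod_power2)
    also have "\<delta> * (cmod z0)\<^sup>2 \<le> \<delta> * R\<^sup>2" using CR[OF z0(1)] \<delta> by (intro mult_left_mono power_mono) auto
    finally show ?thesis using \<delta> by linarith
  qed
  moreover have "open {z \<in> - F. u z > s}"
  proof -
    have "open (- F \<inter> u -` {s<..})" using F cont by (intro continuous_open_preimage) auto
    moreover have "- F \<inter> u -` {s<..} = {z \<in> - F. u z > s}" by auto
    ultimately show ?thesis by simp
  qed
  ultimately obtain \<rho> where \<rho>: "\<rho> > 0" "ball z0 \<rho> \<subseteq> {z \<in> - F. u z > s}"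
    using z0F unfolding open_contains_ball by blast
  have ball: "z \<in> -F" "v z \<le> v z0" if "dist z0 z < \<rho>" for z
  proof -
    have "z \<in> {z \<in> - F. u z > s}" using \<rho>(2) that by auto
    then show "z \<in> -F" by auto
    show "v z \<le> v z0" using \<open>z \<in> {z \<in> - F. u z > s}\<close> by (intro z0(2)) (auto simp: C_def)
  qed
  \<comment> \<open>At a maximum of \<open>v\<close> its second derivative in a unit direction \<open>w\<close> is at most 0. The directions
    1 and \<open>\<i>\<close> together bound the Laplacian of \<open>v\<close>, which is \<open>4 \<delta>\<close>.\<close>
  have dir: "(uxx z0 * Re w + uxy z0 * Im w) * Re w + (uyx z0 * Re w + uyy z0 * Im w) * Im w + 2 * \<delta> \<le> 0"
    if w: "(Re w)\<^sup>2 + (Im w)\<^sup>2 = 1" for w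
  proof (rule ccontr)
    assume "\<not> ?thesis"
    then have c: "(uxx z0 * Re w + uxy z0 * Im w) * Re w + (uyx z0 * Re w + uyy z0 * Im w) * Im w + 2 * \<delta> > 0" by simp
    define p where "p s = z0 + complex_of_real s * w" for s
    have line: "(p has_derivative (\<lambda>h. complex_of_real h * w)) (at s)" for s
      unfolding p_def by (auto intro!: derivative_eq_intros)
    have "cmod w = 1" using w by (simp add: cmod_def)
    then have near: "dist z0 (p s) < \<rho>" if "\<bar>s\<bar> < \<rho>" for s
      using that by (simp add: p_def dist_norm norm_mult)
    have p0: "p 0 = z0" by (simp add: p_def)
    have chain: "((\<lambda>s. g (p s)) has_real_derivative gx * Re w + gy * Im w) (at s)"
      if "(g has_derivative (\<lambda>h. gx * Re h + gy * Im h)) (at (p s))" for g gx gy s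
      by (rule has_derivative_imp_has_field_derivative[OF has_derivative_compose[OF line that]])
         (simp add: algebra_simps)
    show False
    proof (rule second_derivative_test_no_max[OF \<rho>(1), of "\<lambda>s. v (p s)"
          "\<lambda>s. (ux (p s) * Re w + uy (p s) * Im w) + 2 * \<delta> * ((Re z0 * Re w + Im z0 * Im w) + s)"])
      fix s :: real assume s: "\<bar>s\<bar> < \<rho>"
      have vp: "v (p s) = u (p s) + \<delta> * (((Re z0)\<^sup>2 + (Im z0)\<^sup>2) + 2 * s * (Re z0 * Re w + Im z0 * Im w) + s\<^sup>2)" for s
      proof -
        have "(Re (p s))\<^sup>2 + (Im (p s))\<^sup>2 = ((Re z0)\<^sup>2 + (Im z0)\<^sup>2) + 2 * s * (Re z0 * Re w + Im z0 * Im w)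
            + s\<^sup>2 * ((Re w)\<^sup>2 + (Im w)\<^sup>2)"
          by (simp add: p_def power2_eq_square algebra_simps)
        then show ?thesis unfolding w by (simp add: v_def)
      qed
      have "((\<lambda>s. u (p s)) has_real_derivative ux (p s) * Re w + uy (p s) * Im w) (at s)"
        by (rule chain) (use d[OF ball(1)[OF near[OF s]]] in auto)
      then show "((\<lambda>s. v (p s)) has_real_derivative (ux (p s) * Re w + uy (p s) * Im w)
          + 2 * \<delta> * ((Re z0 * Re w + Im z0 * Im w) + s)) (at s)"
        unfolding vp by (auto intro!: derivative_eq_intros simp: algebra_simps)
      show "v (p s) \<le> v (p 0)" using ball(2)[OF near[OF s]] p0 by simp
    next
      have "((\<lambda>s. ux (p s)) has_real_derivative uxx z0 * Re w + uxy z0 * Im w) (at 0)"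
        "((\<lambda>s. uy (p s)) has_real_derivative uyx z0 * Re w + uyy z0 * Im w) (at 0)"
        by (rule chain; use d[OF z0F] p0 in auto)+
      then show "((\<lambda>s. (ux (p s) * Re w + uy (p s) * Im w) + 2 * \<delta> * ((Re z0 * Re w + Im z0 * Im w) + s))
          has_real_derivative ((uxx z0 * Re w + uxy z0 * Im w) * Re w + (uyx z0 * Re w + uyy z0 * Im w) * Im w
          + 2 * \<delta>)) (at 0)"
        by (auto intro!: derivative_eq_intros)
    qed (use c in auto)
  qed
  show False using dir[of 1] dir[of \<i>] d[OF z0F] \<delta> by simp
qed

lemma green_function_at_top:
  assumes "is_green_function F g"
  shows "filterlim g at_top at_infinity"
proof -
  obtain \<gamma> where "((\<lambda>\<zeta>. g \<zeta> - ln (cmod \<zeta>)) \<longlongrightarrow> \<gamma>) at_infinity"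
    using assms by (auto simp: is_green_function_def)
  moreover have "filterlim (\<lambda>\<zeta>::complex. ln (cmod \<zeta>)) at_top at_infinity"
    using filterlim_compose[OF ln_at_top filterlim_norm_at_top] .
  ultimately have "filterlim (\<lambda>\<zeta>. (g \<zeta> - ln (cmod \<zeta>)) + ln (cmod \<zeta>)) at_top at_infinity"
    by (rule filterlim_tendsto_add_at_top)
  then show ?thesis by simp
qed

text \<open>
  The difference of two Green functions need not be negative at infinity, since their Robin constants
  are not known to agree. Scaling the first by \<open>1 - \<epsilon>\<close> makes the difference tend to \<open>-\<infinity>\<close> there.
\<close>

lemma green_function_le:
  assumes F: "closed F" and g: "is_green_function F g" and g': "is_green_function F g'"
  shows "g p \<le> g' p"
proof (cases "p \<in> F")
  case True
  then show ?thesis using g g' by (simp add: is_green_function_def)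
next
  case False
  have *: "(1 - \<epsilon>) * g p - 1 * g' p \<le> 0" if \<epsilon>: "\<epsilon> > 0" for \<epsilon>
  proof (rule harmonic_maximum_principle_exterior[OF _ F _ _ False])
    show "harmonic_on (\<lambda>p. (1 - \<epsilon>) * g p - 1 * g' p) (- F)"
      using g g' by (intro harmonic_on_diff_scaled) (auto simp: is_green_function_def)
    fix a assume "a \<in> F"
    then have "(g \<longlongrightarrow> 0) (at a within - F)" "(g' \<longlongrightarrow> 0) (at a within - F)"
      using g g' by (auto simp: is_green_function_def)
    then have "((\<lambda>p. (1 - \<epsilon>) * g p - 1 * g' p) \<longlongrightarrow> (1 - \<epsilon>) * 0 - 1 * 0) (at a within - F)"
      by (intro tendsto_intros)
    then show "((\<lambda>p. (1 - \<epsilon>) * g p - 1 * g' p) \<longlongrightarrow> 0) (at a within - F)" by simp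
  next
    obtain \<gamma> \<gamma>' where "((\<lambda>\<zeta>. g \<zeta> - ln (cmod \<zeta>)) \<longlongrightarrow> \<gamma>) at_infinity"
      "((\<lambda>\<zeta>. g' \<zeta> - ln (cmod \<zeta>)) \<longlongrightarrow> \<gamma>') at_infinity"
      using g g' by (auto simp: is_green_function_def)
    then have "((\<lambda>\<zeta>. (g \<zeta> - ln (cmod \<zeta>)) - (g' \<zeta> - ln (cmod \<zeta>))) \<longlongrightarrow> \<gamma> - \<gamma>') at_infinity"
      by (intro tendsto_intros)
    then have 1: "\<forall>\<^sub>F \<zeta> in at_infinity. (g \<zeta> - ln (cmod \<zeta>)) - (g' \<zeta> - ln (cmod \<zeta>)) < \<gamma> - \<gamma>' + 1"
      by (rule order_tendstoD) simp
    have 2: "\<forall>\<^sub>F \<zeta> in at_infinity. g \<zeta> \<ge> (\<gamma> - \<gamma>' + 1) / \<epsilon>"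
      using green_function_at_top[OF g] by (auto simp: filterlim_at_top)
    show "\<forall>\<^sub>F p in at_infinity. (1 - \<epsilon>) * g p - 1 * g' p \<le> 0"
      using 1 2
    proof eventually_elim
      case (elim \<zeta>)
      have "\<gamma> - \<gamma>' + 1 \<le> \<epsilon> * g \<zeta>" using elim(2) \<epsilon> by (simp add: field_simps)
      then show ?case using elim(1) by (simp add: algebra_simps)
    qed
  qed
  have "((\<lambda>\<epsilon>. (1 - \<epsilon>) * g p - 1 * g' p) \<longlongrightarrow> (1 - 0) * g p - 1 * g' p) (at_right 0)"
    by (intro tendsto_intros)
  then have "(1 - 0) * g p - 1 * g' p \<le> 0"
    by (rule tendsto_upperbound) (use * in \<open>auto intro!: eventually_at_rightI[of 0 1]\<close>)
  then show ?thesis by simp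
qed

lemma green_function_eqI:
  assumes "closed F" "is_green_function F g"
  shows "green_function F = g"
  unfolding green_function_def
  by (rule the_equality) (use assms green_function_le in \<open>auto intro!: ext antisym\<close>)

lemma closed_segment_affine_image:
  fixes c d :: complex
  assumes "d \<noteq> 0"
  shows "(\<zeta> - c) / d \<in> closed_segment (-1) 1 \<longleftrightarrow> \<zeta> \<in> closed_segment (c - d) (c + d)"
proof -
  have eq: "(\<zeta> - c) / d = (1 - u) *\<^sub>R (-1) + u *\<^sub>R 1 \<longleftrightarrow> \<zeta> = (1 - u) *\<^sub>R (c - d) + u *\<^sub>R (c + d)" for u :: real
  proof -
    have "(\<zeta> - c) / d = 2 * of_real u - 1 \<longleftrightarrow> \<zeta> - c = (2 * of_real u - 1) * d"
      using assms by (rule nonzero_divide_eq_eq)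
    moreover have "(1 - u) *\<^sub>R (-1) + u *\<^sub>R (1::complex) = 2 * of_real u - 1"
      by (simp add: scaleR_conv_of_real)
    moreover have "(1 - u) *\<^sub>R (c - d) + u *\<^sub>R (c + d) = c + (2 * of_real u - 1) * d"
      by (simp add: scaleR_conv_of_real algebra_simps)
    ultimately show ?thesis by (simp add: diff_eq_eq add.commute)
  qed
  show ?thesis unfolding closed_segment_def mem_Collect_eq eq ..
qed

text \<open>
  The segment is the affine image of \<open>[-1, 1]\<close> with centre \<open>c\<close> and half-axis \<open>d\<close>.
\<close>

lemma green_function_segment:
  fixes c d :: complex
  assumes d: "d \<noteq> 0"
  shows "green_function (closed_segment (c - d) (c + d)) = (\<lambda>\<zeta>. ln (cmod (phi ((\<zeta> - c) / d))))"
proof (rule green_function_eqI)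
  let ?F = "closed_segment (c - d) (c + d)" and ?g = "\<lambda>\<zeta>. ln (cmod (phi ((\<zeta> - c) / d)))"
  show "closed ?F" by simp
  show "is_green_function ?F ?g" unfolding is_green_function_def
  proof (intro conjI ballI)
    have "(\<lambda>\<zeta>. phi ((\<zeta> - c) / d)) holomorphic_on - ?F"
    proof -
      have "(\<lambda>\<zeta>. (\<zeta> - c) / d) holomorphic_on - ?F" using d by (intro holomorphic_intros)
      moreover have "(\<lambda>\<zeta>. (\<zeta> - c) / d) ` (- ?F) \<subseteq> - closed_segment (-1) 1"
        using closed_segment_affine_image[OF d] by blast
      ultimately show ?thesis
        using holomorphic_on_compose_gen[OF _ holomorphic_on_phi] by (simp add: o_def)
    qed
    then show "harmonic_on ?g (- ?F)" by (intro harmonic_on_ln_norm) auto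
    have inf: "filterlim (\<lambda>\<zeta>. (\<zeta> - c) / d) at_infinity at_infinity"
    proof -
      have "filterlim (\<lambda>\<zeta>. \<zeta> - c) at_infinity at_infinity"
        using tendsto_add_filterlim_at_infinity'[OF filterlim_ident tendsto_const[of "-c"]] by simp
      then have "filterlim (\<lambda>\<zeta>. (1/d) * (\<zeta> - c)) at_infinity at_infinity"
        using d by (intro tendsto_mult_filterlim_at_infinity[OF tendsto_const]) auto
      then show ?thesis by simp
    qed
    have 1: "((\<lambda>\<zeta>. phi ((\<zeta> - c) / d) / ((\<zeta> - c) / d)) \<longlongrightarrow> 2) at_infinity"
      using filterlim_compose[OF phi_div_tendsto inf] .
    have 2: "((\<lambda>\<zeta>::complex. 1 - c / \<zeta>) \<longlongrightarrow> 1 - 0) at_infinity"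
      by (intro tendsto_intros tendsto_divide_0[OF tendsto_const] filterlim_ident)
    have 3: "((\<lambda>\<zeta>. phi ((\<zeta> - c) / d) / ((\<zeta> - c) / d) * (1 - c / \<zeta>) / d) \<longlongrightarrow> 2 * (1 - 0) / d) at_infinity"
      by (rule tendsto_divide[OF tendsto_mult[OF 1 2] tendsto_const d])
    have ev0: "\<forall>\<^sub>F \<zeta>::complex in at_infinity. \<zeta> \<noteq> 0 \<and> \<zeta> \<noteq> c"
      by (intro eventually_conj eventually_not_equal_at_infinity)
    have "((\<lambda>\<zeta>. phi ((\<zeta> - c) / d) / \<zeta>) \<longlongrightarrow> 2 / d) at_infinity"
    proof (rule Lim_transform_eventually)
      show "((\<lambda>\<zeta>. phi ((\<zeta> - c) / d) / ((\<zeta> - c) / d) * (1 - c / \<zeta>) / d) \<longlongrightarrow> 2 / d) at_infinity"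
        using 3 by (simp only: diff_zero mult_1_right)
      show "\<forall>\<^sub>F \<zeta> in at_infinity. phi ((\<zeta> - c) / d) / ((\<zeta> - c) / d) * (1 - c / \<zeta>) / d = phi ((\<zeta> - c) / d) / \<zeta>"
        using ev0 by eventually_elim (use d in \<open>auto simp: field_simps\<close>)
    qed
    then have "((\<lambda>\<zeta>. ln (cmod (phi ((\<zeta> - c) / d) / \<zeta>))) \<longlongrightarrow> ln (cmod (2 / d))) at_infinity"
      by (intro tendsto_ln tendsto_norm) (use d in auto)
    then have "((\<lambda>\<zeta>. ?g \<zeta> - ln (cmod \<zeta>)) \<longlongrightarrow> ln (cmod (2 / d))) at_infinity"
    proof (rule Lim_transform_eventually)
      show "\<forall>\<^sub>F \<zeta> in at_infinity. ln (cmod (phi ((\<zeta> - c) / d) / \<zeta>)) = ?g \<zeta> - ln (cmod \<zeta>)"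
        using ev0 by eventually_elim (auto simp: norm_divide ln_div)
    qed
    then show "\<exists>\<gamma>. ((\<lambda>\<zeta>. ?g \<zeta> - ln (cmod \<zeta>)) \<longlongrightarrow> \<gamma>) at_infinity" by blast
    fix a assume "a \<in> ?F"
    then have 1: "cmod (phi ((a - c) / d)) = 1"
      using closed_segment_affine_image[OF d] norm_phi_eq_1_iff by blast
    then show "?g a = 0" by simp
    have "continuous_on UNIV ?g"
      by (rule continuous_on_ln[OF continuous_on_compose2[OF continuous_on_norm_phi[of UNIV], of UNIV "\<lambda>\<zeta>. (\<zeta> - c) / d"]])
         (use d in \<open>auto intro!: continuous_intros\<close>)
    then have "(?g \<longlongrightarrow> ?g a) (at a)"
      by (simp add: continuous_on_eq_continuous_at isCont_def)
    then show "(?g \<longlongrightarrow> 0) (at a within - ?F)"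
      using 1 by (auto intro: tendsto_within_subset)
  qed
qed

section \<open>Uniformization of the four-sheeted surface\<close>

text \<open>
  The two copies of the \<open>\<zeta>\<close>-sphere, glued along the cut, form the Riemann surface of a square root
  with branch points \<open>1 / A\<close> and \<open>1 / B\<close>. With \<open>d\<close> half the difference of these points and \<open>d e\<close> their
  midpoint, it is the \<open>t\<close>-sphere under the Joukowski map
  \<open>\<zeta> = d e + d (t + 1 / t) / 2 = d N(t) / (2 t)\<close>: the first copy is \<open>|t| > 1\<close>, the second is
  \<open>|t| < 1\<close>, the cut is \<open>|t| = 1\<close>, and \<open>t \<mapsto> 1 / t\<close> exchanges the copies. In this coordinate
  \<open>f\<close> is the rational function \<open>F\<close>, the projection is \<open>z = X / m\<close>, and \<open>exp (- u)\<close> is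
  \<open>|t\<^sup>2 \<zeta>| = |d m(t) / 2|\<close>. The constant \<open>k\<close> is one of the two roots of \<open>1 / (A B)\<close>; its choice is
  the choice of the branch \<open>f\<close>.
\<close>

locale four_sheets =
  fixes A B k :: complex
  assumes A_neq_B: "A \<noteq> B" and norm_A: "cmod A > 1" and norm_B: "cmod B > 1"
    and zero_notin_cut: "0 \<notin> closed_segment (1 / A) (1 / B)"
    and k_square: "k\<^sup>2 * (A * B) = 1"
begin

definition d :: complex where "d = (1 / A - 1 / B) / 2"
definition e :: complex where "e = (A + B) / (B - A)"
definition N :: "complex \<Rightarrow> complex" where "N t = t\<^sup>2 + 2 * e * t + 1"
definition m :: "complex \<Rightarrow> complex" where "m t = t * N t"
definition X :: "complex \<Rightarrow> complex" where "X t = (d\<^sup>2 * (N t)\<^sup>2 + 4 * t\<^sup>2) / (4 * d)"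
definition zeta :: "complex \<Rightarrow> complex" where "zeta t = d * N t / (2 * t)"
definition F :: "complex \<Rightarrow> complex" where "F t = k * N t / (t\<^sup>2 - 1)"

text \<open>
  The value of \<open>f\<^sup>2\<close> at the points over \<open>1 / \<zeta>\<close> is \<open>1 / ((A - \<zeta>) (B - \<zeta>)) = t\<^sup>2 / y\<close>. The polynomial
  \<open>(t\<^sup>2 - 1)\<^sup>2 (F\<^sup>2 y - t\<^sup>2)\<close>, called \<open>Kfun\<close>, vanishes where this equals the value of \<open>f\<^sup>2\<close> over \<open>\<zeta>\<close>.
\<close>

definition y :: "complex \<Rightarrow> complex" where "y t = (A * t - d * N t / 2) * (B * t - d * N t / 2)"
definition Kfun :: "complex \<Rightarrow> complex" where "Kfun t = k\<^sup>2 * (N t)\<^sup>2 * y t - t\<^sup>2 * (t\<^sup>2 - 1)\<^sup>2"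

text \<open>
  This is \<open>\<zeta>(t) \<zeta>(t') = 1\<close> without denominators, so that it also makes sense over \<open>z = \<infinity>\<close>.
  The fibre of a generic \<open>t\<close> is \<open>t, 1 / t, t', 1 / t'\<close> with \<open>t'\<close> paired to \<open>t\<close>.
\<close>

definition paired :: "complex \<Rightarrow> complex \<Rightarrow> bool" where
  "paired t t' \<longleftrightarrow> d\<^sup>2 * N t * N t' = 4 * t * t'"

text \<open>
  The fourth sheet, where \<open>|m|\<close> is strictly smaller than at the other points of the fibre. As
  \<open>m (1 / t) = m t / t ^ 4\<close>, only \<open>|t| < 1\<close> and the competitors \<open>t'\<close> in the closed disc matter. For
  paired points both inequalities say \<open>|m t| < |m t'|\<close>; over \<open>z = \<infinity>\<close>, where both sides
  vanish, one of them reads \<open>0 < 0\<close> and the other one still decides.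
\<close>

definition \<Omega> :: "complex set" where
  "\<Omega> = {t. cmod t < 1 \<and> (\<forall>t'. cmod t' \<le> 1 \<and> paired t t' \<longrightarrow>
      cmod (d * N t) < 2 * cmod t' \<or> 2 * cmod t < cmod (d * N t'))}"

lemma A_nz: "A \<noteq> 0" and B_nz: "B \<noteq> 0" and k_nz: "k \<noteq> 0"
  using norm_A norm_B k_square by auto

lemma d_nz: "d \<noteq> 0" using A_neq_B A_nz B_nz by (simp add: d_def)

lemma d_e: "d * e = (1 / A + 1 / B) / 2"
proof -
  have "B - A \<noteq> 0" using A_neq_B by simp
  have "d = (B - A) / (2 * A * B)" using A_nz B_nz by (simp add: d_def field_simps)
  then have "d * e = (A + B) / (2 * A * B)" using \<open>B - A \<noteq> 0\<close> by (simp add: e_def)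
  then show ?thesis using A_nz B_nz by (simp add: field_simps)
qed

lemma A_d: "A * d * (1 + e) = 1" and B_d: "B * d * (e - 1) = 1"
proof -
  have "d * (1 + e) = 1 / A" "d * (e - 1) = 1 / B"
    using d_e by (simp_all add: algebra_simps) (simp_all add: d_def field_simps)
  then show "A * d * (1 + e) = 1" "B * d * (e - 1) = 1"
    using A_nz B_nz by (simp_all add: mult.assoc)
qed

lemma N_0 [simp]: "N 0 = 1" by (simp add: N_def)

lemma N_recip: "t \<noteq> 0 \<Longrightarrow> N (1 / t) = N t / t\<^sup>2"
  by (simp add: N_def field_simps power2_eq_square)

lemma m_recip: "t \<noteq> 0 \<Longrightarrow> m (1 / t) = m t / t ^ 4"
  by (simp add: m_def N_recip field_simps eval_nat_numeral)

lemma X_recip: "t \<noteq> 0 \<Longrightarrow> X (1 / t) = X t / t ^ 4"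
  using d_nz by (simp add: X_def N_recip field_simps eval_nat_numeral)

lemma F_recip: "t \<noteq> 0 \<Longrightarrow> t\<^sup>2 \<noteq> 1 \<Longrightarrow> F (1 / t) = - F t"
proof -
  assume t: "t \<noteq> 0" "t\<^sup>2 \<noteq> 1"
  have "F (1 / t) = k * (N t / t\<^sup>2) / ((1 - t\<^sup>2) / t\<^sup>2)"
    using t by (simp add: F_def N_recip power_divide diff_divide_distrib)
  also have "\<dots> = k * N t / (1 - t\<^sup>2)" using t by simp
  also have "\<dots> = - F t" unfolding F_def using t by (simp add: divide_simps) (simp add: algebra_simps)
  finally show ?thesis .
qed

lemma paired_sym: "paired t t' \<longleftrightarrow> paired t' t"
  by (auto simp: paired_def mult_ac)

text \<open>
  Two points have the same projection iff they are equal, inverse to each other, or one of these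
  after pairing: the difference of the projections factors accordingly.
\<close>

lemma cross_identity:
  "4 * d * (X t * m t' - X t' * m t) = (d\<^sup>2 * N t * N t' - 4 * t * t') * ((t - t') * (t * t' - 1))"
  using d_nz by (simp add: X_def m_def N_def field_simps) (simp add: power2_eq_square algebra_simps)

lemma paired_same_z: "paired t t' \<Longrightarrow> X t * m t' = X t' * m t"
  using cross_identity[of t t'] d_nz by (simp add: paired_def)

lemma X_m_not_both_0: "X t = 0 \<Longrightarrow> m t \<noteq> 0"
  using d_nz by (auto simp: X_def m_def)

lemma A_factor: "A * (d * N t / 2) - t = A * d / 2 * (t - 1)\<^sup>2"
  and B_factor: "B * (d * N t / 2) - t = B * d / 2 * (t + 1)\<^sup>2"
  using A_d B_d unfolding N_def by (algebra, algebra)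

text \<open>
  With the factorizations of \<open>A \<zeta> - 1\<close> and \<open>B \<zeta> - 1\<close> at \<open>t'\<close>, this says \<open>y t * (F t')\<^sup>2 = t\<^sup>2\<close>.
\<close>

lemma y_paired:
  assumes "paired t t'"
  shows "y t * (N t')\<^sup>2 = A * B * t\<^sup>2 * (t'\<^sup>2 - 1)\<^sup>2"
proof -
  have "(A * t - d * N t / 2) * (d * N t' / 2) = t * (A * (d * N t' / 2) - t')"
    "(B * t - d * N t / 2) * (d * N t' / 2) = t * (B * (d * N t' / 2) - t')"
    using assms unfolding paired_def by (simp_all add: field_simps) algebra+
  note ab = this[unfolded A_factor B_factor]
  have "y t * (d * N t' / 2)\<^sup>2 = ((A * t - d * N t / 2) * (d * N t' / 2)) * ((B * t - d * N t / 2) * (d * N t' / 2))"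
    unfolding y_def power2_eq_square by (simp only: mult_ac)
  then have "y t * (d * N t' / 2)\<^sup>2 = t * (A * d / 2 * (t' - 1)\<^sup>2) * (t * (B * d / 2 * (t' + 1)\<^sup>2))"
    unfolding ab .
  also have "t * (A * d / 2 * u) * (t * (B * d / 2 * v)) = (d\<^sup>2 / 4) * (A * B * t\<^sup>2 * (u * v))" for u v
    by (simp add: power2_eq_square)
  also have "(t' - 1)\<^sup>2 * (t' + 1)\<^sup>2 = (t'\<^sup>2 - 1)\<^sup>2" by (simp add: power2_eq_square algebra_simps)
  finally have "(d\<^sup>2 / 4) * (y t * (N t')\<^sup>2) = (d\<^sup>2 / 4) * (A * B * t\<^sup>2 * (t'\<^sup>2 - 1)\<^sup>2)"
    by (simp add: power_divide power_mult_distrib mult.assoc)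
  moreover have "d\<^sup>2 / 4 \<noteq> 0" using d_nz by simp
  ultimately show ?thesis using mult_left_cancel[of "d\<^sup>2 / 4"] by blast
qed

lemma N_1: "N 1 \<noteq> 0" and y_1: "y 1 \<noteq> 0"
proof -
  have "N 1 = 2 * (1 + e)" by (simp add: N_def)
  then have "A * (d * N 1 / 2) = A * d * (1 + e)" by (simp only:) simp
  then have "A * (d * N 1 / 2) = 1" using A_d by simp
  then show "N 1 \<noteq> 0" by auto
  have h: "d * N 1 / 2 = 1 / A" using \<open>A * (d * N 1 / 2) = 1\<close> A_nz by (simp add: field_simps)
  have "A * A \<noteq> 1" "A * B \<noteq> 1"
    using norm_A norm_B less_1_mult[of "cmod A" "cmod A"] less_1_mult[of "cmod A" "cmod B"]
    by (metis norm_mult norm_one less_irrefl)+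
  then have "A - 1 / A \<noteq> 0" "B - 1 / A \<noteq> 0" using A_nz by (auto simp: eq_divide_eq mult.commute)
  then show "y 1 \<noteq> 0" unfolding y_def h by simp
qed

definition np :: "complex poly" where "np = [:1, 2 * e, 1:]"
definition mp :: "complex poly" where "mp = pCons 0 np"
definition xp :: "complex poly" where "xp = smult (1 / (4 * d)) (smult (d\<^sup>2) (np\<^sup>2) + [:0, 0, 4:])"
definition yp :: "complex poly" where
  "yp = ([:0, A:] - smult (d / 2) np) * ([:0, B:] - smult (d / 2) np)"
definition kpoly :: "complex poly" where
  "kpoly = smult (k\<^sup>2) (np\<^sup>2 * yp) - [:0, 0, 1:] * [:-1, 0, 1:]\<^sup>2"

lemma poly_np [simp]: "poly np t = N t" by (simp add: np_def N_def power2_eq_square algebra_simps)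
lemma poly_mp [simp]: "poly mp t = m t" by (simp add: mp_def m_def)
lemma poly_xp [simp]: "poly xp t = X t"
  using d_nz by (simp add: xp_def X_def power2_eq_square field_simps)
lemma poly_yp [simp]: "poly yp t = y t" by (simp add: yp_def y_def algebra_simps)
lemma poly_kpoly [simp]: "poly kpoly t = Kfun t"
  by (simp add: kpoly_def Kfun_def power2_eq_square algebra_simps)

lemma np_nz: "np \<noteq> 0" and mp_nz: "mp \<noteq> 0" by (simp_all add: np_def mp_def)

lemma yp_nz: "yp \<noteq> 0" using y_1 poly_yp by (metis poly_0)

lemma kpoly_nz: "kpoly \<noteq> 0"
proof -
  have "Kfun 1 \<noteq> 0" using k_nz N_1 y_1 by (simp add: Kfun_def)
  then show ?thesis using poly_kpoly by (metis poly_0)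
qed

lemma poly_altdef_le:
  fixes p :: "complex poly"
  assumes "degree p \<le> n"
  shows "poly p x = (\<Sum>i\<le>n. coeff p i * x ^ i)"
  unfolding poly_altdef
  by (rule sum.mono_neutral_left) (use assms in \<open>auto intro: coeff_eq_0\<close>)

section \<open>The remainder on the surface\<close>

text \<open>
  \<open>m\<^sup>n Q(z)\<close> as a polynomial in \<open>t\<close>. Unlike \<open>Q(z)\<close> it has no poles over \<open>z = \<infinity>\<close>, so that
  zeros of \<open>Q\<close> near infinity need no separate treatment.
\<close>

definition homogenize :: "nat \<Rightarrow> complex poly \<Rightarrow> complex poly" where
  "homogenize n Q = (\<Sum>i\<le>n. smult (coeff Q i) (xp ^ i * mp ^ (n - i)))"

lemma poly_homogenize:
  assumes "degree Q \<le> n" "m t \<noteq> 0"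
  shows "poly (homogenize n Q) t = m t ^ n * poly Q (X t / m t)"
proof -
  have "poly (homogenize n Q) t = (\<Sum>i\<le>n. coeff Q i * (X t ^ i * m t ^ (n - i)))"
    by (simp add: homogenize_def poly_sum)
  also have "\<dots> = (\<Sum>i\<le>n. m t ^ n * (coeff Q i * (X t / m t) ^ i))"
  proof (rule sum.cong[OF refl])
    fix i assume "i \<in> {..n}"
    then have "m t ^ n = m t ^ i * m t ^ (n - i)" by (simp flip: power_add)
    then show "coeff Q i * (X t ^ i * m t ^ (n - i)) = m t ^ n * (coeff Q i * (X t / m t) ^ i)"
      using assms(2) by (simp add: power_divide)
  qed
  also have "\<dots> = m t ^ n * poly Q (X t / m t)"
    using assms(1) by (simp add: poly_altdef_le sum_distrib_left)
  finally show ?thesis .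
qed

text \<open>
  The remainder \<open>Q\<^sub>0 + Q\<^sub>1 f + Q\<^sub>2 f\<^sup>2 + Q\<^sub>3 f\<^sup>3\<close> without its denominator \<open>m\<^sup>n (t\<^sup>2 - 1)\<^sup>3\<close>.
\<close>

definition rempoly :: "nat \<Rightarrow> (nat \<Rightarrow> complex poly) \<Rightarrow> complex poly" where
  "rempoly n Q = (\<Sum>j\<le>3. smult (k ^ j) (homogenize n (Q j) * np ^ j * [:-1, 0, 1:] ^ (3 - j)))"

definition remainder :: "(nat \<Rightarrow> complex poly) \<Rightarrow> complex \<Rightarrow> complex" where
  "remainder Q t = (\<Sum>j\<le>3. poly (Q j) (X t / m t) * F t ^ j)"

lemma poly_rempoly:
  assumes "\<And>j. j \<le> 3 \<Longrightarrow> degree (Q j) \<le> n" "m t \<noteq> 0" "t\<^sup>2 \<noteq> 1"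
  shows "poly (rempoly n Q) t = m t ^ n * (t\<^sup>2 - 1) ^ 3 * remainder Q t"
proof -
  have *: "poly [:-1, 0, 1:] t = t\<^sup>2 - 1" by (simp add: power2_eq_square)
  have "poly (rempoly n Q) t = (\<Sum>j\<le>3. k ^ j * (m t ^ n * poly (Q j) (X t / m t) * N t ^ j * (t\<^sup>2 - 1) ^ (3 - j)))"
    unfolding rempoly_def poly_sum poly_smult poly_mult poly_power poly_np *
    using assms by (intro sum.cong refl) (simp add: poly_homogenize)
  also have "\<dots> = (\<Sum>j\<le>3. m t ^ n * (t\<^sup>2 - 1) ^ 3 * (poly (Q j) (X t / m t) * F t ^ j))"
  proof (rule sum.cong[OF refl])
    fix j :: nat assume "j \<in> {..3}"
    then have "(t\<^sup>2 - 1) ^ 3 = (t\<^sup>2 - 1) ^ j * (t\<^sup>2 - 1) ^ (3 - j)" by (simp flip: power_add)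
    moreover have "t\<^sup>2 - 1 \<noteq> 0" using assms(3) by simp
    ultimately show "k ^ j * (m t ^ n * poly (Q j) (X t / m t) * N t ^ j * (t\<^sup>2 - 1) ^ (3 - j)) =
        m t ^ n * (t\<^sup>2 - 1) ^ 3 * (poly (Q j) (X t / m t) * F t ^ j)"
      by (simp add: F_def power_divide power_mult_distrib)
  qed
  finally show ?thesis by (simp add: remainder_def sum_distrib_left)
qed

text \<open>
  Solving the four equations for the remainders on a fibre gives
  \<open>lhs_coeff j * homogenize n (Q j) = rhs_coeff j * (rempoly n Q + error)\<close>, where the error collects the
  contributions of the other three points.
\<close>

definition lhs_coeff :: "nat \<Rightarrow> complex poly" where
  "lhs_coeff j = (if j = 0 then smult (-2) (kpoly * [:-1, 0, 1:]) else if j = 1 then smult (-2 * k) (kpoly * np)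
     else if j = 2 then smult 2 (kpoly * [:-1, 0, 1:]) else smult (2 * k) (kpoly * np))"

definition rhs_coeff :: "nat \<Rightarrow> complex poly" where
  "rhs_coeff j = (if j \<le> 1 then [:0, 0, 1:] else yp)"

lemma lhs_coeff_nz: "lhs_coeff j \<noteq> 0"
proof -
  have "kpoly * [:-1, 0, 1:] \<noteq> 0" "kpoly * np \<noteq> 0" using kpoly_nz np_nz by (subst mult_eq_0_iff, simp)+
  then show ?thesis unfolding lhs_coeff_def using k_nz by (simp del: mult_pCons_right mult_pCons_left)
qed

lemma rhs_coeff_nz: "rhs_coeff j \<noteq> 0" using yp_nz by (simp add: rhs_coeff_def)

lemma at_most_3_cases [consumes 1, case_names zero one two three]: "(j::nat) \<le> 3 \<Longrightarrow> (j = 0 \<Longrightarrow> R) \<Longrightarrow> (j = 1 \<Longrightarrow> R) \<Longrightarrow> (j = 2 \<Longrightarrow> R) \<Longrightarrow> (j = 3 \<Longrightarrow> R) \<Longrightarrow> R"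
  by linarith

text \<open>
  A norm on cubics that dominates their size on the unit disc and, after reversal of the
  coefficients, outside of it.
\<close>

definition coeff_norm :: "complex poly \<Rightarrow> real" where "coeff_norm P = (\<Sum>i\<le>3. cmod (coeff P i))"

lemma coeff_norm_nonneg: "coeff_norm P \<ge> 0" by (simp add: coeff_norm_def sum_nonneg)

lemma coeff_norm_eq_0: "degree P \<le> 3 \<Longrightarrow> coeff_norm P = 0 \<Longrightarrow> P = 0"
proof (rule poly_eqI)
  fix i assume "degree P \<le> 3" "coeff_norm P = 0"
  then show "coeff P i = coeff 0 i"
    by (cases "i \<le> 3") (auto simp: coeff_norm_def sum_nonneg_eq_0_iff intro: coeff_eq_0)
qed

lemma poly_cubic: "degree P \<le> 3 \<Longrightarrow> poly P (t::complex) = (\<Sum>i\<le>3. coeff P i * t ^ i)"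
  by (rule poly_altdef_le)

lemma norm_poly_le_coeff_norm:
  assumes "degree P \<le> 3" "cmod t \<le> 1"
  shows "cmod (poly P t) \<le> coeff_norm P"
  unfolding coeff_norm_def poly_cubic[OF assms(1)]
proof (intro order_trans[OF norm_sum] sum_mono)
  fix i show "cmod (coeff P i * t ^ i) \<le> cmod (coeff P i)"
    using assms(2) by (simp add: norm_mult norm_power mult_left_le power_le_one)
qed

lemma norm_poly_recip_le_coeff_norm:
  assumes "degree P \<le> 3" "cmod t \<le> 1" "t \<noteq> 0"
  shows "cmod (t ^ 6 * poly P (1 / t)) \<le> coeff_norm P"
  unfolding coeff_norm_def poly_cubic[OF assms(1)] sum_distrib_left
proof (intro order_trans[OF norm_sum] sum_mono)
  fix i :: nat assume "i \<in> {..3}"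
  then have "t ^ 6 = t ^ i * t ^ (6 - i)" by (simp flip: power_add)
  then have eq: "t ^ 6 * (coeff P i * (1 / t) ^ i) = coeff P i * t ^ (6 - i)"
    using assms(3) by (simp add: power_divide)
  show "cmod (t ^ 6 * (coeff P i * (1 / t) ^ i)) \<le> cmod (coeff P i)"
    unfolding eq norm_mult norm_power using assms(2) by (simp add: mult_left_le power_le_one)
qed

text \<open>
  A gap by a factor \<open>q\<close> in either of the inequalities that define \<open>\<Omega>\<close> is a gap in \<open>|m|\<close>.
\<close>

lemma m_ratio:
  assumes p: "paired t t'" and q: "0 < q" "q < 1"
    and g: "cmod (d * N t) < q * (2 * cmod t') \<or> 2 * cmod t < q * cmod (d * N t')"
  shows "cmod (m t) \<le> q * cmod (m t')"
proof -
  have eq: "(cmod d)\<^sup>2 * cmod (N t) * cmod (N t') = 4 * cmod t * cmod t'"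
    using arg_cong[OF p[unfolded paired_def], of cmod] by (simp add: norm_mult norm_power)
  have q2: "q\<^sup>2 \<le> q" using q by (simp add: power2_eq_square)
  from g have "cmod (m t) \<le> q\<^sup>2 * cmod (m t')"
  proof
    assume a: "cmod (d * N t) < q * (2 * cmod t')"
    show ?thesis
    proof (cases "N t = 0")
      case False
      then have pos: "(cmod (d * N t))\<^sup>2 > 0" using d_nz by simp
      have "cmod (m t) * (cmod (d * N t))\<^sup>2 \<le> cmod (m t) * (q * (2 * cmod t'))\<^sup>2"
        using a by (intro mult_left_mono power_mono) auto
      also have "\<dots> = q\<^sup>2 * (cmod (N t) * cmod t' * (4 * cmod t * cmod t'))"
        by (simp add: m_def norm_mult power2_eq_square)
      also have "\<dots> = (q\<^sup>2 * cmod (m t')) * (cmod (d * N t))\<^sup>2"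
        unfolding eq[symmetric] by (simp add: m_def norm_mult power2_eq_square)
      finally show ?thesis using pos by simp
    qed (simp add: m_def)
  next
    assume a: "2 * cmod t < q * cmod (d * N t')"
    have "0 < q * cmod (d * N t')" using a norm_ge_zero[of t] by linarith
    then have "cmod (d * N t') > 0" using q(1) by (simp only: zero_less_mult_iff) linarith
    then have pos: "(cmod (d * N t'))\<^sup>2 > 0" by simp
    have "cmod (m t) * (cmod (d * N t'))\<^sup>2 = cmod t * cmod (N t') * ((cmod d)\<^sup>2 * cmod (N t) * cmod (N t'))"
      by (simp add: m_def norm_mult power2_eq_square)
    also have "\<dots> = (2 * cmod t)\<^sup>2 * cmod (m t')"
      unfolding eq by (simp add: m_def norm_mult power2_eq_square)
    also have "\<dots> \<le> (q * cmod (d * N t'))\<^sup>2 * cmod (m t')"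
      using a by (intro mult_right_mono power_mono) auto
    also have "\<dots> = (q\<^sup>2 * cmod (m t')) * (cmod (d * N t'))\<^sup>2"
      by (simp add: power2_eq_square)
    finally show ?thesis using pos by simp
  qed
  also have "\<dots> \<le> q * cmod (m t')" using q2 by (intro mult_right_mono) auto
  finally show ?thesis .
qed

lemma continuous_on_N: "continuous_on U N" and continuous_on_m: "continuous_on U m"
  and continuous_on_X: "continuous_on U X"
  unfolding N_def[abs_def] m_def[abs_def] X_def[abs_def]
  using d_nz by (auto intro!: continuous_intros)

lemma tendsto_N: "(f \<longlongrightarrow> l) G \<Longrightarrow> ((\<lambda>x. N (f x)) \<longlongrightarrow> N l) G"
  unfolding N_def by (intro tendsto_intros)

definition gapped :: "real \<Rightarrow> complex \<Rightarrow> bool" where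
  "gapped q t \<longleftrightarrow> cmod t < q \<and> (\<forall>t'. cmod t' \<le> 1 \<and> paired t t' \<longrightarrow>
        cmod (d * N t) < q * (2 * cmod t') \<or> 2 * cmod t < q * cmod (d * N t'))"

text \<open>
  The inequalities that define \<open>\<Omega>\<close> hold uniformly near each of its points. Otherwise there are
  points tending to \<open>p\<close> with competitors in the closed disc that violate them almost, and a limit
  point of these competitors violates them at \<open>p\<close>.
\<close>

lemma Omega_gap:
  assumes "p \<in> \<Omega>"
  shows "\<exists>r>0. \<exists>q>0. q < 1 \<and> (\<forall>t\<in>cball p r. gapped q t)"
proof -
  define qq where "qq i = 1 - 1 / real (i + 2)" for i
  have qq: "0 < qq i" "qq i < 1" for i by (auto simp: qq_def)
  have qlim: "qq \<longlonglongrightarrow> 1"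
  proof -
    have "(\<lambda>i. 1 - 1 / real (i + 2)) \<longlonglongrightarrow> 1 - 0"
      by (intro tendsto_diff tendsto_const LIMSEQ_ignore_initial_segment[OF lim_1_over_n])
    then show ?thesis by (simp add: qq_def[abs_def])
  qed
  have "\<exists>i. \<forall>t\<in>cball p (1 / real (i + 1)). gapped (qq i) t"
  proof (rule ccontr)
    assume "\<not> ?thesis"
    then have "\<forall>i. \<exists>t. t \<in> cball p (1 / real (i + 1)) \<and> \<not> gapped (qq i) t" by blast
    then obtain t where t: "\<And>i. t i \<in> cball p (1 / real (i + 1))" "\<And>i. \<not> gapped (qq i) (t i)"
      by metis
    have tlim: "t \<longlonglongrightarrow> p"
    proof (rule metric_LIMSEQ_I)
      fix \<epsilon> :: real assume "\<epsilon> > 0"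
      then obtain n0 where n0: "1 / real (Suc n0) < \<epsilon>" using nat_approx_posE by blast
      have "dist (t i) p < \<epsilon>" if "i \<ge> n0" for i
      proof -
        have "dist (t i) p \<le> 1 / real (i + 1)" using t(1)[of i] by (simp add: dist_commute)
        also have "\<dots> \<le> 1 / real (Suc n0)" using that by (simp add: frac_le)
        finally show ?thesis using n0 by simp
      qed
      then show "\<exists>no. \<forall>n\<ge>no. dist (t n) p < \<epsilon>" by blast
    qed
    have "\<forall>\<^sub>F i in sequentially. cmod (t i) < qq i"
    proof -
      have "(\<lambda>i. qq i - cmod (t i)) \<longlonglongrightarrow> 1 - cmod p" using tlim qlim by (intro tendsto_intros)
      then have "\<forall>\<^sub>F i in sequentially. qq i - cmod (t i) > 0"
        by (rule order_tendstoD) (use assms in \<open>auto simp: \<Omega>_def\<close>)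
      then show ?thesis by (simp add: algebra_simps)
    qed
    then obtain i0 where i0: "\<And>i. i \<ge> i0 \<Longrightarrow> cmod (t i) < qq i"
      by (auto simp: eventually_sequentially)
    have "\<exists>t'. cmod t' \<le> 1 \<and> paired (t (i + i0)) t' \<and> qq (i + i0) * (2 * cmod t') \<le> cmod (d * N (t (i + i0)))
        \<and> qq (i + i0) * cmod (d * N t') \<le> 2 * cmod (t (i + i0))" for i
      using t(2)[of "i + i0"] i0[of "i + i0"] by (auto simp: not_less gapped_def)
    then obtain t' where t': "\<And>i. cmod (t' i) \<le> 1" "\<And>i. paired (t (i + i0)) (t' i)"
       "\<And>i. qq (i + i0) * (2 * cmod (t' i)) \<le> cmod (d * N (t (i + i0)))"
       "\<And>i. qq (i + i0) * cmod (d * N (t' i)) \<le> 2 * cmod (t (i + i0))" by metis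
    have "compact (cball (0::complex) 1)" by simp
    then obtain l s where l: "l \<in> cball 0 1" "strict_mono s" "(t' \<circ> s) \<longlonglongrightarrow> l"
      using t'(1) by (metis (no_types, lifting) compact_imp_seq_compact mem_cball_0 seq_compactE)
    have s': "filterlim (\<lambda>i. s i + i0) at_top sequentially"
      by (rule filterlim_subseq) (use l(2) in \<open>simp add: strict_mono_def\<close>)
    have T: "(\<lambda>i. t (s i + i0)) \<longlonglongrightarrow> p" "(\<lambda>i. qq (s i + i0)) \<longlonglongrightarrow> 1" "(\<lambda>i. t' (s i)) \<longlonglongrightarrow> l"
      using filterlim_compose[OF tlim s'] filterlim_compose[OF qlim s'] l(3) by (simp_all add: o_def)
    note TN = tendsto_N[OF T(1)] tendsto_N[OF T(3)]
    have "(\<lambda>i. d\<^sup>2 * N (t (s i + i0)) * N (t' (s i)) - 4 * t (s i + i0) * t' (s i)) \<longlonglongrightarrow> d\<^sup>2 * N p * N l - 4 * p * l"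
      by (intro tendsto_intros T TN)
    moreover have "d\<^sup>2 * N (t (s i + i0)) * N (t' (s i)) - 4 * t (s i + i0) * t' (s i) = 0" for i
      using t'(2)[of "s i"] by (simp add: paired_def)
    ultimately have "paired p l" by (simp add: paired_def LIMSEQ_const_iff)
    moreover have "1 * (2 * cmod l) \<le> cmod (d * N p)"
    proof (rule LIMSEQ_le)
      show "(\<lambda>i. qq (s i + i0) * (2 * cmod (t' (s i)))) \<longlonglongrightarrow> 1 * (2 * cmod l)" by (intro tendsto_intros T)
      show "(\<lambda>i. cmod (d * N (t (s i + i0)))) \<longlonglongrightarrow> cmod (d * N p)" by (intro tendsto_intros TN)
    qed (use t'(3) in auto)
    moreover have "1 * cmod (d * N l) \<le> 2 * cmod p"
    proof (rule LIMSEQ_le)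
      show "(\<lambda>i. qq (s i + i0) * cmod (d * N (t' (s i)))) \<longlonglongrightarrow> 1 * cmod (d * N l)" by (intro tendsto_intros T TN)
      show "(\<lambda>i. 2 * cmod (t (s i + i0))) \<longlonglongrightarrow> 2 * cmod p" by (intro tendsto_intros T)
    qed (use t'(4) in auto)
    ultimately show False using assms l(1) by (fastforce simp: \<Omega>_def)
  qed
  then obtain i where "\<forall>t\<in>cball p (1 / real (i + 1)). gapped (qq i) t" by blast
  then show ?thesis using qq by (intro exI[of _ "1 / real (i + 1)"] conjI exI[of _ "qq i"]) auto
qed

lemma gapped_imp_Omega:
  assumes q: "0 < q" "q < 1" and g: "gapped q t"
  shows "t \<in> \<Omega>"
proof -
  have less: "x < b" if "x < q * b" "0 \<le> b" for x b :: real
    using that q mult_right_mono[of q 1 b] by simp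
  have "cmod (d * N t) < 2 * cmod t' \<or> 2 * cmod t < cmod (d * N t')"
    if "cmod t' \<le> 1" "paired t t'" for t'
  proof -
    from that g have "cmod (d * N t) < q * (2 * cmod t') \<or> 2 * cmod t < q * cmod (d * N t')"
      by (auto simp: gapped_def)
    then show ?thesis by (elim disj_forward) (rule less; simp)+
  qed
  moreover have "cmod t < 1" using g q by (simp add: gapped_def)
  ultimately show ?thesis by (auto simp: \<Omega>_def)
qed

lemma open_Omega: "open \<Omega>"
  unfolding open_contains_cball
  using Omega_gap gapped_imp_Omega by (meson subsetI)

lemma exists_paired:
  assumes "t \<noteq> 0" "N t \<noteq> 0"
  obtains t' where "cmod t' \<le> 1" "t' \<noteq> 0" "paired t t'"
proof -
  define v where "v = 2 * t / (d\<^sup>2 * N t) - e"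
  define t' where "t' = 1 / phi v"
  have t': "t' \<noteq> 0" "cmod t' \<le> 1" using norm_phi_ge_1[of v] by (auto simp: t'_def norm_divide divide_le_eq)
  have "1 / t' + t' = 2 * v" using phi_add_inverse[of v] by (simp add: t'_def)
  then have "N t' = 2 * (v + e) * t'" using t'(1) by (simp add: N_def field_simps power2_eq_square)
  then have "paired t t'" using assms d_nz by (simp add: paired_def v_def)
  then show ?thesis using that t' by blast
qed

text \<open>
  Where it does not vanish, the four points of the fibre are finite and distinct from the poles and
  zeros of \<open>f\<close>, and inversion of the linear system is unproblematic.
\<close>

definition excpoly :: "complex poly" where "excpoly = [:0, 1:] * np * yp * [:-1, 0, 1:]"

lemma excpoly_nz: "excpoly \<noteq> 0"
  using np_nz yp_nz by (simp add: excpoly_def del: mult_pCons_left mult_pCons_right)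

lemma poly_excpoly: "poly excpoly t = t * N t * y t * (t\<^sup>2 - 1)"
  by (simp add: excpoly_def power2_eq_square algebra_simps del: mult_pCons_left mult_pCons_right)

text \<open>
  Over a fibre \<open>t, 1 / t, t', 1 / t'\<close> the function \<open>f\<close> takes the values \<open>\<plusminus>a, \<plusminus>b\<close>. Half the sums and
  differences of the remainders at opposite points are \<open>Q\<^sub>0 + Q\<^sub>2 a\<^sup>2\<close>, \<open>Q\<^sub>1 a + Q\<^sub>3 a\<^sup>3\<close> and the same
  with \<open>b\<close>, and two such equations determine two coefficients. The relation \<open>y b\<^sup>2 = t\<^sup>2\<close>
  eliminates the squares of \<open>b\<close>.
\<close>

lemma error_formula:
  assumes deg: "\<And>j. j \<le> 3 \<Longrightarrow> degree (Q j) \<le> n"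
    and gen: "poly excpoly t \<noteq> 0" and p: "paired t t'" and j: "j \<le> 3"
  defines "\<Delta> \<equiv> m t ^ n * (t\<^sup>2 - 1) ^ 3"
  defines "W1 \<equiv> \<Delta> * remainder Q (1 / t)" and "W2 \<equiv> \<Delta> * remainder Q t'" and "W3 \<equiv> \<Delta> * remainder Q (1 / t')"
  shows "poly (lhs_coeff j * homogenize n (Q j) - rhs_coeff j * rempoly n Q) t =
    (if j = 0 then t\<^sup>2 * W1 - y t * (F t)\<^sup>2 * (W2 + W3)
     else if j = 1 then - (t\<^sup>2 * W1) - y t * (F t) ^ 3 / F t' * (W2 - W3)
     else if j = 2 then y t * (W1 - W2 - W3)
     else - (y t * W1) - y t * F t / F t' * (W2 - W3))" (is "?L = _")
    and "t' \<noteq> 0" "N t' \<noteq> 0" "t'\<^sup>2 \<noteq> 1"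
proof -
  have t: "t \<noteq> 0" "N t \<noteq> 0" "y t \<noteq> 0" "t\<^sup>2 \<noteq> 1" "t\<^sup>2 - 1 \<noteq> 0" using gen by (auto simp: poly_excpoly)
  have t': "t' \<noteq> 0" using p t d_nz by (auto simp: paired_def)
  then have Nt': "N t' \<noteq> 0" using p t d_nz by (auto simp: paired_def)
  have t'1: "t'\<^sup>2 \<noteq> 1" using y_paired[OF p] t Nt' by auto
  show "t' \<noteq> 0" "N t' \<noteq> 0" "t'\<^sup>2 \<noteq> 1" by fact+
  have m0: "m t \<noteq> 0" "m t' \<noteq> 0" using t t' Nt' by (auto simp: m_def)
  define b where "b = F t'"
  have b0: "b \<noteq> 0" using Nt' t'1 k_nz by (simp add: b_def F_def)
  have yb: "y t * b\<^sup>2 = t\<^sup>2"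
  proof -
    have "y t * b\<^sup>2 = k\<^sup>2 * (y t * (N t')\<^sup>2) / (t'\<^sup>2 - 1)\<^sup>2"
      by (simp add: b_def F_def power_divide power_mult_distrib mult_ac)
    also have "\<dots> = (k\<^sup>2 * (A * B)) * t\<^sup>2" unfolding y_paired[OF p] using t'1 by simp
    finally show ?thesis using k_square by simp
  qed
  have z: "X (1 / t) / m (1 / t) = X t / m t" "X t' / m t' = X t / m t" "X (1 / t') / m (1 / t') = X t / m t"
    using paired_same_z[OF p] m0 t t' by (simp_all add: X_recip m_recip field_simps)
  define a where "a j = poly (Q j) (X t / m t)" for j
  have sum3: "(\<Sum>j\<le>3. g j) = g 0 + g 1 + g 2 + g (3::nat)" for g :: "nat \<Rightarrow> complex"
    by (simp add: eval_nat_numeral)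
  have S: "remainder Q t = a 0 + a 1 * F t + a 2 * (F t)\<^sup>2 + a 3 * (F t) ^ 3"
    "remainder Q (1 / t) = a 0 - a 1 * F t + a 2 * (F t)\<^sup>2 - a 3 * (F t) ^ 3"
    "remainder Q t' = a 0 + a 1 * b + a 2 * b\<^sup>2 + a 3 * b ^ 3"
    "remainder Q (1 / t') = a 0 - a 1 * b + a 2 * b\<^sup>2 - a 3 * b ^ 3"
    unfolding remainder_def z sum3 using t t' t'1 by (simp_all add: F_recip a_def b_def)
  define w Z where "w = t\<^sup>2 - 1" and "Z = (F t)\<^sup>2 * y t - t\<^sup>2"
  have Ft: "k * N t = F t * w" using t by (simp add: F_def w_def)
  have K: "Kfun t = w\<^sup>2 * Z"
  proof -
    have "Kfun t = (k * N t)\<^sup>2 * y t - t\<^sup>2 * w\<^sup>2" by (simp add: Kfun_def power_mult_distrib w_def)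
    also have "\<dots> = w\<^sup>2 * Z" unfolding Ft Z_def by (simp add: power2_eq_square algebra_simps)
    finally show ?thesis .
  qed
  have \<Delta>w: "\<Delta> = m t ^ n * w ^ 3" by (simp add: \<Delta>_def w_def)
  have H: "poly (homogenize n (Q j)) t = m t ^ n * a j" unfolding a_def using deg[OF j] m0 by (simp add: poly_homogenize)
  have P: "poly (rempoly n Q) t = \<Delta> * remainder Q t" unfolding \<Delta>_def using deg m0 t by (simp add: poly_rempoly)
  have pw: "poly [:-1, 0, 1:] t = w" "poly [:0, 0, 1:] t = t\<^sup>2" by (simp_all add: power2_eq_square w_def)
  note del = poly_pCons mult_pCons_left mult_pCons_right
  have odd: "remainder Q t' - remainder Q (1 / t') = b * (2 * a 1 + 2 * a 3 * b\<^sup>2)"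
    unfolding S by (simp add: power2_eq_square power3_eq_cube algebra_simps)
  from j show "?L = (if j = 0 then t\<^sup>2 * W1 - y t * (F t)\<^sup>2 * (W2 + W3)
     else if j = 1 then - (t\<^sup>2 * W1) - y t * (F t) ^ 3 / F t' * (W2 - W3)
     else if j = 2 then y t * (W1 - W2 - W3)
     else - (y t * W1) - y t * F t / F t' * (W2 - W3))"
  proof (cases rule: at_most_3_cases)
    case zero
    have "?L = - 2 * (Kfun t * w) * (m t ^ n * a 0) - t\<^sup>2 * (\<Delta> * remainder Q t)"
      using zero H P pw by (simp add: lhs_coeff_def rhs_coeff_def del: del)
    also have "\<dots> = \<Delta> * (- 2 * Z * a 0 - t\<^sup>2 * remainder Q t)"
      unfolding K \<Delta>w by (simp add: power2_eq_square power3_eq_cube algebra_simps)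
    also have "- 2 * Z * a 0 - t\<^sup>2 * remainder Q t =
        t\<^sup>2 * remainder Q (1 / t) - y t * (F t)\<^sup>2 * (remainder Q t' + remainder Q (1 / t'))"
      unfolding S Z_def yb[symmetric] by (simp add: power2_eq_square power3_eq_cube algebra_simps)
    finally show ?thesis using zero by (simp add: W1_def W2_def W3_def algebra_simps)
  next
    case one
    have "?L = - 2 * (k * N t) * Kfun t * (m t ^ n * a 1) - t\<^sup>2 * (\<Delta> * remainder Q t)"
      using one H P pw by (simp add: lhs_coeff_def rhs_coeff_def del: del)
    also have "\<dots> = \<Delta> * (- 2 * Z * F t * a 1 - t\<^sup>2 * remainder Q t)"
      unfolding K Ft \<Delta>w by (simp add: power2_eq_square power3_eq_cube algebra_simps)
    also have "- 2 * Z * F t * a 1 - t\<^sup>2 * remainder Q t =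
        - (t\<^sup>2 * remainder Q (1 / t)) - y t * (F t) ^ 3 / b * (remainder Q t' - remainder Q (1 / t'))"
    proof -
      have "y t * (F t) ^ 3 / b * (remainder Q t' - remainder Q (1 / t')) = y t * (F t) ^ 3 * (2 * a 1 + 2 * a 3 * b\<^sup>2)"
        unfolding odd using b0 by simp
      then show ?thesis unfolding S(1,2) Z_def yb[symmetric]
        by (simp add: power2_eq_square power3_eq_cube algebra_simps)
    qed
    finally show ?thesis using one by (simp add: W1_def W2_def W3_def b_def algebra_simps)
  next
    case two
    have "?L = 2 * (Kfun t * w) * (m t ^ n * a 2) - y t * (\<Delta> * remainder Q t)"
      using two H P pw by (simp add: lhs_coeff_def rhs_coeff_def del: del)
    also have "\<dots> = \<Delta> * (2 * Z * a 2 - y t * remainder Q t)"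
      unfolding K \<Delta>w by (simp add: power2_eq_square power3_eq_cube algebra_simps)
    also have "2 * Z * a 2 - y t * remainder Q t = y t * (remainder Q (1 / t) - remainder Q t' - remainder Q (1 / t'))"
      unfolding S Z_def yb[symmetric] by (simp add: power2_eq_square power3_eq_cube algebra_simps)
    finally show ?thesis using two by (simp add: W1_def W2_def W3_def algebra_simps)
  next
    case three
    have "?L = 2 * (k * N t) * Kfun t * (m t ^ n * a 3) - y t * (\<Delta> * remainder Q t)"
      using three H P pw by (simp add: lhs_coeff_def rhs_coeff_def del: del)
    also have "\<dots> = \<Delta> * (2 * Z * F t * a 3 - y t * remainder Q t)"
      unfolding K Ft \<Delta>w by (simp add: power2_eq_square power3_eq_cube algebra_simps)
    also have "2 * Z * F t * a 3 - y t * remainder Q t =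
        - (y t * remainder Q (1 / t)) - y t * F t / b * (remainder Q t' - remainder Q (1 / t'))"
    proof -
      have "y t * F t / b * (remainder Q t' - remainder Q (1 / t')) = y t * F t * (2 * a 1 + 2 * a 3 * b\<^sup>2)"
        unfolding odd using b0 by simp
      then show ?thesis unfolding S(1,2) Z_def yb[symmetric]
        by (simp add: power2_eq_square power3_eq_cube algebra_simps)
    qed
    finally show ?thesis using three
      by (simp add: W1_def W2_def W3_def b_def diff_divide_distrib algebra_simps)
  qed
qed

text \<open>
  The remainder at another point of the fibre carries the factor \<open>(m t / m t')\<^sup>n\<close> relative to the
  chosen one; everything else is bounded in terms of the cubic numerator.
\<close>

lemma conjugate_remainder_bounds:
  assumes deg: "\<And>j. j \<le> 3 \<Longrightarrow> degree (Q j) \<le> n"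
    and deg3: "degree (rempoly n Q) \<le> 3"
    and gen: "poly excpoly t \<noteq> 0" and p: "paired t t'" and t1: "cmod t \<le> 1" "cmod t' \<le> 1"
    and q: "0 \<le> q" "cmod t ^ 4 \<le> q" "cmod (m t) \<le> q * cmod (m t')"
    and R: "cmod ((t\<^sup>2 - 1) / (t'\<^sup>2 - 1)) \<le> R"
  defines "\<Delta> \<equiv> m t ^ n * (t\<^sup>2 - 1) ^ 3"
  shows "cmod (\<Delta> * remainder Q (1 / t)) \<le> q ^ n * coeff_norm (rempoly n Q)"
    "cmod (\<Delta> * remainder Q t') \<le> R ^ 3 * q ^ n * coeff_norm (rempoly n Q)"
    "cmod (\<Delta> * remainder Q (1 / t')) \<le> R ^ 3 * q ^ n * coeff_norm (rempoly n Q)"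
proof -
  let ?P = "rempoly n Q"
  have t: "t \<noteq> 0" "N t \<noteq> 0" "t\<^sup>2 \<noteq> 1" "t\<^sup>2 - 1 \<noteq> 0" using gen by (auto simp: poly_excpoly)
  have t': "t' \<noteq> 0" "N t' \<noteq> 0" "t'\<^sup>2 \<noteq> 1" using error_formula(2-4)[OF deg gen p le0] by auto
  have m0: "m t \<noteq> 0" "m t' \<noteq> 0" using t t' by (auto simp: m_def)
  have rec: "m s ^ n * (s\<^sup>2 - 1) ^ 3 * remainder Q (1 / s) = - (s ^ (4 * n) * (s ^ 6 * poly ?P (1 / s)))"
    if "s \<noteq> 0" "s\<^sup>2 \<noteq> 1" "m s \<noteq> 0" for s
  proof -
    have "poly ?P (1 / s) = m (1 / s) ^ n * ((1 / s)\<^sup>2 - 1) ^ 3 * remainder Q (1 / s)"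
      using that deg by (intro poly_rempoly) (auto simp: m_recip power_divide)
    also have "(1 / s)\<^sup>2 - 1 = - ((s\<^sup>2 - 1) / s\<^sup>2)" using that by (simp add: power_divide diff_divide_distrib)
    finally have "poly ?P (1 / s) = - (m s ^ n * (s\<^sup>2 - 1) ^ 3 * remainder Q (1 / s) / (s ^ (4 * n) * s ^ 6))"
      using that by (simp add: m_recip power_divide power_minus_odd flip: power_mult)
    then show ?thesis using that by simp
  qed
  have "\<Delta> * remainder Q (1 / t) = - (t ^ (4 * n) * (t ^ 6 * poly ?P (1 / t)))"
    unfolding \<Delta>_def using t m0 by (intro rec) auto
  then have "cmod (\<Delta> * remainder Q (1 / t)) = (cmod t ^ 4) ^ n * cmod (t ^ 6 * poly ?P (1 / t))"
    by (simp add: norm_mult norm_power power_mult)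
  also have "\<dots> \<le> q ^ n * coeff_norm ?P"
    using q t1 t deg3 by (intro mult_mono power_mono norm_poly_recip_le_coeff_norm) auto
  finally show "cmod (\<Delta> * remainder Q (1 / t)) \<le> q ^ n * coeff_norm ?P" .
  define \<rho> where "\<rho> = (m t / m t') ^ n * ((t\<^sup>2 - 1) / (t'\<^sup>2 - 1)) ^ 3"
  have D: "\<Delta> = \<rho> * (m t' ^ n * (t'\<^sup>2 - 1) ^ 3)"
    unfolding \<Delta>_def \<rho>_def using m0 t'(3) by (simp add: power_divide)
  have "cmod (m t / m t') \<le> q" using q(3) m0 by (simp add: norm_divide divide_le_eq)
  then have \<rho>: "cmod \<rho> \<le> q ^ n * R ^ 3"
    unfolding \<rho>_def norm_mult norm_power using R q(1) by (intro mult_mono power_mono) auto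
  have qR: "0 \<le> q ^ n * R ^ 3" using \<rho> norm_ge_zero order_trans by blast
  have "\<Delta> * remainder Q t' = \<rho> * poly ?P t'"
    unfolding D using t' m0 deg by (subst poly_rempoly) auto
  then have "cmod (\<Delta> * remainder Q t') = cmod \<rho> * cmod (poly ?P t')" by (simp add: norm_mult)
  also have "\<dots> \<le> (q ^ n * R ^ 3) * coeff_norm ?P"
    using \<rho> qR deg3 t1 by (intro mult_mono norm_poly_le_coeff_norm) auto
  finally show "cmod (\<Delta> * remainder Q t') \<le> R ^ 3 * q ^ n * coeff_norm ?P" by (simp add: mult_ac)
  have "\<Delta> * remainder Q (1 / t') = \<rho> * - (t' ^ (4 * n) * (t' ^ 6 * poly ?P (1 / t')))"
    unfolding D mult.assoc[of \<rho>] using t' m0 by (subst rec) auto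
  then have "cmod (\<Delta> * remainder Q (1 / t')) = cmod \<rho> * (cmod t' ^ (4 * n) * cmod (t' ^ 6 * poly ?P (1 / t')))"
    by (simp add: norm_mult norm_power)
  also have "\<dots> \<le> (q ^ n * R ^ 3) * (1 * coeff_norm ?P)"
    using \<rho> qR deg3 t1 t' by (intro mult_mono norm_poly_recip_le_coeff_norm power_le_one) auto
  finally show "cmod (\<Delta> * remainder Q (1 / t')) \<le> R ^ 3 * q ^ n * coeff_norm ?P" by (simp add: mult_ac)
qed

lemma compact_paired:
  assumes "compact K"
  shows "compact {(t, t'). t \<in> K \<and> cmod t' \<le> 1 \<and> paired t t'}"
proof -
  have "closed {p. d\<^sup>2 * N (fst p) * N (snd p) = 4 * fst p * snd p}"
    unfolding N_def by (intro closed_Collect_eq continuous_intros)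
  with compact_Times[OF assms compact_cball[of "0::complex" 1]]
  have "compact ((K \<times> cball 0 1) \<inter> {p. d\<^sup>2 * N (fst p) * N (snd p) = 4 * fst p * snd p})"
    by (rule compact_Int_closed)
  moreover have "(K \<times> cball 0 1) \<inter> {p. d\<^sup>2 * N (fst p) * N (snd p) = 4 * fst p * snd p} =
     {(t, t'). t \<in> K \<and> cmod t' \<le> 1 \<and> paired t t'}" by (auto simp: paired_def)
  ultimately show ?thesis by simp
qed

text \<open>
  The bounds on the conjugate remainders break down at the zeros of \<open>excpoly\<close>. Since the error
  is a polynomial, it suffices to have them on a circle that avoids these points; the maximum modulus
  principle carries them over to the disc.
\<close>

lemma local_estimate:
  assumes "p \<in> \<Omega>"
  obtains r C q where "r > 0" "cball p r \<subseteq> \<Omega>" "0 \<le> q" "q < 1"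
    "\<And>n Q j t. (\<And>j. j \<le> 3 \<Longrightarrow> degree (Q j) \<le> n) \<Longrightarrow> degree (rempoly n Q) \<le> 3 \<Longrightarrow> j \<le> 3 \<Longrightarrow>
       t \<in> cball p r \<Longrightarrow>
       cmod (poly (lhs_coeff j * homogenize n (Q j) - rhs_coeff j * rempoly n Q) t) \<le> C * q ^ n * coeff_norm (rempoly n Q)"
proof -
  from Omega_gap[OF assms] obtain r0 q where r0: "r0 > 0" and q: "0 < q" "q < 1"
    and gq: "\<And>t. t \<in> cball p r0 \<Longrightarrow> gapped q t" by blast
  have g: "\<And>t. t \<in> cball p r0 \<Longrightarrow> cmod t < q"
    "\<And>t t'. t \<in> cball p r0 \<Longrightarrow> cmod t' \<le> 1 \<Longrightarrow> paired t t' \<Longrightarrow>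
        cmod (d * N t) < q * (2 * cmod t') \<or> 2 * cmod t < q * cmod (d * N t')"
    using gq unfolding gapped_def by blast+
  have "finite {t. poly excpoly t = 0}" using excpoly_nz by (rule poly_roots_finite)
  then obtain r1 where r1: "r1 > 0" "\<And>t. t \<in> {t. poly excpoly t = 0} \<Longrightarrow> t \<noteq> p \<Longrightarrow> r1 \<le> dist p t"
    using finite_set_avoid[of "{t. poly excpoly t = 0}" p] by auto
  \<comment> \<open>The circle of radius \<open>r\<close> contains no zero of \<open>excpoly\<close>, its centre being the only possible
    zero in the disc.\<close>
  define r where "r = min r0 (r1 / 2)"
  have r: "r > 0" "r \<le> r0" "r < r1" using r0 r1(1) by (auto simp: r_def)
  have sub: "cball p r \<subseteq> \<Omega>" using gq r q by (auto intro!: gapped_imp_Omega[of q])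
  have gen: "poly excpoly t \<noteq> 0" if "t \<in> sphere p r" for t using r1(2)[of t] that r by force
  let ?C = "{(t, t'). t \<in> sphere p r \<and> cmod t' \<le> 1 \<and> paired t t'}"
  have nz: "t' \<noteq> 0 \<and> N t' \<noteq> 0 \<and> t'\<^sup>2 \<noteq> 1 \<and> t\<^sup>2 \<noteq> 1" if "(t, t') \<in> ?C" for t t'
    using error_formula(2-4)[of "\<lambda>_. 0" 0 t t' 0] gen[of t] that by (auto simp: poly_excpoly)
  define \<Phi> where "\<Phi> p = (case p of (t, t') \<Rightarrow> 1 + cmod (y t) + cmod (y t * (F t)\<^sup>2) + cmod (y t * (F t) ^ 3 / F t')
     + cmod (y t * F t / F t') + cmod ((t\<^sup>2 - 1) / (t'\<^sup>2 - 1)))" for p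
  have "continuous_on ?C \<Phi>"
    unfolding \<Phi>_def case_prod_beta F_def y_def N_def
    by (intro continuous_intros) (use nz k_nz in \<open>auto simp: N_def\<close>)
  then have "bounded (\<Phi> ` ?C)"
    using compact_paired[OF compact_sphere] by (intro compact_imp_bounded compact_continuous_image) auto
  then obtain M where M0: "\<forall>v\<in>\<Phi> ` ?C. norm v \<le> M" unfolding bounded_iff by blast
  have M: "\<Phi> x \<le> M" if "x \<in> ?C" for x
  proof -
    have "norm (\<Phi> x) \<le> M" using M0 that by blast
    then show ?thesis by simp
  qed
  define C where "C = M * (1 + 2 * M ^ 3)"
  show ?thesis
  proof (rule that[of r q C])
    fix n Q j t
    assume deg: "\<And>j. j \<le> 3 \<Longrightarrow> degree (Q j) \<le> n" and deg3: "degree (rempoly n Q) \<le> 3"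
      and j: "j \<le> (3::nat)" and t: "t \<in> cball p r"
    let ?E = "lhs_coeff j * homogenize n (Q j) - rhs_coeff j * rempoly n Q"
    have circle: "cmod (poly ?E s) \<le> C * q ^ n * coeff_norm (rempoly n Q)" if s: "s \<in> sphere p r" for s
    proof -
      have sb: "s \<in> cball p r0" using s r by auto
      have s0: "s \<noteq> 0" "N s \<noteq> 0" using gen[OF s] by (auto simp: poly_excpoly)
      obtain s' where s': "cmod s' \<le> 1" "paired s s'" using exists_paired[OF s0] by blast
      have \<Phi>: "\<Phi> (s, s') \<le> M" by (rule M) (use s s' in auto)
      have nonneg: "0 \<le> cmod (y s)" "0 \<le> cmod (y s * (F s)\<^sup>2)" "0 \<le> cmod (y s * (F s) ^ 3 / F s')"
        "0 \<le> cmod (y s * F s / F s')" "0 \<le> cmod ((s\<^sup>2 - 1) / (s'\<^sup>2 - 1))" by simp_all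
      have Mb: "1 \<le> M" "cmod (y s) \<le> M" "cmod (y s * (F s)\<^sup>2) \<le> M" "cmod (y s * (F s) ^ 3 / F s') \<le> M"
        "cmod (y s * F s / F s') \<le> M" "cmod ((s\<^sup>2 - 1) / (s'\<^sup>2 - 1)) \<le> M"
        using \<Phi> nonneg unfolding \<Phi>_def prod.case by linarith+
      have sq: "cmod s < q" using g(1)[OF sb] .
      have s1: "cmod s \<le> 1" using sq q by linarith
      have "cmod s ^ 4 \<le> cmod s" using s1 power_decreasing[of 1 4 "cmod s"] by simp
      then have s4: "cmod s ^ 4 \<le> q" using sq by linarith
      have mr: "cmod (m s) \<le> q * cmod (m s')" by (rule m_ratio[OF s'(2) q g(2)[OF sb s']])
      define D where "D = m s ^ n * (s\<^sup>2 - 1) ^ 3"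
      define w where "w = q ^ n * coeff_norm (rempoly n Q)"
      have w: "w \<ge> 0" using q coeff_norm_nonneg by (simp add: w_def)
      note W = conjugate_remainder_bounds[OF deg deg3 gen[OF s] s'(2) s1 s'(1) less_imp_le[OF q(1)] s4 mr Mb(6), folded D_def]
      have W': "cmod (D * remainder Q (1 / s)) \<le> w" "cmod (D * remainder Q s') \<le> M ^ 3 * w" "cmod (D * remainder Q (1 / s')) \<le> M ^ 3 * w"
        using W by (simp_all add: w_def mult.assoc)
      define T where "T = cmod (D * remainder Q (1 / s)) + (cmod (D * remainder Q s') + cmod (D * remainder Q (1 / s')))"
      have tri: "cmod (a * u1 - b * u2) \<le> M * (cmod u1 + (x + x'))"
        if "cmod a \<le> M" "cmod b \<le> M" "cmod u2 \<le> x + x'" for a b u1 u2 x x'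
      proof -
        have "cmod (a * u1 - b * u2) \<le> cmod a * cmod u1 + cmod b * cmod u2"
          using norm_triangle_ineq4[of "a * u1" "b * u2"] by (simp add: norm_mult)
        also have "\<dots> \<le> M * cmod u1 + M * (x + x')"
          using that Mb(1) by (intro add_mono mult_mono) auto
        finally show ?thesis by (simp add: algebra_simps)
      qed
      have sM: "cmod (s\<^sup>2) \<le> M" "cmod (- s\<^sup>2) \<le> M" "cmod (- y s) \<le> M"
        using s1 Mb(1,2) power_le_one[of "cmod s" 2] by (auto simp: norm_power)
      have "cmod (poly ?E s) \<le> M * T"
        using j
      proof (cases rule: at_most_3_cases)
        case zero
        then have "poly ?E s = s\<^sup>2 * (D * remainder Q (1 / s)) - y s * (F s)\<^sup>2 * (D * remainder Q s' + D * remainder Q (1 / s'))"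
          using error_formula(1)[OF deg gen[OF s] s'(2) j] by (simp add: D_def)
        then show ?thesis unfolding T_def by (simp only:) (rule tri[OF sM(1) Mb(3) norm_triangle_ineq])
      next
        case one
        then have "poly ?E s = - s\<^sup>2 * (D * remainder Q (1 / s)) - y s * (F s) ^ 3 / F s' * (D * remainder Q s' - D * remainder Q (1 / s'))"
          using error_formula(1)[OF deg gen[OF s] s'(2) j] by (simp add: D_def)
        then show ?thesis unfolding T_def by (simp only:) (rule tri[OF sM(2) Mb(4) norm_triangle_ineq4])
      next
        case two
        then have "poly ?E s = y s * (D * remainder Q (1 / s)) - y s * (D * remainder Q s' + D * remainder Q (1 / s'))"
          using error_formula(1)[of Q n s s' j, OF deg gen[OF s] s'(2) j] by (simp add: D_def algebra_simps)
        then show ?thesis unfolding T_def by (simp only:) (rule tri[OF Mb(2) Mb(2) norm_triangle_ineq])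
      next
        case three
        then have "poly ?E s = - y s * (D * remainder Q (1 / s)) - y s * F s / F s' * (D * remainder Q s' - D * remainder Q (1 / s'))"
          using error_formula(1)[OF deg gen[OF s] s'(2) j] by (simp add: D_def)
        then show ?thesis unfolding T_def by (simp only:) (rule tri[OF sM(3) Mb(5) norm_triangle_ineq4])
      qed
      also have "\<dots> \<le> M * (w + (M ^ 3 * w + M ^ 3 * w))"
        unfolding T_def using W' Mb(1) by (intro mult_left_mono add_mono) auto
      also have "\<dots> = C * q ^ n * coeff_norm (rempoly n Q)" by (simp add: C_def w_def algebra_simps)
      finally show ?thesis .
    qed
    show "cmod (poly ?E t) \<le> C * q ^ n * coeff_norm (rempoly n Q)"
    proof (rule maximum_modulus_frontier[of "poly ?E" "cball p r"])
      show "poly ?E holomorphic_on interior (cball p r)" by (intro holomorphic_intros)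
      show "continuous_on (closure (cball p r)) (poly ?E)" by (intro continuous_intros)
      fix z assume "z \<in> frontier (cball p r)"
      then show "cmod (poly ?E z) \<le> C * q ^ n * coeff_norm (rempoly n Q)" using circle r(1) by simp
    qed (use t in auto)
  qed (use r sub q in auto)
qed

end

section \<open>The fourth sheet as a subset of the Riemann sphere\<close>

lemma topspace_riemann_sphere [simp]: "topspace riemann_sphere = UNIV"
  by (auto simp: riemann_sphere_def; metis option.exhaust rangeI)

text \<open>
  Openness can be tested in the two charts. The complement of a neighbourhood of \<open>\<infinity>\<close> is compact
  because the chart at infinity covers all points of large modulus.
\<close>

lemma openin_riemann_sphere_iff:
  "openin riemann_sphere S \<longleftrightarrow> open (Some -` S) \<and> open (chart_at_infinity -` S)"
proof
  assume "openin riemann_sphere S"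
  then consider U where "open U" "S = Some ` U"
    | C where "compact C" "S = insert None (Some ` (- C))"
    unfolding riemann_sphere_def openin_Alexandroff_compactification by (auto simp: Compl_eq_Diff_UNIV)
  then show "open (Some -` S) \<and> open (chart_at_infinity -` S)"
  proof cases
    case 1
    have "Some -` S = U" using 1 by auto
    moreover have "chart_at_infinity -` S = (- {0}) \<inter> (\<lambda>w. 1 / w) -` U"
      using 1 by (auto simp: chart_at_infinity_def split: if_splits)
    moreover have "open ((- {0::complex}) \<inter> (\<lambda>w. 1 / w) -` U)"
      by (rule continuous_open_preimage) (use 1 in \<open>auto intro!: continuous_intros\<close>)
    ultimately show ?thesis using 1 by simp
  next
    case 2
    obtain M where M: "M > 0" "\<And>x. x \<in> C \<Longrightarrow> cmod x \<le> M"
      using compact_imp_bounded[OF 2(1)] by (auto simp: bounded_pos)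
    have "Some -` S = - C" using 2 by auto
    moreover have "chart_at_infinity -` S = ball 0 (1 / M) \<union> ((- {0}) \<inter> (\<lambda>w. 1 / w) -` (- C))"
    proof -
      have "1 / w \<notin> C" if "cmod w < 1 / M" "w \<noteq> 0" for w
      proof
        assume "1 / w \<in> C"
        then have "1 / cmod w \<le> M" using M(2)[of "1 / w"] by (simp add: norm_divide)
        then show False using that M(1) by (simp add: field_simps)
      qed
      then show ?thesis using 2 M(1) by (auto simp: chart_at_infinity_def split: if_splits)
    qed
    moreover have "open ((- {0::complex}) \<inter> (\<lambda>w. 1 / w) -` (- C))"
      by (rule continuous_open_preimage) (use 2 in \<open>auto intro!: continuous_intros compact_imp_closed\<close>)
    ultimately show ?thesis using 2 by (auto intro: compact_imp_closed)
  qed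
next
  assume op: "open (Some -` S) \<and> open (chart_at_infinity -` S)"
  show "openin riemann_sphere S"
  proof (cases "None \<in> S")
    case False
    then have "S = Some ` (Some -` S)" by (auto simp: image_iff; metis option.exhaust)
    with op show ?thesis unfolding riemann_sphere_def openin_Alexandroff_compactification by auto
  next
    case True
    then have "0 \<in> chart_at_infinity -` S" by (simp add: chart_at_infinity_def)
    with op obtain \<epsilon> where \<epsilon>: "\<epsilon> > 0" "ball 0 \<epsilon> \<subseteq> chart_at_infinity -` S"
      by (meson open_contains_ball)
    have "bounded (- (Some -` S))"
    proof (rule boundedI[of _ "1 / \<epsilon>"], rule ccontr)
      fix z assume z: "z \<in> - (Some -` S)" "\<not> cmod z \<le> 1 / \<epsilon>"
      then have z0: "cmod z > 0" using \<epsilon>(1) by (smt (verit) divide_pos_pos)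
      have "1 / z \<in> ball 0 \<epsilon>" using z \<epsilon>(1) z0 by (simp add: norm_divide field_simps)
      then have "chart_at_infinity (1 / z) \<in> S" using \<epsilon>(2) by blast
      then show False using z z0 by (auto simp: chart_at_infinity_def)
    qed
    then have "compact (- (Some -` S))" using op by (simp add: compact_eq_bounded_closed closed_Compl)
    moreover have "S = insert None (Some ` (UNIV - (- (Some -` S))))" using True
      by (auto simp: image_iff; metis option.exhaust)
    ultimately show ?thesis unfolding riemann_sphere_def openin_Alexandroff_compactification
      using op by (intro disjI2 exI[of _ "- (Some -` S)"] conjI) (simp_all add: closed_Compl)
  qed
qed

context four_sheets
begin

text \<open>
  The projection of the \<open>t\<close>-plane to the \<open>z\<close>-sphere.
\<close>

definition zproj :: "complex \<Rightarrow> complex option" where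
  "zproj t = (if m t = 0 then None else Some (X t / m t))"

lemma zproj_eq_chart: "X t \<noteq> 0 \<Longrightarrow> zproj t = chart_at_infinity (m t / X t)"
  by (simp add: zproj_def chart_at_infinity_def)

lemma zproj_eq_iff: "zproj s = zproj t \<longleftrightarrow> X s * m t = X t * m s"
  using X_m_not_both_0[of s] X_m_not_both_0[of t] by (auto simp: zproj_def field_simps)

text \<open>
  Distinct points of the unit disc with the same projection are paired, and each would have to have
  the strictly smaller \<open>|m|\<close>.
\<close>

lemma inj_on_zproj: "inj_on zproj \<Omega>"
proof (rule inj_onI, rule ccontr)
  fix s t assume s: "s \<in> \<Omega>" and t: "t \<in> \<Omega>" and eq: "zproj s = zproj t" and ne: "s \<noteq> t"
  have 1: "cmod s < 1" "cmod t < 1" using s t by (auto simp: \<Omega>_def)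
  have "s * t \<noteq> 1"
    using 1 mult_strict_mono'[of "cmod s" 1 "cmod t" 1] by (metis mult_1 norm_ge_zero norm_mult norm_one less_irrefl)
  moreover have "(d\<^sup>2 * N s * N t - 4 * s * t) * ((s - t) * (s * t - 1)) = 0"
    using cross_identity[of s t] eq by (simp add: zproj_eq_iff)
  ultimately have p: "paired s t" using ne by (simp add: paired_def)
  then have "cmod (d\<^sup>2 * N s * N t) = cmod (4 * s * t)" by (simp add: paired_def)
  then have n: "cmod (d * N s) * cmod (d * N t) = (2 * cmod s) * (2 * cmod t)"
    by (simp add: norm_mult norm_power power2_eq_square mult_ac)
  have "cmod (d * N s) < 2 * cmod t \<or> 2 * cmod s < cmod (d * N t)" using s p 1 by (auto simp: \<Omega>_def)
  moreover have "cmod (d * N t) < 2 * cmod s \<or> 2 * cmod t < cmod (d * N s)"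
    using t p 1 paired_sym by (auto simp: \<Omega>_def)
  ultimately consider "cmod (d * N s) < 2 * cmod t" "cmod (d * N t) < 2 * cmod s"
    | "2 * cmod s < cmod (d * N t)" "2 * cmod t < cmod (d * N s)" by linarith
  then show False
  proof cases
    case 1
    then have "cmod (d * N s) * cmod (d * N t) < (2 * cmod t) * (2 * cmod s)"
      by (intro mult_strict_mono') auto
    then show False using n by simp
  next
    case 2
    then have "(2 * cmod s) * (2 * cmod t) < cmod (d * N t) * cmod (d * N s)"
      by (intro mult_strict_mono') auto
    then show False using n by (simp add: mult.commute)
  qed
qed

lemma holomorphic_on_m: "m holomorphic_on U" and holomorphic_on_X: "X holomorphic_on U"
  and holomorphic_on_N: "N holomorphic_on U"
  unfolding m_def[abs_def] X_def[abs_def] N_def[abs_def] using d_nz by (auto intro!: holomorphic_intros)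

lemma open_m: "open {t. m t \<noteq> 0}" and open_X: "open {t. X t \<noteq> 0}"
  by (intro open_Collect_neq continuous_on_m continuous_on_X continuous_on_const)+

text \<open>
  On \<open>\<Omega>\<close> the projection is injective and holomorphic in the charts, hence open.
\<close>

lemma open_zproj_image:
  assumes "open V" "V \<subseteq> \<Omega>"
  shows "openin riemann_sphere (zproj ` V)"
  unfolding openin_riemann_sphere_iff
proof
  have V: "open (V \<inter> {t. m t \<noteq> 0})" "open (V \<inter> {t. X t \<noteq> 0})"
    using assms open_m open_X by auto
  have "Some -` (zproj ` V) = (\<lambda>t. X t / m t) ` (V \<inter> {t. m t \<noteq> 0})"
    by (auto simp: zproj_def image_iff split: if_splits)
  moreover have "open \<dots>"
  proof (rule open_mapping_thm3)
    show "(\<lambda>t. X t / m t) holomorphic_on (V \<inter> {t. m t \<noteq> 0})"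
      by (intro holomorphic_intros holomorphic_on_m holomorphic_on_X) auto
    show "inj_on (\<lambda>t. X t / m t) (V \<inter> {t. m t \<noteq> 0})"
    proof (rule inj_onI)
      fix s t assume *: "s \<in> V \<inter> {t. m t \<noteq> 0}" "t \<in> V \<inter> {t. m t \<noteq> 0}" "X s / m s = X t / m t"
      then have "zproj s = zproj t" by (simp add: zproj_def)
      then show "s = t" using * assms inj_on_zproj by (auto dest: inj_onD)
    qed
  qed (use V in auto)
  ultimately show "open (Some -` (zproj ` V))" by simp
  have "chart_at_infinity -` (zproj ` V) = (\<lambda>t. m t / X t) ` (V \<inter> {t. X t \<noteq> 0})" (is "?l = ?r")
  proof
    show "?l \<subseteq> ?r"
    proof
      fix w assume "w \<in> ?l"
      then obtain t where t: "t \<in> V" "chart_at_infinity w = zproj t" by auto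
      have "X t \<noteq> 0 \<and> w = m t / X t"
        using t(2) X_m_not_both_0[of t] by (auto simp: chart_at_infinity_def zproj_def field_simps split: if_splits)
      then show "w \<in> ?r" using t by blast
    qed
    show "?r \<subseteq> ?l" using zproj_eq_chart by force
  qed
  moreover have "open ?r"
  proof (rule open_mapping_thm3)
    show "(\<lambda>t. m t / X t) holomorphic_on (V \<inter> {t. X t \<noteq> 0})"
      by (intro holomorphic_intros holomorphic_on_m holomorphic_on_X) auto
    show "inj_on (\<lambda>t. m t / X t) (V \<inter> {t. X t \<noteq> 0})"
    proof (rule inj_onI)
      fix s t assume *: "s \<in> V \<inter> {t. X t \<noteq> 0}" "t \<in> V \<inter> {t. X t \<noteq> 0}" "m s / X s = m t / X t"
      then have "zproj s = zproj t" by (simp add: zproj_eq_chart)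
      then show "s = t" using * assms inj_on_zproj by (auto dest: inj_onD)
    qed
  qed (use V in auto)
  ultimately show "open (chart_at_infinity -` (zproj ` V))" by simp
qed

lemma open_zproj_preimage:
  assumes "openin riemann_sphere S"
  shows "open {t. zproj t \<in> S}"
proof -
  have op: "open (Some -` S)" "open (chart_at_infinity -` S)"
    using assms by (auto simp: openin_riemann_sphere_iff)
  have "{t. zproj t \<in> S} = ({t. m t \<noteq> 0} \<inter> (\<lambda>t. X t / m t) -` (Some -` S)) \<union>
     ({t. X t \<noteq> 0} \<inter> (\<lambda>t. m t / X t) -` (chart_at_infinity -` S))"
    using X_m_not_both_0 by (auto simp: zproj_def chart_at_infinity_def split: if_splits)
  moreover have "open ({t. m t \<noteq> 0} \<inter> (\<lambda>t. X t / m t) -` (Some -` S))"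
    by (intro continuous_open_preimage continuous_intros continuous_on_X continuous_on_m open_m op) auto
  moreover have "open ({t. X t \<noteq> 0} \<inter> (\<lambda>t. m t / X t) -` (chart_at_infinity -` S))"
    by (intro continuous_open_preimage continuous_intros continuous_on_X continuous_on_m open_X op) auto
  ultimately show ?thesis by auto
qed

lemma homeomorphic_map_zproj:
  "homeomorphic_map (top_of_set \<Omega>) (subtopology riemann_sphere (zproj ` \<Omega>)) zproj"
proof (rule bijective_open_imp_homeomorphic_map)
  show "continuous_map (top_of_set \<Omega>) (subtopology riemann_sphere (zproj ` \<Omega>)) zproj"
    unfolding continuous_map_in_subtopology
  proof
    show "continuous_map (top_of_set \<Omega>) riemann_sphere zproj"
      unfolding continuous_map_def
    proof (intro conjI allI impI)
      fix U assume "openin riemann_sphere U"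
      then have "open {t. zproj t \<in> U}" by (rule open_zproj_preimage)
      moreover have "{x \<in> topspace (top_of_set \<Omega>). zproj x \<in> U} = \<Omega> \<inter> {t. zproj t \<in> U}" by auto
      ultimately show "openin (top_of_set \<Omega>) {x \<in> topspace (top_of_set \<Omega>). zproj x \<in> U}"
        by (simp add: openin_open_Int)
    qed auto
  qed auto
  show "open_map (top_of_set \<Omega>) (subtopology riemann_sphere (zproj ` \<Omega>)) zproj"
    unfolding open_map_def
  proof (intro allI impI)
    fix U assume "openin (top_of_set \<Omega>) U"
    then have "open U" "U \<subseteq> \<Omega>" using open_Omega by (auto simp: openin_open_eq)
    then have "openin riemann_sphere (zproj ` U)" "zproj ` U = zproj ` U \<inter> zproj ` \<Omega>" using open_zproj_image by auto
    then show "openin (subtopology riemann_sphere (zproj ` \<Omega>)) (zproj ` U)"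
      unfolding openin_subtopology by blast
  qed
qed (use inj_on_zproj in auto)

text \<open>
  The point \<open>z\<^sup>(\<^sup>4\<^sup>)\<close> on the fourth sheet.
\<close>

definition tau :: "complex option \<Rightarrow> complex" where "tau = inv_into \<Omega> zproj"

lemma tau_zproj: "t \<in> \<Omega> \<Longrightarrow> tau (zproj t) = t"
  unfolding tau_def using inj_on_zproj by (rule inv_into_f_f)

lemma zproj_tau: "p \<in> zproj ` \<Omega> \<Longrightarrow> zproj (tau p) = p" and tau_in: "p \<in> zproj ` \<Omega> \<Longrightarrow> tau p \<in> \<Omega>"
  unfolding tau_def by (auto simp: f_inv_into_f inv_into_into)

lemma continuous_map_tau:
  "continuous_map (subtopology riemann_sphere (zproj ` \<Omega>)) (top_of_set \<Omega>) tau"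
proof -
  obtain g where g: "homeomorphic_maps (top_of_set \<Omega>) (subtopology riemann_sphere (zproj ` \<Omega>)) zproj g"
    using homeomorphic_map_zproj homeomorphic_map_maps by blast
  then have "continuous_map (subtopology riemann_sphere (zproj ` \<Omega>)) (top_of_set \<Omega>) g"
    by (simp add: homeomorphic_maps_def)
  then show ?thesis
  proof (rule continuous_map_eq)
    fix p assume "p \<in> topspace (subtopology riemann_sphere (zproj ` \<Omega>))"
    then obtain t where "t \<in> \<Omega>" "p = zproj t" by auto
    then show "g p = tau p" using g tau_zproj by (simp add: homeomorphic_maps_def)
  qed
qed

lemma compact_tau_image:
  assumes "compactin riemann_sphere K" "K \<subseteq> zproj ` \<Omega>"
  shows "compact (tau ` K)" "tau ` K \<subseteq> \<Omega>"
proof -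
  have "compactin (subtopology riemann_sphere (zproj ` \<Omega>)) K"
    using assms by (simp add: compactin_subtopology)
  then have "compactin (top_of_set \<Omega>) (tau ` K)" using continuous_map_tau by (rule image_compactin)
  then show "compact (tau ` K)" by (simp add: compactin_subtopology)
  show "tau ` K \<subseteq> \<Omega>" using assms tau_in by auto
qed

lemma cut_eq: "cut A B = closed_segment (d * e - d) (d * e + d)"
proof -
  have "d * e + d = 1 / A" "d * e - d = 1 / B"
    unfolding d_e by (simp_all add: d_def field_simps)
  then show ?thesis by (simp add: cut_def closed_segment_commute)
qed

lemma norm_cut: "\<zeta> \<in> cut A B \<Longrightarrow> cmod \<zeta> < 1"
proof -
  assume "\<zeta> \<in> cut A B"
  moreover have "cut A B \<subseteq> ball 0 1" unfolding cut_def
    by (rule closed_segment_subset) (use norm_A norm_B in \<open>auto simp: norm_divide divide_less_eq\<close>)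
  ultimately show ?thesis by auto
qed

lemma cut_iff: "\<zeta> \<in> cut A B \<longleftrightarrow> cmod (phi ((\<zeta> - d * e) / d)) = 1"
  unfolding cut_eq norm_phi_eq_1_iff closed_segment_affine_image[OF d_nz] ..

text \<open>
  The coordinate \<open>t\<close> of the point over \<open>\<zeta>\<close> on the second copy.
\<close>

definition inner_root :: "complex \<Rightarrow> complex" where "inner_root \<zeta> = 1 / phi ((\<zeta> - d * e) / d)"

lemma inner_root_nz: "inner_root \<zeta> \<noteq> 0" and norm_inner_root: "cmod (inner_root \<zeta>) \<le> 1"
  using norm_phi_ge_1 by (auto simp: inner_root_def norm_divide divide_le_eq)

lemma norm_inner_root_less: "\<zeta> \<notin> cut A B \<Longrightarrow> cmod (inner_root \<zeta>) < 1"
  unfolding cut_iff using norm_phi_ge_1[of "(\<zeta> - d * e) / d"] by (auto simp: inner_root_def norm_divide divide_less_eq)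

lemma zeta_eq: "t \<noteq> 0 \<Longrightarrow> (zeta t - d * e) / d = (t + 1 / t) / 2"
  using d_nz by (simp add: zeta_def N_def field_simps power2_eq_square)

lemma zeta_inner_root: "zeta (inner_root \<zeta>) = \<zeta>"
proof -
  define v where "v = (\<zeta> - d * e) / d"
  have "(zeta (inner_root \<zeta>) - d * e) / d = (inner_root \<zeta> + 1 / inner_root \<zeta>) / 2"
    using inner_root_nz by (rule zeta_eq)
  also have "\<dots> = v" using phi_add_inverse[of v] by (simp add: inner_root_def add.commute flip: v_def)
  finally show ?thesis using d_nz by (simp add: v_def)
qed

lemma zeta_recip: "t \<noteq> 0 \<Longrightarrow> zeta (1 / t) = zeta t"
  by (simp add: zeta_def N_recip power2_eq_square)

lemma zeta_eq_iff:
  assumes "s \<noteq> 0" "t \<noteq> 0"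
  shows "zeta s = zeta t \<longleftrightarrow> s = t \<or> s = 1 / t"
proof
  assume "zeta s = zeta t"
  then have "(s + 1 / s) / 2 = (t + 1 / t) / 2" using zeta_eq[OF assms(1)] zeta_eq[OF assms(2)] by simp
  then show "s = t \<or> s = 1 / t" using joukowski_roots[of s t "(t + 1 / t) / 2"] assms by simp
qed (use assms zeta_recip in auto)

lemma paired_iff_zeta:
  assumes "t \<noteq> 0" "s \<noteq> 0"
  shows "paired t s \<longleftrightarrow> zeta t * zeta s = 1"
  using assms by (simp add: paired_def zeta_def divide_eq_eq) (auto simp: power2_eq_square mult_ac)

lemma zeta_eq_0_iff: "t \<noteq> 0 \<Longrightarrow> zeta t = 0 \<longleftrightarrow> N t = 0"
  using d_nz by (simp add: zeta_def)

lemma paired_unique: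
  assumes "t \<noteq> 0" "N t \<noteq> 0" "paired t s" "paired t s'"
  shows "s = s' \<or> s = 1 / s'"
proof -
  have "s \<noteq> 0" "s' \<noteq> 0" using assms d_nz by (auto simp: paired_def)
  then have "zeta t * zeta s = 1" "zeta t * zeta s' = 1" using assms paired_iff_zeta by auto
  then have "zeta s = zeta s'" by (metis mult_cancel_left mult_zero_left zero_neq_one)
  then show ?thesis using zeta_eq_iff \<open>s \<noteq> 0\<close> \<open>s' \<noteq> 0\<close> by blast
qed

lemma paired_norm_unique:
  assumes "t \<noteq> 0" "N t \<noteq> 0" "paired t s" "paired t s'" "cmod s \<le> 1" "cmod s' \<le> 1"
  shows "cmod s = cmod s'"
proof -
  have "s' \<noteq> 0" using assms d_nz by (auto simp: paired_def)
  from paired_unique[OF assms(1-4)] show ?thesis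
  proof
    assume s: "s = 1 / s'"
    then have "1 / cmod s' \<le> 1" using assms(5) by (simp add: norm_divide)
    then have "cmod s' = 1" using \<open>s' \<noteq> 0\<close> assms(6) by (simp add: divide_le_eq)
    then show ?thesis using s by (simp add: norm_divide)
  qed simp
qed

lemma paired_norms:
  assumes "paired s t"
  shows "cmod (d * N s) * cmod (d * N t) = (2 * cmod s) * (2 * cmod t)"
  using arg_cong[OF assms[unfolded paired_def], of cmod]
  by (simp add: norm_mult norm_power power2_eq_square mult_ac)

lemma paired_less_iff:
  assumes p: "paired s t" and "s \<noteq> 0" "N s \<noteq> 0"
  shows "2 * cmod s < cmod (d * N t) \<longleftrightarrow> cmod (d * N s) < 2 * cmod t"
proof -
  have t: "t \<noteq> 0" "N t \<noteq> 0" using assms d_nz by (auto simp: paired_def)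
  have pos: "cmod (d * N t) > 0" "2 * cmod t > 0" using t d_nz by auto
  have "2 * cmod s < cmod (d * N t) \<longleftrightarrow> (2 * cmod s) * (2 * cmod t) < cmod (d * N t) * (2 * cmod t)"
    by (rule mult_less_cancel_right_pos[OF pos(2), symmetric])
  also have "\<dots> \<longleftrightarrow> cmod (d * N s) * cmod (d * N t) < (2 * cmod t) * cmod (d * N t)"
    unfolding paired_norms[OF p] by (simp only: mult.commute)
  also have "\<dots> \<longleftrightarrow> cmod (d * N s) < 2 * cmod t"
    by (rule mult_less_cancel_right_pos[OF pos(1)])
  finally show ?thesis .
qed

lemma Omega_iff:
  assumes t: "t \<noteq> 0" "N t \<noteq> 0" and s: "cmod s \<le> 1" "paired t s"
  shows "t \<in> \<Omega> \<longleftrightarrow> cmod t < 1 \<and> cmod (d * N t) < 2 * cmod s"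
proof
  assume "t \<in> \<Omega>"
  then show "cmod t < 1 \<and> cmod (d * N t) < 2 * cmod s"
    using s paired_less_iff[OF s(2) t] by (auto simp: \<Omega>_def)
next
  assume "cmod t < 1 \<and> cmod (d * N t) < 2 * cmod s"
  then show "t \<in> \<Omega>" unfolding \<Omega>_def using paired_norm_unique[OF t _ s(2) _ s(1)] by auto
qed

lemma A_notin_cut: "A \<notin> cut A B"
  using norm_cut norm_A by force

text \<open>
  Otherwise paired points have equal \<open>|m|\<close> as soon as both lie inside the unit circle. Near \<open>t = 1\<close>,
  that is over \<open>\<zeta> = 1 / A\<close>, the function \<open>\<psi>\<close>, which is \<open>t' / N(t)\<close> with \<open>t'\<close> the point paired to
  \<open>t\<close>, then has constant modulus inside the circle. As \<open>1 / \<zeta>\<close> stays off the cut there, \<open>\<psi>\<close> is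
  holomorphic across the circle, hence constant. But \<open>\<psi> (1 / t) = t\<^sup>2 \<psi> t\<close>.
\<close>

lemma Omega_nonempty: "\<Omega> \<noteq> {}"
proof
  assume empty: "\<Omega> = {}"
  define vv where "vv t = (1 / zeta t - d * e) / d" for t
  define \<psi> where "\<psi> t = inner_root (1 / zeta t) / N t" for t
  let ?D = "{t. t \<noteq> 0 \<and> N t \<noteq> 0}"
  have opD: "open ?D"
    unfolding N_def by (intro open_Collect_conj open_Collect_neq continuous_intros)
  have vvh: "vv holomorphic_on ?D" unfolding vv_def[abs_def] zeta_def
    using d_nz by (intro holomorphic_intros holomorphic_on_N) auto
  define G where "G = ?D \<inter> vv -` (- closed_segment (-1) 1)"
  have "open G" unfolding G_def
    by (rule continuous_open_preimage) (use opD vvh in \<open>auto intro: holomorphic_on_imp_continuous_on\<close>)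
  have G: "t \<noteq> 0 \<and> N t \<noteq> 0 \<and> 1 / zeta t \<notin> cut A B" if "t \<in> G" for t
    using that unfolding G_def vv_def cut_iff norm_phi_eq_1_iff by auto
  have z1: "zeta 1 = 1 / A"
  proof -
    have "N 1 = (1 + e) * 2" by (simp add: N_def)
    then have "zeta 1 = d * (1 + e)" by (simp add: zeta_def)
    then have "A * zeta 1 = 1" using A_d by (simp only: mult.assoc)
    then show ?thesis using A_nz by (simp add: eq_divide_eq mult.commute)
  qed
  have "1 \<in> G" unfolding G_def using N_1 A_notin_cut z1 by (auto simp: vv_def cut_iff norm_phi_eq_1_iff)
  with \<open>open G\<close> obtain \<rho> where \<rho>: "\<rho> > 0" "ball 1 \<rho> \<subseteq> G" by (meson open_contains_ball)
  have "\<psi> holomorphic_on G"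
  proof -
    have cmp: "(phi \<circ> vv) holomorphic_on G"
      by (rule holomorphic_on_compose_gen[OF _ holomorphic_on_phi])
         (use vvh in \<open>auto simp: G_def intro: holomorphic_on_subset\<close>)
    then have "(\<lambda>t. 1 / (phi \<circ> vv) t / N t) holomorphic_on G"
      by (intro holomorphic_on_divide cmp holomorphic_on_N holomorphic_on_const) (use G in auto)
    then show ?thesis by (simp add: \<psi>_def[abs_def] inner_root_def vv_def)
  qed
  then have hol: "\<psi> holomorphic_on ball 1 \<rho>" using \<rho>(2) by (rule holomorphic_on_subset)
  have mod: "cmod (\<psi> t) = cmod d / 2" if t: "t \<in> ball 1 \<rho>" "cmod t < 1" for t
  proof -
    have "t \<in> G" using \<rho>(2) t(1) by blast
    then have tG: "t \<noteq> 0" "N t \<noteq> 0" "1 / zeta t \<notin> cut A B" using G by auto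
    define s where "s = inner_root (1 / zeta t)"
    have s: "s \<noteq> 0" "cmod s < 1" using inner_root_nz norm_inner_root_less tG by (auto simp: s_def)
    have "zeta t * zeta s = 1" using tG zeta_eq_0_iff by (simp add: s_def zeta_inner_root)
    then have p: "paired t s" using paired_iff_zeta tG s by simp
    then have p: "paired t s" "paired s t" using paired_sym by blast+
    have Ns: "N s \<noteq> 0" using p tG s by (auto simp: paired_def)
    have "\<not> cmod (d * N t) < 2 * cmod s" using empty Omega_iff[OF tG(1,2) _ p(1)] s t by auto
    moreover have "\<not> cmod (d * N s) < 2 * cmod t" using empty Omega_iff[OF s(1) Ns _ p(2)] s t by auto
    then have "\<not> 2 * cmod s < cmod (d * N t)" using paired_less_iff[OF p(2) s(1) Ns] by simp
    ultimately have "2 * cmod s = cmod d * cmod (N t)" by (simp add: norm_mult)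
    then show ?thesis using tG by (simp add: \<psi>_def s_def norm_divide field_simps)
  qed
  define \<eta> where "\<eta> = min \<rho> 1 / 2"
  define \<xi> where "\<xi> = complex_of_real (1 - \<eta>)"
  have \<eta>: "0 < \<eta>" "\<eta> < \<rho>" "\<eta> < 1" using \<rho> by (auto simp: \<eta>_def)
  have "cmod \<xi> = \<bar>1 - \<eta>\<bar>" unfolding \<xi>_def by (rule norm_of_real)
  then have "cmod \<xi> < 1" using \<eta> by simp
  moreover have "1 - \<xi> = complex_of_real \<eta>" by (simp add: \<xi>_def)
  then have "dist 1 \<xi> = \<eta>" using \<eta> by (simp add: dist_norm)
  ultimately have \<xi>: "\<xi> \<in> ball 1 \<rho> \<inter> ball 0 1" using \<eta> by simp
  have "\<psi> constant_on ball 1 \<rho>"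
  proof (rule maximum_modulus_principle[OF hol _ _ _ _ \<xi>])
    fix z :: complex assume "z \<in> ball 1 \<rho> \<inter> ball 0 1"
    then have "cmod (\<psi> z) = cmod d / 2" "cmod (\<psi> \<xi>) = cmod d / 2" using mod[of z] mod[of \<xi>] \<xi> by simp_all
    then show "cmod (\<psi> z) \<le> cmod (\<psi> \<xi>)" by simp
  qed auto
  then obtain K where K: "\<And>t. t \<in> ball 1 \<rho> \<Longrightarrow> \<psi> t = K" by (auto simp: constant_on_def)
  define b where "b = complex_of_real (1 + \<eta>)"
  have "1 - b = complex_of_real (- \<eta>)" by (simp add: b_def)
  then have "dist 1 b = \<eta>" using \<eta> by (simp add: dist_norm)
  moreover have "cmod b = \<bar>1 + \<eta>\<bar>" unfolding b_def by (rule norm_of_real)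
  ultimately have b: "b \<in> ball 1 \<rho>" "b \<noteq> 0" using \<eta> by auto
  have "1 / b \<in> ball 1 \<rho>"
  proof -
    have "1 - 1 / (1 + \<eta>) = \<eta> / (1 + \<eta>)" using \<eta> by (simp add: field_simps)
    moreover have "\<eta> / (1 + \<eta>) \<le> \<eta>" using \<eta> by (simp add: divide_le_eq)
    moreover have "dist 1 (1 / b) = \<bar>1 - 1 / (1 + \<eta>)\<bar>"
      unfolding b_def dist_norm by (metis norm_of_real of_real_1 of_real_diff of_real_divide)
    ultimately show ?thesis using \<eta> by simp
  qed
  then have "\<psi> (1 / b) = \<psi> b" using K b by simp
  moreover have "\<psi> (1 / b) = \<psi> b * b\<^sup>2"
    using b by (simp add: \<psi>_def zeta_recip N_recip)
  moreover have "b \<in> G" using b(1) \<rho>(2) by blast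
  then have "\<psi> b \<noteq> 0" using G inner_root_nz by (auto simp: \<psi>_def)
  ultimately have "b\<^sup>2 = 1" by simp
  then have "(1 + \<eta>)\<^sup>2 = 1" unfolding b_def by (metis of_real_eq_1_iff of_real_power)
  then show False using \<eta> by (simp add: power2_eq_square algebra_simps add_nonneg_eq_0_iff)
qed

end

section \<open>The boundary between the third and the fourth sheet\<close>

text \<open>
  The gap between the two largest of four numbers that come in two ordered pairs.
\<close>

lemma sorted_four_gap:
  fixes x1 x2 y1 y2 :: real
  assumes "y1 \<le> x1" "y2 \<le> x2"
  defines "L \<equiv> sorted_list_of_multiset (mset [y1, y2, x1, x2])"
  shows "L ! 3 - L ! 2 = (if x2 \<le> x1 then min (x1 - x2) (x1 - y1) else min (x2 - x1) (x2 - y2))"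
proof -
  have "L = insort y1 (insort y2 (insort x1 [x2]))"
    unfolding L_def sorted_list_of_multiset_mset by (simp add: sort_key_def)
  then show ?thesis using assms(1,2)
    by (auto simp: min_def eval_nat_numeral)
qed

context four_sheets
begin

lemma green_cut: "green_function (cut A B) = (\<lambda>\<zeta>. ln (cmod (phi ((\<zeta> - d * e) / d))))"
  unfolding cut_eq by (rule green_function_segment[OF d_nz])

lemma green_zeta:
  assumes "t \<noteq> 0" "cmod t \<le> 1"
  shows "green_function (cut A B) (zeta t) = - ln (cmod t)"
proof -
  have "cmod (phi ((zeta t - d * e) / d)) = cmod (1 / t)"
    using assms by (intro norm_phi_joukowski) (auto simp: zeta_eq add.commute norm_divide)
  then show ?thesis using assms by (simp add: green_cut norm_divide ln_div)
qed

text \<open>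
  The values of \<open>u\<close> at the point over \<open>\<zeta>(t)\<close> on the second and on the first copy, for \<open>t\<close> in the unit
  disc.
\<close>

definition u_second :: "complex \<Rightarrow> real" where "u_second t = - 2 * ln (cmod t) - ln (cmod (zeta t))"
definition u_first :: "complex \<Rightarrow> real" where "u_first t = 2 * ln (cmod t) - ln (cmod (zeta t))"

lemma nuttall_u_zeta:
  assumes "t \<noteq> 0" "cmod t \<le> 1"
  shows "nuttall_u A B (zeta t, Copy2) = u_second t" "nuttall_u A B (zeta t, Copy1) = u_first t"
  using green_zeta[OF assms] by (simp_all add: u_second_def u_first_def)

text \<open>
  The two points of a finite fibre in the closed unit disc; the other two are their inverses.
\<close>

definition fibre_pair :: "complex \<Rightarrow> complex \<Rightarrow> bool" where
  "fibre_pair s t \<longleftrightarrow> s \<noteq> 0 \<and> t \<noteq> 0 \<and> cmod s \<le> 1 \<and> cmod t \<le> 1 \<and> zeta s * zeta t = 1"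

lemma fibre_pair_sym: "fibre_pair s t \<longleftrightarrow> fibre_pair t s" by (auto simp: fibre_pair_def mult.commute)

lemma fibre_pair_D:
  assumes "fibre_pair s t"
  shows "N s \<noteq> 0" "N t \<noteq> 0" "m s \<noteq> 0" "paired s t" "paired t s"
proof -
  show "N s \<noteq> 0" "N t \<noteq> 0" "m s \<noteq> 0" using assms by (auto simp: fibre_pair_def zeta_def m_def)
  show "paired s t" using assms paired_iff_zeta by (simp add: fibre_pair_def)
  then show "paired t s" using paired_sym by blast
qed

lemma fibre_pair_recip:
  assumes "fibre_pair s t"
  shows "zeta t = 1 / zeta s"
proof -
  have p: "zeta s * zeta t = 1" using assms by (simp add: fibre_pair_def)
  then have "zeta s \<noteq> 0" by auto
  with p show ?thesis by (metis nonzero_mult_div_cancel_left)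
qed

lemma zproj_zeta:
  assumes "t \<noteq> 0" "N t \<noteq> 0"
  shows "zproj t = Some ((zeta t + 1 / zeta t) / 2)"
  using assms d_nz by (simp add: zproj_def zeta_def m_def X_def field_simps power2_eq_square)

lemma zproj_fibre_pair: "fibre_pair s t \<Longrightarrow> zproj s = Some ((zeta s + zeta t) / 2)"
proof -
  assume st: "fibre_pair s t"
  then have "zeta t = 1 / zeta s" by (rule fibre_pair_recip)
  then show ?thesis using zproj_zeta[of s] fibre_pair_D[OF st] st by (simp add: fibre_pair_def)
qed

lemma surface_fibre_pair:
  assumes "fibre_pair s t" "zproj s = Some z"
  shows "surface_fibre z = mset [(zeta s, Copy1), (zeta t, Copy1), (zeta s, Copy2), (zeta t, Copy2)]"
proof -
  have z: "z = (zeta s + zeta t) / 2" using zproj_fibre_pair[OF assms(1)] assms(2) by simp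
  have "[:1, - 2 * z, 1:] = [:- zeta s, 1:] * [:- zeta t, 1:]"
    using assms(1) by (simp add: fibre_pair_def z) (simp add: mult.commute)
  then have "proots [:1, - 2 * z, 1:] = {#zeta s, zeta t#}"
    by (simp only: proots_mult pCons_eq_0_iff one_neq_zero simp_thms not_False_eq_True proots_linear_factor) simp
  then show ?thesis by (simp add: surface_fibre_def)
qed

lemma exists_fibre_pair:
  obtains s t where "fibre_pair s t" "zproj s = Some z"
proof -
  let ?s = "inner_root (phi z)" and ?t = "inner_root (1 / phi z)"
  have st: "fibre_pair ?s ?t" using inner_root_nz norm_inner_root by (simp add: fibre_pair_def zeta_inner_root)
  moreover have "zproj ?s = Some z" using zproj_fibre_pair[OF st] phi_add_inverse[of z] by (simp add: zeta_inner_root)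
  ultimately show ?thesis using that by blast
qed

definition top_gap :: "complex \<Rightarrow> real" where
  "top_gap z = u_values A B z ! 3 - u_values A B z ! 2"

lemma u_first_le_u_second: "cmod t \<le> 1 \<Longrightarrow> t \<noteq> 0 \<Longrightarrow> u_first t \<le> u_second t"
  by (simp add: u_second_def u_first_def)

lemma top_gap_fibre_pair:
  assumes "fibre_pair s t" "zproj s = Some z"
  shows "top_gap z = (if u_second t \<le> u_second s then min (u_second s - u_second t) (u_second s - u_first s) else min (u_second t - u_second s) (u_second t - u_first t))"
proof -
  have *: "s \<noteq> 0" "cmod s \<le> 1" "t \<noteq> 0" "cmod t \<le> 1" using assms by (auto simp: fibre_pair_def)
  have "image_mset (nuttall_u A B) (surface_fibre z) = mset [u_first s, u_first t, u_second s, u_second t]"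
    unfolding surface_fibre_pair[OF assms] using nuttall_u_zeta[OF *(1,2)] nuttall_u_zeta[OF *(3,4)]
    by (simp del: nuttall_u.simps)
  then show ?thesis unfolding top_gap_def u_values_def
    using sorted_four_gap[of "u_first s" "u_second s" "u_first t" "u_second t"] u_first_le_u_second * by simp
qed

lemma u_second_diff:
  assumes "fibre_pair s t"
  shows "u_second s - u_second t = 2 * (ln (2 * cmod t) - ln (cmod (d * N s)))"
proof -
  have nz: "s \<noteq> 0" "t \<noteq> 0" "N s \<noteq> 0" using assms fibre_pair_D[OF assms] by (auto simp: fibre_pair_def)
  have zt: "zeta t = 1 / zeta s" using assms by (rule fibre_pair_recip)
  have zs: "cmod (zeta s) = cmod (d * N s) / (2 * cmod s)" by (simp add: zeta_def norm_divide norm_mult)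
  have "ln (cmod (zeta t)) = - ln (cmod (zeta s))" using nz d_nz
    unfolding zt by (simp add: norm_divide ln_div zeta_def)
  moreover have "ln (cmod (zeta s)) = ln (cmod (d * N s)) - ln (2 * cmod s)"
    unfolding zs using nz d_nz by (simp add: ln_div)
  moreover have "ln (2 * cmod s) = ln 2 + ln (cmod s)" "ln (2 * cmod t) = ln 2 + ln (cmod t)"
    using nz by (simp_all add: ln_mult)
  ultimately show ?thesis by (simp add: u_second_def)
qed

lemma u_second_less_iff:
  assumes "fibre_pair s t"
  shows "u_second t < u_second s \<longleftrightarrow> cmod (d * N s) < 2 * cmod t"
proof -
  have nz: "t \<noteq> 0" "N s \<noteq> 0" using assms fibre_pair_D[OF assms] by (auto simp: fibre_pair_def)
  have "u_second t < u_second s \<longleftrightarrow> 0 < u_second s - u_second t" by simp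
  also have "\<dots> \<longleftrightarrow> ln (cmod (d * N s)) < ln (2 * cmod t)"
    unfolding u_second_diff[OF assms] by (simp only: zero_less_mult_iff) simp
  also have "\<dots> \<longleftrightarrow> cmod (d * N s) < 2 * cmod t" using nz d_nz by (intro ln_less_cancel_iff) auto
  finally show ?thesis .
qed

lemma u_first_less_iff: "t \<noteq> 0 \<Longrightarrow> u_first t < u_second t \<longleftrightarrow> cmod t < 1"
proof -
  assume "t \<noteq> 0"
  then have "u_first t < u_second t \<longleftrightarrow> ln (cmod t) < 0" unfolding u_second_def u_first_def by (intro iffI) linarith+
  then show ?thesis using \<open>t \<noteq> 0\<close> by simp
qed

lemma fibre_pair_Omega_iff:
  assumes "fibre_pair s t"
  shows "s \<in> \<Omega> \<longleftrightarrow> u_second t < u_second s \<and> u_first s < u_second s"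
  using Omega_iff[of s t] u_second_less_iff[OF assms] u_first_less_iff[of s] fibre_pair_D[OF assms] assms
  by (auto simp: fibre_pair_def)

lemma Some_in_boundary_iff: "Some z \<in> boundary_34 A B \<longleftrightarrow> top_gap z = 0"
  by (auto simp: boundary_34_def top_gap_def)

text \<open>
  The two largest values of \<open>u\<close> over \<open>z\<close> differ iff one of the two points in the closed disc
  beats the other one and is not on the unit circle, where it would tie with its inverse.
\<close>

lemma Some_boundary: "Some z \<in> boundary_34 A B \<longleftrightarrow> Some z \<notin> zproj ` \<Omega>"
proof -
  obtain s t where st: "fibre_pair s t" "zproj s = Some z" using exists_fibre_pair by blast
  have ts: "fibre_pair t s" "zproj t = Some z"
    using st fibre_pair_sym zproj_fibre_pair[of s t] zproj_fibre_pair[of t s] by (auto simp: add.commute)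
  have "top_gap z \<noteq> 0 \<longleftrightarrow> s \<in> \<Omega> \<or> t \<in> \<Omega>"
    unfolding top_gap_fibre_pair[OF st] fibre_pair_Omega_iff[OF st(1)] fibre_pair_Omega_iff[OF ts(1)]
    using u_first_le_u_second[of s] u_first_le_u_second[of t] st(1) by (auto simp: fibre_pair_def min_def split: if_splits)
  moreover have "Some z \<in> zproj ` \<Omega> \<longleftrightarrow> s \<in> \<Omega> \<or> t \<in> \<Omega>"
  proof
    assume "Some z \<in> zproj ` \<Omega>"
    then obtain r where r: "r \<in> \<Omega>" "zproj r = Some z" by (metis imageE)
    have "m r \<noteq> 0" using r(2) by (auto simp: zproj_def split: if_splits)
    then have rnz: "r \<noteq> 0" "N r \<noteq> 0" by (auto simp: m_def)
    have r1: "cmod r < 1" using r by (simp add: \<Omega>_def)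
    have "(zeta r + 1 / zeta r) / 2 = (zeta s + 1 / zeta s) / 2"
      using zproj_zeta[OF rnz] r(2) zproj_fibre_pair[OF st(1)] st(2) fibre_pair_recip[OF st(1)] by simp
    then have "zeta r + 1 / zeta r = zeta s + 1 / zeta s" by (simp only: divide_cancel_right) simp
    moreover have "zeta r \<noteq> 0" "zeta s \<noteq> 0"
      using rnz fibre_pair_D[OF st(1)] st(1) zeta_eq_0_iff by (auto simp: fibre_pair_def)
    ultimately have "zeta r = zeta s \<or> zeta r = 1 / zeta s"
      by (intro joukowski_roots[of _ _ "(zeta s + 1 / zeta s) / 2"]) simp_all
    moreover have "1 / zeta s = zeta t" using fibre_pair_recip[OF st(1)] by simp
    ultimately have "r = s \<or> r = 1 / s \<or> r = t \<or> r = 1 / t"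
      using zeta_eq_iff[OF rnz(1)] st(1) by (auto simp: fibre_pair_def)
    moreover have "r \<noteq> 1 / s" "r \<noteq> 1 / t" using r1 st(1)
      by (auto simp: fibre_pair_def norm_divide divide_less_eq)
    ultimately show "s \<in> \<Omega> \<or> t \<in> \<Omega>" using r by auto
  qed (use st ts in \<open>auto intro: rev_image_eqI\<close>)
  ultimately show ?thesis using Some_in_boundary_iff by blast
qed

lemma m_zero_disc: "cmod t \<le> 1 \<Longrightarrow> m t = 0 \<longleftrightarrow> t = 0 \<or> t = inner_root 0"
proof -
  assume t: "cmod t \<le> 1"
  have z: "zeta (inner_root 0) = 0" by (rule zeta_inner_root)
  have r: "cmod (inner_root 0) < 1" by (rule norm_inner_root_less) (use zero_notin_cut in \<open>simp add: cut_def\<close>)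
  have "N t = 0 \<longleftrightarrow> t = inner_root 0" if "t \<noteq> 0"
  proof -
    have "N t = 0 \<longleftrightarrow> zeta t = zeta (inner_root 0)" using zeta_eq_0_iff[OF that] z by simp
    also have "\<dots> \<longleftrightarrow> t = inner_root 0 \<or> t = 1 / inner_root 0" using zeta_eq_iff[OF that inner_root_nz] .
    also have "\<dots> \<longleftrightarrow> t = inner_root 0" using t r inner_root_nz[of 0]
      by (auto simp: norm_divide divide_le_eq)
    finally show ?thesis .
  qed
  then show ?thesis by (auto simp: m_def)
qed

text \<open>
  Over \<open>z = \<infinity>\<close> the closed disc contains the points 0 (where \<open>\<zeta> = \<infinity>\<close>) and \<open>inner_root 0\<close> (where
  \<open>\<zeta> = 0\<close>). The comparison between them is that of the Robin constant \<open>ln (2 / |d|)\<close> with the value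
  of the Green function at 0.
\<close>

lemma None_Omega: "None \<in> zproj ` \<Omega> \<longleftrightarrow> cmod d \<noteq> 2 * cmod (inner_root 0)"
proof -
  have r: "cmod (inner_root 0) < 1" by (rule norm_inner_root_less) (use zero_notin_cut in \<open>simp add: cut_def\<close>)
  have Nr: "N (inner_root 0) = 0" using zeta_eq_0_iff[OF inner_root_nz, of 0] zeta_inner_root by simp
  have zproj_None: "zproj t = None \<longleftrightarrow> m t = 0" for t by (simp add: zproj_def)
  have "None \<in> zproj ` \<Omega> \<longleftrightarrow> (\<exists>t\<in>\<Omega>. m t = 0)" unfolding zproj_None[symmetric] by (metis imageE imageI)
  also have "\<dots> \<longleftrightarrow> 0 \<in> \<Omega> \<or> inner_root 0 \<in> \<Omega>"
  proof -
    have "cmod t \<le> 1" if "t \<in> \<Omega>" for t using that by (simp add: \<Omega>_def)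
    moreover have "m 0 = 0" "m (inner_root 0) = 0" using m_zero_disc[of 0] m_zero_disc[OF norm_inner_root] by auto
    ultimately show ?thesis using m_zero_disc by blast
  qed
  also have "0 \<in> \<Omega> \<longleftrightarrow> cmod d < 2 * cmod (inner_root 0)"
  proof -
    have p: "paired 0 s \<longleftrightarrow> s = inner_root 0" if "cmod s \<le> 1" for s
      using m_zero_disc[OF that] d_nz inner_root_nz[of 0] by (auto simp: paired_def m_def Nr)
    show ?thesis
    proof
      assume "0 \<in> \<Omega>"
      moreover have "cmod (inner_root 0) \<le> 1" "paired 0 (inner_root 0)" using r p by auto
      ultimately have "cmod (d * N 0) < 2 * cmod (inner_root 0) \<or> 2 * cmod 0 < cmod (d * N (inner_root 0))"
        unfolding \<Omega>_def by blast
      then show "cmod d < 2 * cmod (inner_root 0)" using Nr by simp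
    qed (use p in \<open>auto simp: \<Omega>_def\<close>)
  qed
  also have "inner_root 0 \<in> \<Omega> \<longleftrightarrow> 2 * cmod (inner_root 0) < cmod d"
  proof -
    have p: "paired (inner_root 0) s \<longleftrightarrow> s = 0" for s using Nr inner_root_nz by (auto simp: paired_def)
    show ?thesis
    proof
      assume "inner_root 0 \<in> \<Omega>"
      moreover have "cmod 0 \<le> 1" "paired (inner_root 0) 0" using p by auto
      ultimately have "cmod (d * N (inner_root 0)) < 2 * cmod 0 \<or> 2 * cmod (inner_root 0) < cmod (d * N 0)"
        unfolding \<Omega>_def by blast
      then show "2 * cmod (inner_root 0) < cmod d" by simp
    qed (use p r in \<open>auto simp: \<Omega>_def\<close>)
  qed
  finally show ?thesis by linarith
qed

text \<open>
  As \<open>z \<rightarrow> \<infinity>\<close>, the values of \<open>u\<close> on the second copy differ by a quantity \<open>\<delta>\<close> with limit \<open>\<Lambda>\<close>,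
  which is 0 exactly in the case of a tie over \<open>\<infinity>\<close>; both exceed the values on the first copy by
  amounts bounded away from 0. The gap between the two largest values is squeezed between
  \<open>|\<delta>|\<close> and the minimum \<open>G\<close> of these differences.
\<close>

lemma None_boundary: "None \<in> boundary_34 A B \<longleftrightarrow> None \<notin> zproj ` \<Omega>"
proof -
  let ?s = "\<lambda>z. inner_root (phi z)" and ?t = "\<lambda>z. inner_root (1 / phi z)"
  have st: "fibre_pair (?s z) (?t z)" "zproj (?s z) = Some z" for z
  proof -
    show st: "fibre_pair (?s z) (?t z)" using inner_root_nz norm_inner_root by (simp add: fibre_pair_def zeta_inner_root)
    show "zproj (?s z) = Some z" using zproj_fibre_pair[OF st] phi_add_inverse[of z] by (simp add: zeta_inner_root)
  qed
  define \<delta> where "\<delta> z = u_second (?s z) - u_second (?t z)" for z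
  define G where "G z = min \<bar>\<delta> z\<bar> (min (u_second (?s z) - u_first (?s z)) (u_second (?t z) - u_first (?t z)))" for z
  have bounds: "0 \<le> top_gap z" "top_gap z \<le> \<bar>\<delta> z\<bar>" "G z \<le> top_gap z" for z
  proof -
    have le: "u_first (?s z) \<le> u_second (?s z)" "u_first (?t z) \<le> u_second (?t z)"
      using st(1)[of z] u_first_le_u_second by (auto simp: fibre_pair_def)
    show "0 \<le> top_gap z" "top_gap z \<le> \<bar>\<delta> z\<bar>" "G z \<le> top_gap z"
      unfolding top_gap_fibre_pair[OF st] \<delta>_def G_def using le by auto
  qed
  have lim_s: "(?s \<longlongrightarrow> 0) at_infinity"
  proof -
    have "filterlim (\<lambda>z. (phi z - d * e) * (1 / d)) at_infinity at_infinity"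
    proof -
      have "filterlim (\<lambda>z. - (d * e) + phi z) at_infinity at_infinity"
        by (rule tendsto_add_filterlim_at_infinity[OF tendsto_const phi_at_infinity])
      then have "filterlim (\<lambda>z. (1 / d) * (- (d * e) + phi z)) at_infinity at_infinity"
        using d_nz by (intro tendsto_mult_filterlim_at_infinity[OF tendsto_const]) auto
      then show ?thesis by (simp add: mult.commute)
    qed
    then have "filterlim (\<lambda>z. (phi z - d * e) / d) at_infinity at_infinity" by simp
    then have "filterlim (\<lambda>z. phi ((phi z - d * e) / d)) at_infinity at_infinity"
      by (rule filterlim_compose[OF phi_at_infinity])
    then show ?thesis unfolding inner_root_def by (intro tendsto_divide_0[OF tendsto_const])
  qed
  have lim_t: "((\<lambda>z. cmod (?t z)) \<longlongrightarrow> cmod (inner_root 0)) at_infinity"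
  proof -
    have c: "continuous_on UNIV (\<lambda>\<zeta>. cmod (inner_root \<zeta>))"
    proof -
      have "continuous_on UNIV (\<lambda>\<zeta>. cmod (phi ((\<zeta> - d * e) / d)))"
        by (rule continuous_on_compose2[OF continuous_on_norm_phi[of UNIV]])
           (use d_nz in \<open>auto intro!: continuous_intros\<close>)
      then show ?thesis unfolding inner_root_def norm_divide by (intro continuous_on_divide) (auto intro: continuous_intros)
    qed
    have "((\<lambda>z. 1 / phi z) \<longlongrightarrow> 0) at_infinity"
      by (rule tendsto_divide_0[OF tendsto_const phi_at_infinity])
    then show ?thesis
      using continuous_on_tendsto_compose[OF c] by simp
  qed
  define \<Lambda> where "\<Lambda> = 2 * (ln (2 * cmod (inner_root 0)) - ln (cmod d))"
  have lim_\<delta>: "(\<delta> \<longlongrightarrow> \<Lambda>) at_infinity"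
  proof -
    have "((\<lambda>z. cmod (d * N (?s z))) \<longlongrightarrow> cmod (d * N 0)) at_infinity"
      by (intro tendsto_intros tendsto_N lim_s)
    then have "((\<lambda>z. 2 * (ln (2 * cmod (?t z)) - ln (cmod (d * N (?s z))))) \<longlongrightarrow>
        2 * (ln (2 * cmod (inner_root 0)) - ln (cmod (d * N 0)))) at_infinity"
      by (intro tendsto_mult tendsto_diff tendsto_ln tendsto_const lim_t) (use inner_root_nz d_nz in auto)
    then show ?thesis unfolding \<delta>_def u_second_diff[OF st(1)] by (simp add: \<Lambda>_def)
  qed
  have \<Lambda>0: "\<Lambda> = 0 \<longleftrightarrow> cmod d = 2 * cmod (inner_root 0)"
  proof -
    have "\<Lambda> = 0 \<longleftrightarrow> ln (cmod d) = ln (2 * cmod (inner_root 0))" by (auto simp: \<Lambda>_def)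
    also have "\<dots> \<longleftrightarrow> cmod d = 2 * cmod (inner_root 0)" using d_nz inner_root_nz by (intro ln_inj_iff) auto
    finally show ?thesis .
  qed
  have b: "None \<in> boundary_34 A B \<longleftrightarrow> (top_gap \<longlongrightarrow> 0) at_infinity"
    by (simp add: boundary_34_def top_gap_def[abs_def])
  show ?thesis unfolding None_Omega b not_not \<Lambda>0[symmetric]
  proof
    assume "\<Lambda> = 0"
    then have "((\<lambda>z. \<bar>\<delta> z\<bar>) \<longlongrightarrow> 0) at_infinity" using tendsto_rabs[OF lim_\<delta>] by simp
    then show "(top_gap \<longlongrightarrow> 0) at_infinity"
      by (rule tendsto_sandwich[where f = "\<lambda>_. 0" and h = "\<lambda>z. \<bar>\<delta> z\<bar>", rotated 3]) (use bounds in auto)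
  next
    assume g: "(top_gap \<longlongrightarrow> 0) at_infinity"
    show "\<Lambda> = 0"
    proof (rule ccontr)
      assume "\<Lambda> \<noteq> 0"
      have r: "cmod (inner_root 0) < 1" by (rule norm_inner_root_less) (use zero_notin_cut in \<open>simp add: cut_def\<close>)
      have lt: "((\<lambda>z. u_second (?t z) - u_first (?t z)) \<longlongrightarrow> - 4 * ln (cmod (inner_root 0))) at_infinity"
      proof -
        have "((\<lambda>z. - 4 * ln (cmod (?t z))) \<longlongrightarrow> - 4 * ln (cmod (inner_root 0))) at_infinity"
          by (intro tendsto_intros lim_t) (use inner_root_nz in auto)
        then show ?thesis by (simp add: u_second_def u_first_def algebra_simps)
      qed
      define \<epsilon> where "\<epsilon> = min (\<bar>\<Lambda>\<bar> / 2) (min (4 * ln 2) (- 2 * ln (cmod (inner_root 0))))"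
      have lnr: "ln (cmod (inner_root 0)) < 0" using r inner_root_nz by simp
      have \<epsilon>: "\<epsilon> > 0" using \<open>\<Lambda> \<noteq> 0\<close> lnr by (simp add: \<epsilon>_def)
      have "\<forall>\<^sub>F z in at_infinity. \<bar>\<delta> z\<bar> > \<bar>\<Lambda>\<bar> / 2"
        by (rule order_tendstoD(1)[OF tendsto_rabs[OF lim_\<delta>]]) (use \<open>\<Lambda> \<noteq> 0\<close> in simp)
      moreover have "\<forall>\<^sub>F z in at_infinity. cmod (?s z) < 1 / 2"
        by (rule order_tendstoD(2)[OF tendsto_norm[OF lim_s]]) simp
      moreover have "\<forall>\<^sub>F z in at_infinity. u_second (?t z) - u_first (?t z) > - 2 * ln (cmod (inner_root 0))"
        by (rule order_tendstoD(1)[OF lt]) (use lnr in simp)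
      moreover have "\<forall>\<^sub>F z in at_infinity. top_gap z < \<epsilon>"
        using order_tendstoD(2)[OF g \<epsilon>] .
      ultimately have "\<forall>\<^sub>F z::complex in at_infinity. False"
      proof eventually_elim
        case (elim z)
        have "ln (cmod (?s z)) < ln (1 / 2)" using elim(2) inner_root_nz by (intro ln_less_cancel_iff[THEN iffD2]) auto
        then have "u_second (?s z) - u_first (?s z) > 4 * ln 2" by (simp add: u_second_def u_first_def ln_div)
        moreover have "\<epsilon> \<le> \<bar>\<Lambda>\<bar> / 2" "\<epsilon> \<le> 4 * ln 2" "\<epsilon> \<le> - 2 * ln (cmod (inner_root 0))" by (simp_all add: \<epsilon>_def)
        ultimately have "G z \<ge> \<epsilon>" unfolding G_def using elim by (intro min.boundedI) linarith+
        then show False using bounds(3)[of z] elim by linarith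
      qed
      then show False using trivial_limit_at_infinity[where 'a = complex] by (simp add: trivial_limit_def)
    qed
  qed
qed

lemma boundary_eq: "boundary_34 A B = - zproj ` \<Omega>"
proof (rule set_eqI)
  fix p show "p \<in> boundary_34 A B \<longleftrightarrow> p \<in> - zproj ` \<Omega>"
    using Some_boundary None_boundary by (cases p) auto
qed

text \<open>
  The four values of \<open>f\<close> on a fibre add up to 0, so the sum over the first three sheets is \<open>- f\<close> at
  the fourth one, which lies on the second copy because \<open>u\<close> is larger there.
\<close>

lemma sheet_sum:
  assumes br: "\<And>t. t \<noteq> 0 \<Longrightarrow> N t \<noteq> 0 \<Longrightarrow> cmod t < 1 \<Longrightarrow> f_tilde (Some (zeta t)) = - F t"
    and sp: "sheet_points A B z [p1, p2, p3, p4]"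
  shows "\<exists>t\<in>\<Omega>. zproj t = Some z \<and> surface_f f_tilde p1 + surface_f f_tilde p2 + surface_f f_tilde p3 = - F t"
proof -
  obtain s t where st: "fibre_pair s t" "zproj s = Some z" using exists_fibre_pair by blast
  have ts: "fibre_pair t s" "zproj t = Some z"
    using st fibre_pair_sym zproj_fibre_pair[of s t] zproj_fibre_pair[of t s] by (auto simp: add.commute)
  have ms: "mset [p1, p2, p3, p4] = surface_fibre z"
    and u: "nuttall_u A B p1 < nuttall_u A B p4" "nuttall_u A B p2 < nuttall_u A B p4" "nuttall_u A B p3 < nuttall_u A B p4"
    using sp by (auto simp: sheet_points_def)
  have key: "s' \<in> \<Omega> \<and> surface_f f_tilde p1 + surface_f f_tilde p2 + surface_f f_tilde p3 = - F s'"
    if f: "fibre_pair s' t'" and z: "zproj s' = Some z" and p4: "p4 = (zeta s', Copy2)" for s' t'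
  proof -
    have nz: "s' \<noteq> 0" "cmod s' \<le> 1" "t' \<noteq> 0" "cmod t' \<le> 1" using f by (auto simp: fibre_pair_def)
    have "add_mset p4 {#p1, p2, p3#} = add_mset (zeta s', Copy2) {#(zeta s', Copy1), (zeta t', Copy1), (zeta t', Copy2)#}"
      using ms surface_fibre_pair[OF f z] by (simp add: add_mset_commute)
    then have rest: "{#p1, p2, p3#} = {#(zeta s', Copy1), (zeta t', Copy1), (zeta t', Copy2)#}" using p4 by simp
    have lt: "nuttall_u A B p < nuttall_u A B p4" if "p \<in># {#p1, p2, p3#}" for p using that u by auto
    have "u_second t' < u_second s'" "u_first s' < u_second s'"
      using lt[of "(zeta t', Copy2)"] lt[of "(zeta s', Copy1)"] nuttall_u_zeta nz
      unfolding rest p4 by (auto simp del: nuttall_u.simps)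
    then have O: "s' \<in> \<Omega>" using fibre_pair_Omega_iff[OF f] by simp
    have "surface_f f_tilde p1 + surface_f f_tilde p2 + surface_f f_tilde p3 = sum_mset (image_mset (surface_f f_tilde) {#p1, p2, p3#})"
      by (simp add: add.assoc)
    also have "\<dots> = f_tilde (Some (zeta s'))" unfolding rest by simp
    also have "\<dots> = - F s'" using O nz fibre_pair_D[OF f] by (intro br) (auto simp: \<Omega>_def)
    finally show ?thesis using O by simp
  qed
  have p4in: "p4 \<in># mset [p1, p2, p3, p4]" by simp
  then have "p4 \<in> {(zeta s, Copy1), (zeta t, Copy1), (zeta s, Copy2), (zeta t, Copy2)}"
    unfolding ms surface_fibre_pair[OF st] by simp
  moreover have "p4 \<noteq> (zeta r, Copy1)" if r: "r = s \<or> r = t" for r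
  proof
    assume p: "p4 = (zeta r, Copy1)"
    have "(zeta r, Copy2) \<in># mset [p1, p2, p3, p4]"
      unfolding ms surface_fibre_pair[OF st] using r by auto
    then have "nuttall_u A B (zeta r, Copy2) < nuttall_u A B p4" using p u by auto
    moreover have "r \<noteq> 0" "cmod r \<le> 1" using r st(1) by (auto simp: fibre_pair_def)
    ultimately show False using p nuttall_u_zeta[of r] u_first_le_u_second[of r] by simp
  qed
  ultimately have "p4 = (zeta s, Copy2) \<or> p4 = (zeta t, Copy2)" by blast
  then show ?thesis using key[OF st] key[OF ts] st ts by blast
qed

end

section \<open>Zeros of locally uniform limits of polynomials\<close>

lemma multi_subseq:
  fixes x :: "nat \<Rightarrow> nat \<Rightarrow> complex"
  assumes "compact C" "\<And>i n. i < k \<Longrightarrow> x i n \<in> C"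
  shows "\<exists>r l. strict_mono r \<and> (\<forall>i<k. l i \<in> C \<and> (\<lambda>n. x i (r n)) \<longlonglongrightarrow> l i)"
  using assms(2)
proof (induction k)
  case 0
  then show ?case by (auto intro!: exI[of _ id] simp: strict_mono_def)
next
  case (Suc k)
  then obtain r l where r: "strict_mono r" "\<And>i. i < k \<Longrightarrow> l i \<in> C \<and> (\<lambda>n. x i (r n)) \<longlonglongrightarrow> l i"
    by (metis less_Suc_eq)
  have "\<forall>n. x k (r n) \<in> C" using Suc.prems by simp
  then obtain a s where s: "a \<in> C" "strict_mono s" "((\<lambda>n. x k (r n)) \<circ> s) \<longlonglongrightarrow> a"
    using assms(1) unfolding compact_def by meson
  have "(\<lambda>n. x i (r (s n))) \<longlonglongrightarrow> l i" if "i < k" for i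
    using LIMSEQ_subseq_LIMSEQ[OF conjunct2[OF r(2)[OF that]] s(2)] by (simp add: o_def)
  moreover have "(\<lambda>n. x k (r (s n))) \<longlonglongrightarrow> a" using s(3) by (simp add: o_def)
  moreover have "strict_mono (\<lambda>n. r (s n))" using r(1) s(2) by (simp add: strict_mono_def)
  ultimately show ?case using r(2) s(1)
    by (intro exI[of _ "\<lambda>n. r (s n)"] exI[of _ "l(k := a)"]) (auto simp: less_Suc_eq)
qed

lemma uniform_limit_dominated:
  fixes f :: "nat \<Rightarrow> 'a \<Rightarrow> 'b :: metric_space"
  assumes "\<And>n x. x \<in> S \<Longrightarrow> dist (f n x) (g x) \<le> a n" "a \<longlonglongrightarrow> 0"
  shows "uniform_limit S f g sequentially"
  unfolding uniform_limit_iff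
proof (intro allI impI)
  fix \<epsilon> :: real assume "\<epsilon> > 0"
  then have "\<forall>\<^sub>F n in sequentially. a n < \<epsilon>" using order_tendstoD(2)[OF assms(2)] by auto
  then show "\<forall>\<^sub>F n in sequentially. \<forall>x\<in>S. dist (f n x) (g x) < \<epsilon>"
    by eventually_elim (use assms(1) in \<open>auto intro: le_less_trans\<close>)
qed

text \<open>
  Locally uniform convergence on \<open>W\<close>, with a polynomial limit; \<open>W\<close> is then open.
\<close>

definition loc_unif :: "complex set \<Rightarrow> (nat \<Rightarrow> complex poly) \<Rightarrow> complex poly \<Rightarrow> bool" where
  "loc_unif W Fs G \<longleftrightarrow> (\<forall>p\<in>W. \<exists>r>0. cball p r \<subseteq> W \<and>
     uniform_limit (cball p r) (\<lambda>n. poly (Fs n)) (poly G) sequentially)"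

lemma loc_unif_compact:
  assumes "loc_unif W Fs G" "compact T" "T \<subseteq> W"
  shows "uniform_limit T (\<lambda>n. poly (Fs n)) (poly G) sequentially"
proof -
  from assms(1) have "\<forall>p\<in>W. \<exists>r>0. uniform_limit (cball p r) (\<lambda>n. poly (Fs n)) (poly G) sequentially"
    by (auto simp: loc_unif_def)
  then obtain r where r: "\<And>p. p \<in> W \<Longrightarrow> r p > 0 \<and> uniform_limit (cball p (r p)) (\<lambda>n. poly (Fs n)) (poly G) sequentially"
    by metis
  have "T \<subseteq> (\<Union>p\<in>T. ball p (r p))" using r assms(3) by force
  then obtain D where D: "D \<subseteq> T" "finite D" "T \<subseteq> (\<Union>p\<in>D. ball p (r p))"
    using compactE_image[OF assms(2), of T "\<lambda>p. ball p (r p)"] by auto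
  have "uniform_limit (\<Union>p\<in>D. cball p (r p)) (\<lambda>n. poly (Fs n)) (poly G) sequentially"
    using D(2) r D(1) assms(3) by (intro uniform_limit_on_UNION) auto
  then show ?thesis by (rule uniform_limit_on_subset) (use D(3) in force)
qed

lemma uniform_limit_poly_max_modulus:
  assumes "0 < r" "uniform_limit (sphere p r) (\<lambda>n. poly (Fs n)) (poly G) sequentially"
  shows "uniform_limit (cball p r) (\<lambda>n. poly (Fs n)) (poly (G :: complex poly)) sequentially"
  unfolding uniform_limit_iff
proof (intro allI impI)
  fix \<epsilon> :: real assume \<epsilon>: "\<epsilon> > 0"
  then have "\<forall>\<^sub>F n in sequentially. \<forall>x\<in>sphere p r. dist (poly (Fs n) x) (poly G x) < \<epsilon> / 2"
    using assms(2) unfolding uniform_limit_iff by (meson half_gt_zero)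
  then show "\<forall>\<^sub>F n in sequentially. \<forall>x\<in>cball p r. dist (poly (Fs n) x) (poly G x) < \<epsilon>"
  proof eventually_elim
    case (elim n)
    have "cmod (poly (Fs n - G) x) \<le> \<epsilon> / 2" if "x \<in> cball p r" for x
    proof (rule maximum_modulus_frontier[of "poly (Fs n - G)" "cball p r"])
      show "poly (Fs n - G) holomorphic_on interior (cball p r)" by (intro holomorphic_intros)
      show "continuous_on (closure (cball p r)) (poly (Fs n - G))" by (intro continuous_intros)
      fix z assume "z \<in> frontier (cball p r)"
      then show "cmod (poly (Fs n - G) z) \<le> \<epsilon> / 2" using elim assms(1) by (force simp: dist_norm)
    qed (use that in auto)
    then show ?case using \<epsilon> by (fastforce simp: dist_norm)
  qed
qed

text \<open>
  A zero \<open>t n \<rightarrow> a\<close> can be divided out: the quotients converge uniformly on circles that avoid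
  \<open>a\<close>, hence by the maximum modulus principle on the discs they bound.
\<close>

lemma loc_unif_divide:
  assumes L: "loc_unif W Fs G" and t: "t \<longlonglongrightarrow> a" "a \<in> W"
    and F: "\<And>n. Fs n = [:- t n, 1:] * Fs' n"
  shows "\<exists>G'. G = [:- a, 1:] * G' \<and> loc_unif W Fs' G'"
proof -
  have "poly G a = 0"
  proof -
    from L t(2) obtain r where r: "r > 0" "uniform_limit (cball a r) (\<lambda>n. poly (Fs n)) (poly G) sequentially"
      by (auto simp: loc_unif_def)
    have "(\<lambda>n. poly G (t n)) \<longlonglongrightarrow> 0"
    proof (rule tendstoI)
      fix \<epsilon> :: real assume "\<epsilon> > 0"
      then have "\<forall>\<^sub>F n in sequentially. \<forall>x\<in>cball a r. dist (poly (Fs n) x) (poly G x) < \<epsilon>"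
        using r(2) by (auto simp: uniform_limit_iff)
      moreover have "\<forall>\<^sub>F n in sequentially. dist (t n) a < r" using t(1) r(1) by (rule tendstoD)
      ultimately show "\<forall>\<^sub>F n in sequentially. dist (poly G (t n)) 0 < \<epsilon>"
      proof eventually_elim
        case (elim n)
        then have "dist (poly (Fs n) (t n)) (poly G (t n)) < \<epsilon>" by (auto simp: dist_commute)
        then show ?case using F by (simp add: dist_commute)
      qed
    qed
    moreover have "(\<lambda>n. poly G (t n)) \<longlonglongrightarrow> poly G a" using t(1) by (intro tendsto_intros)
    ultimately show ?thesis by (rule LIMSEQ_unique[symmetric])
  qed
  then obtain G' where G: "G = [:- a, 1:] * G'" by (auto simp: poly_eq_0_iff_dvd dvd_def)
  have "loc_unif W Fs' G'" unfolding loc_unif_def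
  proof
    fix p assume "p \<in> W"
    with L obtain r0 where r0: "r0 > 0" "cball p r0 \<subseteq> W"
      "uniform_limit (cball p r0) (\<lambda>n. poly (Fs n)) (poly G) sequentially" by (auto simp: loc_unif_def)
    \<comment> \<open>Shrink the disc so that its boundary circle misses the limit root \<open>a\<close>.\<close>
    define r where "r = (if dist p a = r0 then r0 / 2 else r0)"
    have r: "r > 0" "r \<le> r0" "dist p a \<noteq> r" using r0(1) by (auto simp: r_def)
    define \<eta> where "\<eta> = \<bar>r - dist p a\<bar>"
    have \<eta>: "\<eta> > 0" using r by (simp add: \<eta>_def)
    have far: "\<eta> \<le> cmod (x - a)" if "x \<in> sphere p r" for x
      using that norm_triangle_ineq3[of "x - p" "a - p"] dist_triangle3[of p x a]
      unfolding \<eta>_def by (simp add: dist_norm norm_minus_commute abs_minus_commute)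
    have u: "uniform_limit (sphere p r) (\<lambda>n x. poly (Fs n) x / (x - t n)) (\<lambda>x. poly G x / (x - a)) sequentially"
    proof (rule uniform_lim_divide[OF _ _ _ far \<eta>])
      show "uniform_limit (sphere p r) (\<lambda>n. poly (Fs n)) (poly G) sequentially"
        by (rule uniform_limit_on_subset[OF r0(3)]) (use r in auto)
      show "uniform_limit (sphere p r) (\<lambda>n x. x - t n) (\<lambda>x. x - a) sequentially"
      proof (rule uniform_limit_dominated)
        show "(\<lambda>n. dist (t n) a) \<longlonglongrightarrow> 0" using t(1) by (rule iffD1[OF tendsto_dist_iff])
      qed (simp add: dist_norm norm_minus_commute)
      show "bounded (poly G ` sphere p r)"
        by (intro compact_imp_bounded compact_continuous_image continuous_intros) auto
    qed
    have c1: "\<forall>\<^sub>F n in sequentially. \<forall>x\<in>sphere p r. poly (Fs n) x / (x - t n) = poly (Fs' n) x"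
    proof -
      have "\<forall>\<^sub>F n in sequentially. dist (t n) a < \<eta>" using t(1) \<eta> by (rule tendstoD)
      then show ?thesis
      proof (eventually_elim, intro ballI)
        fix n x assume *: "dist (t n) a < \<eta>" "x \<in> sphere p r"
        then have "x \<noteq> t n" using far[of x] by (auto simp: dist_norm)
        then show "poly (Fs n) x / (x - t n) = poly (Fs' n) x" unfolding F by (simp add: field_simps)
      qed
    qed
    have c2: "poly G x / (x - a) = poly G' x" if "x \<in> sphere p r" for x
    proof -
      have "x - a \<noteq> 0" using far[OF that] \<eta> by auto
      moreover have "poly G x = (x - a) * poly G' x" unfolding G by (simp add: algebra_simps)
      ultimately show ?thesis by simp
    qed
    have "uniform_limit (sphere p r) (\<lambda>n. poly (Fs' n)) (poly G') sequentially"
      using u uniform_limit_cong[OF c1 c2] by simp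
    then have "uniform_limit (cball p r) (\<lambda>n. poly (Fs' n)) (poly G') sequentially"
      using r(1) by (intro uniform_limit_poly_max_modulus)
    moreover have "cball p r \<subseteq> W" using r0(2) r(2) by auto
    ultimately show "\<exists>r>0. cball p r \<subseteq> W \<and> uniform_limit (cball p r) (\<lambda>n. poly (Fs' n)) (poly G') sequentially"
      using r(1) by blast
  qed
  with G show ?thesis by blast
qed

text \<open>
  A version of Hurwitz's theorem that keeps track of multiplicities without counting integrals: any
  list of convergent zeros survives in the limit.
\<close>

lemma loc_unif_roots:
  fixes k :: nat
  assumes "loc_unif W Fs G" "\<And>i. i < k \<Longrightarrow> (\<lambda>n. t i n) \<longlonglongrightarrow> l i \<and> l i \<in> W"
    and "\<And>n. (\<Prod>i<k. [:- t i n, 1:]) dvd Fs n"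
  shows "(\<Prod>i<k. [:- l i, 1:]) dvd G"
  using assms
proof (induction k arbitrary: Fs G)
  case (Suc k)
  have "\<exists>H. Fs n = (\<Prod>i<k. [:- t i n, 1:]) * [:- t k n, 1:] * H" for n
    using Suc.prems(3)[of n] by (auto simp: dvd_def)
  then obtain H where H: "\<And>n. Fs n = (\<Prod>i<k. [:- t i n, 1:]) * [:- t k n, 1:] * H n" by metis
  define Fs' where "Fs' n = (\<Prod>i<k. [:- t i n, 1:]) * H n" for n
  have F: "Fs n = [:- t k n, 1:] * Fs' n" for n
    unfolding H[of n] Fs'_def by (simp only: mult_ac)
  obtain G' where G': "G = [:- l k, 1:] * G'" "loc_unif W Fs' G'"
    using loc_unif_divide[OF Suc.prems(1) _ _ F, of "l k"] Suc.prems(2)[of k] by auto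
  have "(\<Prod>i<k. [:- l i, 1:]) dvd G'"
    by (rule Suc.IH[OF G'(2)]) (use Suc.prems(2) in \<open>auto simp: Fs'_def\<close>)
  then show ?case unfolding G'(1) prod.lessThan_Suc by (metis mult.commute mult_dvd_mono dvd_refl)
qed simp

section \<open>The branch of the function and the degree of the remainder\<close>

lemma degree_le_of_bigo_power:
  assumes "poly p \<in> O[at_infinity](\<lambda>t::complex. t ^ n)"
  shows "degree p \<le> n"
proof -
  obtain C where "\<forall>\<^sub>F t in at_infinity. cmod (poly p t) \<le> C * cmod (t ^ n)"
    using assms by (elim landau_o.bigE)
  then obtain R where R: "\<And>t. R \<le> cmod t \<Longrightarrow> cmod (poly p t) \<le> C * cmod t ^ n"
    by (auto simp: eventually_at_infinity norm_power)
  define c where "c i = (deriv ^^ i) (poly p) 0 / fact i" for i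
  have "poly p x = (\<Sum>i\<le>n. c i * x ^ i)" for x
    unfolding c_def by (rule Liouville_polynomial[OF _ R]) (intro holomorphic_intros)
  then have "poly p = poly (\<Sum>i\<le>n. monom (c i) i)" by (simp add: fun_eq_iff poly_sum poly_monom)
  then have "p = (\<Sum>i\<le>n. monom (c i) i)" by (simp only: poly_eq_poly_eq_iff)
  then show ?thesis by (auto intro!: degree_sum_le order_trans[OF degree_monom_le])
qed

context four_sheets
begin

lemma F_square:
  assumes "t \<noteq> 0" "N t \<noteq> 0" "t\<^sup>2 \<noteq> 1"
  shows "(F t)\<^sup>2 * ((A - 1 / zeta t) * (B - 1 / zeta t)) = 1"
proof -
  define w where "w = d * N t / 2"
  have w: "w \<noteq> 0" "zeta t = w / t" using assms d_nz by (simp_all add: w_def zeta_def)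
  have "(A - 1 / zeta t) * (B - 1 / zeta t) = (A * w - t) * (B * w - t) / w\<^sup>2"
    using w by (simp add: field_simps power2_eq_square)
  also have "(A * w - t) * (B * w - t) = A * d / 2 * (t - 1)\<^sup>2 * (B * d / 2 * (t + 1)\<^sup>2)"
    unfolding w_def A_factor B_factor ..
  also have "A * d / 2 * u * (B * d / 2 * v) = A * B * (d / 2)\<^sup>2 * (u * v)" for u v
    by (simp add: power2_eq_square)
  also have "(t - 1)\<^sup>2 * (t + 1)\<^sup>2 = (t\<^sup>2 - 1)\<^sup>2" by (simp add: power2_eq_square algebra_simps)
  also have "(F t)\<^sup>2 * (A * B * (d / 2)\<^sup>2 * (t\<^sup>2 - 1)\<^sup>2 / w\<^sup>2) = k\<^sup>2 * (A * B) * ((N t)\<^sup>2 * (d / 2)\<^sup>2 / w\<^sup>2)"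
    using assms(3) by (simp add: F_def power_divide power_mult_distrib)
  also have "(N t)\<^sup>2 * (d / 2)\<^sup>2 / w\<^sup>2 = 1" using w(1) by (simp add: w_def power_divide power_mult_distrib)
  finally show ?thesis using k_square by simp
qed

lemma inner_root_zeta:
  assumes "t \<noteq> 0" "cmod t < 1"
  shows "inner_root (zeta t) = t" "zeta t \<notin> cut A B"
proof -
  have "inner_root (zeta t) = t \<or> inner_root (zeta t) = 1 / t"
    using zeta_eq_iff[OF inner_root_nz assms(1)] zeta_inner_root by blast
  moreover have "cmod (1 / t) > 1" using assms by (simp add: norm_divide)
  ultimately show r: "inner_root (zeta t) = t" using norm_inner_root[of "zeta t"] by auto
  have "cmod (phi ((zeta t - d * e) / d)) = 1 / cmod (inner_root (zeta t))" by (simp add: inner_root_def norm_divide)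
  then show "zeta t \<notin> cut A B" unfolding cut_iff r using assms by auto
qed

text \<open>
  The two functions have the same square and no zeros on the complement of the cut without 0,
  which is connected.
\<close>

lemma branch_sign:
  assumes "branch_off_cut A B f f_tilde"
  shows "\<exists>\<sigma>. \<sigma>\<^sup>2 = 1 \<and> (\<forall>t. t \<noteq> 0 \<and> N t \<noteq> 0 \<and> cmod t < 1 \<longrightarrow> f_tilde (Some (zeta t)) = \<sigma> * F t)"
proof -
  let ?D = "- cut A B - {0}"
  define g where "g \<zeta> = f_tilde (Some \<zeta>) / F (inner_root \<zeta>)" for \<zeta>
  have r1: "cmod (inner_root \<zeta>) < 1" "N (inner_root \<zeta>) \<noteq> 0" "(inner_root \<zeta>)\<^sup>2 \<noteq> 1" if "\<zeta> \<in> ?D" for \<zeta>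
  proof -
    show r: "cmod (inner_root \<zeta>) < 1" using that norm_inner_root_less by auto
    show "N (inner_root \<zeta>) \<noteq> 0" using zeta_eq_0_iff[OF inner_root_nz, of \<zeta>] zeta_inner_root that by auto
    show "(inner_root \<zeta>)\<^sup>2 \<noteq> 1" using r by (auto simp: power2_eq_1_iff)
  qed
  have sq: "(g \<zeta>)\<^sup>2 = 1" if "\<zeta> \<in> ?D" for \<zeta>
  proof -
    have "(f_tilde (Some \<zeta>))\<^sup>2 * ((A - 1 / \<zeta>) * (B - 1 / \<zeta>)) = 1"
      using assms that by (auto simp: branch_off_cut_def)
    moreover have F: "(F (inner_root \<zeta>))\<^sup>2 * ((A - 1 / \<zeta>) * (B - 1 / \<zeta>)) = 1"
      using F_square[OF inner_root_nz r1(2,3)[OF that]] by (simp add: zeta_inner_root)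
    ultimately have "(f_tilde (Some \<zeta>))\<^sup>2 = (F (inner_root \<zeta>))\<^sup>2" by (metis mult_cancel_right zero_neq_one mult_zero_right)
    moreover have "F (inner_root \<zeta>) \<noteq> 0" using F by auto
    ultimately show ?thesis by (simp add: g_def power_divide)
  qed
  have "continuous_on ?D g"
  proof -
    have "(f_tilde \<circ> Some) holomorphic_on (Some -` (- Some ` cut A B))"
      using assms by (auto simp: branch_off_cut_def sphere_holomorphic_on_def)
    moreover have "Some -` (- Some ` cut A B) = - cut A B" by auto
    ultimately have 1: "continuous_on ?D (\<lambda>\<zeta>. f_tilde (Some \<zeta>))"
      using holomorphic_on_imp_continuous_on continuous_on_subset by (fastforce simp: o_def)
    have "(phi \<circ> (\<lambda>\<zeta>. (\<zeta> - d * e) / d)) holomorphic_on ?D"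
      by (rule holomorphic_on_compose_gen[OF _ holomorphic_on_phi])
         (use d_nz in \<open>auto intro!: holomorphic_intros simp: cut_iff norm_phi_eq_1_iff\<close>)
    then have "continuous_on ?D (\<lambda>\<zeta>. phi ((\<zeta> - d * e) / d))"
      by (simp add: o_def holomorphic_on_imp_continuous_on)
    then have 2: "continuous_on ?D inner_root" unfolding inner_root_def[abs_def] by (intro continuous_intros) auto
    show ?thesis unfolding g_def F_def N_def
      by (intro continuous_intros 1 2) (use r1 k_nz in \<open>auto simp: N_def\<close>)
  qed
  moreover have "connected ?D"
  proof (rule connected_open_delete)
    show "open (- cut A B)" by (simp add: cut_def open_Compl)
    show "connected (- cut A B)" unfolding cut_def
      by (rule connected_complement_bounded_convex) (auto intro: bounded_closed_segment)
  qed auto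
  ultimately have con: "connected (g ` ?D)" by (rule connected_continuous_image)
  have sub: "g ` ?D \<subseteq> {1, -1}" using sq by (auto simp: power2_eq_1_iff)
  then have "finite (g ` ?D)" using finite_subset by blast
  then have "g ` ?D = {} \<or> (\<exists>a. g ` ?D = {a})" using connected_finite_iff_sing[OF con] by blast
  then obtain \<sigma> where \<sigma>: "\<sigma>\<^sup>2 = 1" "\<And>\<zeta>. \<zeta> \<in> ?D \<Longrightarrow> g \<zeta> = \<sigma>"
  proof (elim disjE exE)
    assume "g ` ?D = {}"
    then show ?thesis by (intro that[of 1]) auto
  next
    fix a assume a: "g ` ?D = {a}"
    then have "a \<in> {1, -1}" using sub by blast
    then have "a\<^sup>2 = 1" by auto
    then show ?thesis using a by (intro that[of a]) auto
  qed
  have "f_tilde (Some (zeta t)) = \<sigma> * F t" if t: "t \<noteq> 0" "N t \<noteq> 0" "cmod t < 1" for t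
  proof -
    have D: "zeta t \<in> ?D" using inner_root_zeta[OF t(1,3)] zeta_eq_0_iff[OF t(1)] t by auto
    have "t\<^sup>2 \<noteq> 1" using t(3) by (auto simp: power2_eq_1_iff)
    then have "F t \<noteq> 0" using t k_nz by (simp add: F_def)
    then show ?thesis using \<sigma>(2)[OF D] inner_root_zeta(1)[OF t(1,3)] by (simp add: g_def field_simps)
  qed
  with \<sigma>(1) show ?thesis by blast
qed

lemma one_over_tendsto: "((\<lambda>t::complex. 1 / t) \<longlongrightarrow> 0) at_infinity"
  by (rule tendsto_divide_0[OF tendsto_const filterlim_ident])

lemma N_asymp: "((\<lambda>t. N t / t\<^sup>2) \<longlongrightarrow> 1) at_infinity"
proof -
  have "((\<lambda>t. 1 + 2 * e * (1 / t) + (1 / t)\<^sup>2) \<longlongrightarrow> 1 + 2 * e * 0 + 0\<^sup>2) at_infinity"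
    by (intro tendsto_intros one_over_tendsto)
  then have "((\<lambda>t. 1 + 2 * e * (1 / t) + (1 / t)\<^sup>2) \<longlongrightarrow> 1) at_infinity" by simp
  then show ?thesis
    by (rule Lim_transform_eventually)
       (use eventually_not_equal_at_infinity[of 0] in eventually_elim, simp add: N_def field_simps power2_eq_square)
qed

lemma z_asymp: "((\<lambda>t. (X t / m t) / t) \<longlongrightarrow> d / 4) at_infinity"
proof -
  have "((\<lambda>t. d / 4 * (N t / t\<^sup>2) + (1 / t)\<^sup>2 / (d * (N t / t\<^sup>2))) \<longlongrightarrow> d / 4 * 1 + 0\<^sup>2 / (d * 1)) at_infinity"
    by (intro tendsto_intros one_over_tendsto N_asymp) (use d_nz in auto)
  then have *: "((\<lambda>t. d / 4 * (N t / t\<^sup>2) + (1 / t)\<^sup>2 / (d * (N t / t\<^sup>2))) \<longlongrightarrow> d / 4) at_infinity" by simp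
  have "\<forall>\<^sub>F t in at_infinity. N t / t\<^sup>2 \<noteq> 0" by (rule tendsto_imp_eventually_ne[OF N_asymp]) simp
  then have "\<forall>\<^sub>F t in at_infinity. d / 4 * (N t / t\<^sup>2) + (1 / t)\<^sup>2 / (d * (N t / t\<^sup>2)) = (X t / m t) / t"
    by eventually_elim (use d_nz in \<open>auto simp: X_def m_def field_simps power2_eq_square\<close>)
  then show ?thesis by (rule Lim_transform_eventually[OF *])
qed

lemma z_at_infinity: "filterlim (\<lambda>t. X t / m t) at_infinity at_infinity"
proof -
  have "filterlim (\<lambda>t. ((X t / m t) / t) * t) at_infinity at_infinity"
    by (rule tendsto_mult_filterlim_at_infinity[OF z_asymp _ filterlim_ident]) (use d_nz in simp)
  then show ?thesis
    by (rule filterlim_mono_eventually[OF _ order_refl order_refl])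
       (use eventually_not_equal_at_infinity[of 0] in eventually_elim, simp)
qed

text \<open>
  Near \<open>t = \<infinity>\<close>, that is at \<open>\<infinity>\<^sup>(\<^sup>1\<^sup>)\<close>, the function \<open>F\<close> is the given germ, because \<open>\<phi> (z) = \<zeta>\<close> as soon
  as \<open>|\<zeta>| > 1\<close>. The assumption fixes the sign of \<open>k\<close>.
\<close>

lemma germ_eq_F:
  assumes bo: "branch_off_cut A B f f_tilde"
    and br: "\<And>t. t \<noteq> 0 \<Longrightarrow> N t \<noteq> 0 \<Longrightarrow> cmod t < 1 \<Longrightarrow> f_tilde (Some (zeta t)) = - F t"
  shows "\<forall>\<^sub>F t in at_infinity. f (Some (X t / m t)) = F t \<and> m t \<noteq> 0 \<and> t\<^sup>2 \<noteq> 1 \<and> t \<noteq> 0"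
proof -
  have ev1: "\<forall>\<^sub>F t::complex in at_infinity. cmod t > 1"
    using eventually_at_infinity by (force intro: exI[of _ 2])
  have "filterlim (\<lambda>t. (d / 2 * (N t / t\<^sup>2)) * t) at_infinity at_infinity"
    by (rule tendsto_mult_filterlim_at_infinity[OF tendsto_mult[OF tendsto_const N_asymp] _ filterlim_ident])
       (use d_nz in simp)
  then have zeta1: "\<forall>\<^sub>F t in at_infinity. cmod ((d / 2 * (N t / t\<^sup>2)) * t) > 1"
    using ev1 by (auto simp: filterlim_iff)
  from zeta1 ev1 show ?thesis
  proof eventually_elim
    case (elim t)
    then have t0: "t \<noteq> 0" by auto
    have z1: "cmod (zeta t) > 1" using elim(1) t0 by (simp add: zeta_def power2_eq_square)
    then have N0: "N t \<noteq> 0" using zeta_eq_0_iff[OF t0] by auto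
    have m0: "m t \<noteq> 0" using t0 N0 by (simp add: m_def)
    have t1: "t\<^sup>2 \<noteq> 1" using elim(2) by (auto simp: power2_eq_1_iff)
    have "zeta t + 1 / zeta t = 2 * (X t / m t)"
      using zproj_zeta[OF t0(1) N0] m0 by (simp add: zproj_def mult.commute)
    then have ph: "phi (X t / m t) = zeta t" using z1 by (rule phi_joukowski)
    have "X t / m t \<notin> closed_segment (-1) 1"
      using norm_phi_eq_1_iff[of "X t / m t"] ph z1 by auto
    then have "f (Some (X t / m t)) = f_tilde (Some (zeta t))"
      using bo ph by (auto simp: branch_off_cut_def)
    also have "\<dots> = f_tilde (Some (zeta (1 / t)))" using t0 by (simp add: zeta_recip)
    also have "\<dots> = - F (1 / t)"
      using t0 N0 elim(2) by (intro br) (auto simp: N_recip norm_divide)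
    also have "\<dots> = F t" using t0 t1 by (simp add: F_recip)
    finally show ?case using m0 t1 t0 by simp
  qed
qed

text \<open>
  This is where the order of vanishing enters. The point \<open>\<infinity>\<^sup>(\<^sup>1\<^sup>)\<close> is \<open>t = \<infinity>\<close>, where \<open>z\<close> grows
  like \<open>t\<close> and \<open>m\<close> like \<open>t ^ 3\<close>. The numerator of the remainder is thus of order
  \<open>3 n + 6 - (3 n + 3)\<close>.
\<close>

lemma degree_rempoly:
  assumes deg: "\<And>j. j \<le> 3 \<Longrightarrow> degree (Q j) \<le> n"
    and bo: "branch_off_cut A B f f_tilde"
    and br: "\<And>t. t \<noteq> 0 \<Longrightarrow> N t \<noteq> 0 \<Longrightarrow> cmod t < 1 \<Longrightarrow> f_tilde (Some (zeta t)) = - F t"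
    and O: "(\<lambda>z. \<Sum>j\<le>3. poly (Q j) z * f (Some z) ^ j) \<in> O[at_infinity](\<lambda>z. 1 / z ^ (3 * n + 3))"
  shows "degree (rempoly n Q) \<le> 3"
proof (rule degree_le_of_bigo_power)
  let ?z = "\<lambda>t. X t / m t"
  have nz: "\<forall>\<^sub>F t::complex in at_infinity. t \<noteq> 0" by (rule eventually_not_equal_at_infinity)
  have germ: "\<forall>\<^sub>F t in at_infinity. f (Some (?z t)) = F t \<and> m t \<noteq> 0 \<and> t\<^sup>2 \<noteq> 1 \<and> t \<noteq> 0"
    using bo by (rule germ_eq_F) (fact br)
  have mO: "m \<in> O[at_infinity](\<lambda>t. t ^ 3)"
  proof (rule bigoI_tendsto)
    show "((\<lambda>t. m t / t ^ 3) \<longlongrightarrow> 1) at_infinity"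
      by (rule Lim_transform_eventually[OF N_asymp])
         (use nz in eventually_elim, simp add: m_def power2_eq_square power3_eq_cube)
  qed (use nz in eventually_elim, simp)
  have tO: "(\<lambda>t::complex. t\<^sup>2 - 1) \<in> O[at_infinity](\<lambda>t. t\<^sup>2)"
  proof (rule bigoI_tendsto)
    have "((\<lambda>t::complex. 1 - (1 / t)\<^sup>2) \<longlongrightarrow> 1 - 0\<^sup>2) at_infinity" by (intro tendsto_intros one_over_tendsto)
    then show "((\<lambda>t::complex. (t\<^sup>2 - 1) / t\<^sup>2) \<longlongrightarrow> 1 - 0\<^sup>2) at_infinity"
      by (rule Lim_transform_eventually) (use nz in eventually_elim, simp add: field_simps power2_eq_square)
  qed (use nz in eventually_elim, simp)
  have zO: "(\<lambda>t. 1 / ?z t) \<in> O[at_infinity](\<lambda>t. 1 / t)"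
  proof (rule bigoI_tendsto)
    have "((\<lambda>t. 1 / (?z t / t)) \<longlongrightarrow> 1 / (d / 4)) at_infinity"
      by (intro tendsto_intros z_asymp) (use d_nz in auto)
    then show "((\<lambda>t. (1 / ?z t) / (1 / t)) \<longlongrightarrow> 1 / (d / 4)) at_infinity" by simp
  qed (use nz in eventually_elim, simp)
  have "(\<lambda>t. \<Sum>j\<le>3. poly (Q j) (?z t) * f (Some (?z t)) ^ j) \<in> O[at_infinity](\<lambda>t. 1 / ?z t ^ (3 * n + 3))"
    using landau_o.big.compose[OF O z_at_infinity] .
  also have "(\<lambda>t. 1 / ?z t ^ (3 * n + 3)) = (\<lambda>t. (1 / ?z t) ^ (3 * n + 3))" by (simp only: power_one_over)
  also have "\<dots> \<in> O[at_infinity](\<lambda>t. (1 / t) ^ (3 * n + 3))" by (rule landau_o.big_power[OF zO])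
  finally have "(\<lambda>t. m t ^ n * (t\<^sup>2 - 1) ^ 3 * (\<Sum>j\<le>3. poly (Q j) (?z t) * f (Some (?z t)) ^ j))
      \<in> O[at_infinity](\<lambda>t. (t ^ 3) ^ n * (t\<^sup>2) ^ 3 * (1 / t) ^ (3 * n + 3))"
    by (intro landau_o.big.mult landau_o.big_power mO tO)
  also have "?this \<longleftrightarrow> poly (rempoly n Q) \<in> O[at_infinity](\<lambda>t. t ^ 3)"
  proof (rule landau_o.big.cong_ex)
    show "\<forall>\<^sub>F t in at_infinity. m t ^ n * (t\<^sup>2 - 1) ^ 3 * (\<Sum>j\<le>3. poly (Q j) (?z t) * f (Some (?z t)) ^ j) = poly (rempoly n Q) t"
      using germ by eventually_elim (use deg in \<open>simp add: poly_rempoly remainder_def\<close>)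
    show "\<forall>\<^sub>F t::complex in at_infinity. (t ^ 3) ^ n * (t\<^sup>2) ^ 3 * (1 / t) ^ (3 * n + 3) = t ^ 3"
      using nz
    proof eventually_elim
      case (elim t)
      have "(t ^ 3) ^ n * (t\<^sup>2) ^ 3 = t ^ (3 * n + 3) * t ^ 3" by (simp add: add.commute flip: power_mult power_add)
      then show ?case using elim by (simp add: power_one_over)
    qed
  qed
  finally show "poly (rempoly n Q) \<in> O[at_infinity](\<lambda>t. t ^ 3)" .
qed

text \<open>
  If the remainder vanished identically, then it would vanish at all points of a generic fibre,
  and the linear system would force all coefficients to vanish.
\<close>

lemma rempoly_nz:
  assumes deg: "\<And>j. j \<le> 3 \<Longrightarrow> degree (Q j) \<le> n" and nz: "\<exists>j\<le>3. Q j \<noteq> 0"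
  shows "rempoly n Q \<noteq> 0"
proof
  assume P: "rempoly n Q = 0"
  obtain j where j: "j \<le> 3" "Q j \<noteq> 0" using nz by blast
  have S0: "remainder Q s = 0" if "m s \<noteq> 0" "s\<^sup>2 \<noteq> 1" for s
    using poly_rempoly[of Q n s, OF deg that] P that by simp
  have "poly (lhs_coeff j * homogenize n (Q j) * excpoly) t = 0" for t
  proof (cases "poly excpoly t = 0")
    case False
    then have t: "t \<noteq> 0" "N t \<noteq> 0" "t\<^sup>2 \<noteq> 1" by (auto simp: poly_excpoly)
    then obtain t' where t': "paired t t'" using exists_paired by blast
    note ef = error_formula[of Q n t t' j, OF deg False t' j(1)]
    have "remainder Q (1 / t) = 0" "remainder Q t' = 0" "remainder Q (1 / t') = 0"
      using t ef(2-4) by (auto intro!: S0 simp: m_recip power_divide) (auto simp: m_def)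
    then have "poly (lhs_coeff j * homogenize n (Q j) - rhs_coeff j * rempoly n Q) t = 0" using ef(1) by simp
    then show ?thesis using P by simp
  qed simp
  then have "lhs_coeff j * homogenize n (Q j) * excpoly = 0" using poly_all_0_iff_0 by blast
  then have h: "homogenize n (Q j) = 0" using lhs_coeff_nz excpoly_nz by auto
  have "poly (Q j) z = 0" for z
  proof -
    obtain s t where st: "fibre_pair s t" "zproj s = Some z" using exists_fibre_pair by blast
    then have "m s \<noteq> 0" "X s / m s = z" using fibre_pair_D[OF st(1)] by (auto simp: zproj_def)
    then show ?thesis using poly_homogenize[OF deg[OF j(1)], of s] h by simp
  qed
  then show False using j(2) poly_all_0_iff_0 by blast
qed

end

section \<open>Asymptotics of the coefficients\<close>

lemma prod_list_linear_factors_dvd: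
  fixes g :: "'a \<Rightarrow> 'b :: comm_monoid_mult"
  assumes "\<And>x. x \<in> set xs \<Longrightarrow> g x dvd h x"
  shows "prod_list (map g xs) dvd prod_list (map h xs)"
  using assms by (induction xs) (auto intro: mult_dvd_mono)

context four_sheets
begin

lemma poly_eq_off_m:
  assumes "\<And>t. m t \<noteq> 0 \<Longrightarrow> poly p t = poly q t"
  shows "p = q"
proof -
  have "poly ((p - q) * mp) t = 0" for t by (cases "m t = 0") (use assms in auto)
  then have "(p - q) * mp = 0" using poly_all_0_iff_0 by blast
  then show ?thesis using mp_nz by simp
qed

lemma homogenize_linear_factor:
  assumes "degree Q \<le> n"
  shows "homogenize (Suc n) ([:- z, 1:] * Q) = (xp - smult z mp) * homogenize n Q"
proof (rule poly_eq_off_m)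
  fix t assume m: "m t \<noteq> 0"
  have "degree ([:- z, 1:] * Q) \<le> Suc n"
    using degree_mult_le[of "[:- z, 1:]" Q] assms by simp
  then have "poly (homogenize (Suc n) ([:- z, 1:] * Q)) t = m t ^ Suc n * poly ([:- z, 1:] * Q) (X t / m t)"
    using m by (rule poly_homogenize)
  also have "\<dots> = (X t - z * m t) * (m t ^ n * poly Q (X t / m t))"
    using m by (simp add: field_simps)
  also have "\<dots> = poly ((xp - smult z mp) * homogenize n Q) t"
    using poly_homogenize[OF assms m] by simp
  finally show "poly (homogenize (Suc n) ([:- z, 1:] * Q)) t = poly ((xp - smult z mp) * homogenize n Q) t" .
qed

lemma homogenize_roots_dvd:
  assumes "Q \<noteq> 0" "degree Q \<le> n" "mset zs \<subseteq># proots Q"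
  shows "prod_list (map (\<lambda>z. xp - smult z mp) zs) dvd homogenize n Q"
  using assms
proof (induction zs arbitrary: Q n)
  case (Cons z zs)
  then have "z \<in># proots Q" by (auto dest: mset_subset_eqD)
  then have "poly Q z = 0" using Cons.prems(1) by simp
  then obtain Q' where Q: "Q = [:- z, 1:] * Q'" by (auto simp: poly_eq_0_iff_dvd dvd_def)
  have Q'0: "Q' \<noteq> 0" using Q Cons.prems(1) by auto
  have dQ: "degree Q = Suc (degree Q')" unfolding Q using Q'0 by (simp add: degree_mult_eq del: mult_pCons_left)
  then obtain n' where n: "n = Suc n'" "degree Q' \<le> n'" using Cons.prems(2) by (cases n) auto
  have "proots Q = {#z#} + proots Q'"
    unfolding Q using Q'0 by (subst proots_mult) (auto simp del: mult_pCons_left)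
  then have "mset zs \<subseteq># proots Q'" using Cons.prems(3) by simp
  then have "prod_list (map (\<lambda>z. xp - smult z mp) zs) dvd homogenize n' Q'" using Cons.IH Q'0 n(2) by blast
  then show ?case unfolding n(1) Q homogenize_linear_factor[OF n(2)]
    by (simp only: list.map prod_list.Cons) (rule mult_dvd_mono[OF dvd_refl])
qed simp

lemma tau_factor_dvd:
  assumes "Some z \<in> zproj ` \<Omega>"
  shows "[:- tau (Some z), 1:] dvd xp - smult z mp"
proof -
  have "zproj (tau (Some z)) = Some z" using assms by (rule zproj_tau)
  then have "X (tau (Some z)) = z * m (tau (Some z))" by (auto simp: zproj_def field_simps split: if_splits)
  then have "poly (xp - smult z mp) (tau (Some z)) = 0" by simp
  then show ?thesis by (simp only: poly_eq_0_iff_dvd)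
qed

text \<open>
  Zeros of \<open>Q\<close> at points \<open>z\<close> off the boundary, counted with multiplicity, lift to zeros of the
  homogenized polynomial at \<open>tau z\<close>: each factor \<open>z - z\<^sub>i\<close> becomes \<open>X - z\<^sub>i m\<close>.
\<close>

lemma zeros_lift:
  assumes Q: "Q \<noteq> 0" "degree Q \<le> n"
    and K: "\<And>z. z \<in># M \<Longrightarrow> Some z \<in> zproj ` \<Omega>" and M: "M \<subseteq># proots Q" and len: "len \<le> size M"
  shows "\<exists>t. (\<forall>i<len. t i \<in> (\<lambda>z. tau (Some z)) ` set_mset M) \<and> (\<Prod>i<len. [:- t i, 1:]) dvd homogenize n Q"
proof -
  obtain zs where zs: "mset zs = M" using ex_mset by blast
  define ys where "ys = take len zs"
  have "length zs = size M" using zs by (metis size_mset)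
  then have length_ys: "length ys = len" using len by (simp add: ys_def)
  have "mset ys + mset (drop len zs) = mset zs" unfolding ys_def by (metis append_take_drop_id mset_append)
  then have "mset ys \<subseteq># mset zs" by (metis mset_subset_eq_add_left)
  then have sub: "mset ys \<subseteq># M" using zs by simp
  have "prod_list (map (\<lambda>z. [:- tau (Some z), 1:]) ys) dvd prod_list (map (\<lambda>z. xp - smult z mp) ys)"
    by (rule prod_list_linear_factors_dvd) (use sub K tau_factor_dvd in \<open>auto dest: mset_subset_eqD\<close>)
  also have "\<dots> dvd homogenize n Q"
    using sub M by (intro homogenize_roots_dvd Q) (rule subset_mset.order_trans)
  also have "prod_list (map (\<lambda>z. [:- tau (Some z), 1:]) ys) = (\<Prod>i<len. [:- tau (Some (ys ! i)), 1:])"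
    unfolding prod.list_conv_set_nth length_map length_ys by (intro prod.cong) (auto simp: length_ys)
  finally have "(\<Prod>i<len. [:- tau (Some (ys ! i)), 1:]) dvd homogenize n Q" .
  moreover have "ys ! i \<in> set_mset M" if "i < len" for i
  proof -
    have "ys ! i \<in># mset ys" using that length_ys by simp
    then show ?thesis by (rule mset_subset_eqD[OF sub])
  qed
  ultimately show ?thesis by (intro exI[of _ "\<lambda>i. tau (Some (ys ! i))"]) auto
qed

end

text \<open>
  The remainder condition enters only through the degree of the numerators.
\<close>

locale hermite_pade = four_sheets +
  fixes Q :: "nat \<Rightarrow> nat \<Rightarrow> complex poly"
  assumes deg: "\<And>n j. j \<le> 3 \<Longrightarrow> degree (Q n j) \<le> n"
    and nz: "\<And>n. \<exists>j\<le>3. Q n j \<noteq> 0"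
    and deg3: "\<And>n. degree (rempoly n (Q n)) \<le> 3"
begin

text \<open>
  Division by the norm of the cubic numerator makes the sequences relatively compact.
\<close>

definition \<nu> :: "nat \<Rightarrow> real" where "\<nu> n = coeff_norm (rempoly n (Q n))"
definition remnorm :: "nat \<Rightarrow> complex poly" where "remnorm n = smult (1 / of_real (\<nu> n)) (rempoly n (Q n))"
definition lhsnorm :: "nat \<Rightarrow> nat \<Rightarrow> complex poly" where
  "lhsnorm j n = smult (1 / of_real (\<nu> n)) (lhs_coeff j * homogenize n (Q n j))"

lemma \<nu>_pos: "\<nu> n > 0"
proof -
  have "rempoly n (Q n) \<noteq> 0" using deg nz by (intro rempoly_nz) auto
  then have "\<nu> n \<noteq> 0" using coeff_norm_eq_0[OF deg3] by (auto simp: \<nu>_def)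
  then show ?thesis using coeff_norm_nonneg[of "rempoly n (Q n)"] by (simp add: \<nu>_def)
qed

lemma coeff_norm_remnorm: "coeff_norm (remnorm n) = 1"
proof -
  have "coeff_norm (remnorm n) = (\<Sum>i\<le>3. 1 / \<nu> n * cmod (coeff (rempoly n (Q n)) i))"
    unfolding coeff_norm_def remnorm_def using \<nu>_pos[of n] by (simp add: norm_mult norm_divide)
  also have "\<dots> = 1 / \<nu> n * \<nu> n" unfolding \<nu>_def coeff_norm_def sum_distrib_left ..
  finally show ?thesis using \<nu>_pos[of n] by simp
qed

lemma degree_remnorm: "degree (remnorm n) \<le> 3"
  unfolding remnorm_def using degree_smult_le deg3 order_trans by blast

lemma norm_coeff_remnorm: "i \<le> 3 \<Longrightarrow> cmod (coeff (remnorm n) i) \<le> 1"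
proof -
  assume "i \<le> 3"
  then have "cmod (coeff (remnorm n) i) \<le> coeff_norm (remnorm n)" unfolding coeff_norm_def
    by (intro member_le_sum) auto
  then show ?thesis by (simp add: coeff_norm_remnorm)
qed

definition cubic :: "(nat \<Rightarrow> complex) \<Rightarrow> complex poly" where "cubic c = (\<Sum>i\<le>3. monom (c i) i)"

lemma coeff_cubic: "coeff (cubic c) i = (if i \<le> 3 then c i else 0)"
  by (auto simp: cubic_def coeff_sum)

lemma degree_cubic: "degree (cubic c) \<le> 3"
  by (rule degree_le) (simp add: coeff_cubic)

text \<open>
  Once the cubic numerators converge, so do the left-hand sides of the linear relations, since the
  errors decay geometrically.
\<close>

lemma lhsnorm_loc_unif:
  assumes r: "strict_mono r" and c: "\<And>i. i \<le> 3 \<Longrightarrow> (\<lambda>n. coeff (remnorm (r n)) i) \<longlonglongrightarrow> c i" and j: "j \<le> 3"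
  shows "loc_unif \<Omega> (\<lambda>n. lhsnorm j (r n)) (rhs_coeff j * cubic c)"
  unfolding loc_unif_def
proof
  fix p assume "p \<in> \<Omega>"
  then obtain R C q where R: "R > 0" "cball p R \<subseteq> \<Omega>" and q: "0 \<le> q" "q < 1"
    and est: "\<And>n Q j t. (\<And>j. j \<le> 3 \<Longrightarrow> degree (Q j) \<le> n) \<Longrightarrow> degree (rempoly n Q) \<le> 3 \<Longrightarrow> j \<le> 3 \<Longrightarrow>
       t \<in> cball p R \<Longrightarrow>
       cmod (poly (lhs_coeff j * homogenize n (Q j) - rhs_coeff j * rempoly n Q) t) \<le> C * q ^ n * coeff_norm (rempoly n Q)"
    by (rule local_estimate) blast
  have "bounded (poly (rhs_coeff j) ` cball p R)"
    by (intro compact_imp_bounded compact_continuous_image continuous_intros) auto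
  then obtain V where V: "\<And>t. t \<in> cball p R \<Longrightarrow> cmod (poly (rhs_coeff j) t) \<le> V"
    unfolding bounded_iff by blast
  have V0: "V \<ge> 0" by (rule order_trans[OF norm_ge_zero V[of p]]) (use R(1) in simp)
  have "uniform_limit (cball p R) (\<lambda>n. poly (lhsnorm j (r n))) (poly (rhs_coeff j * cubic c)) sequentially"
  proof (rule uniform_limit_dominated)
    fix n t assume t: "t \<in> cball p R"
    let ?\<nu> = "complex_of_real (\<nu> (r n))"
    have t1: "cmod t \<le> 1" using t R(2) by (auto simp: \<Omega>_def)
    have nu: "?\<nu> \<noteq> 0" using \<nu>_pos[of "r n"] by simp
    have "poly (lhsnorm j (r n)) t - poly (rhs_coeff j * cubic c) t =
      poly (lhs_coeff j * homogenize (r n) (Q (r n) j) - rhs_coeff j * rempoly (r n) (Q (r n))) t / ?\<nu> + poly (rhs_coeff j) t * poly (remnorm (r n) - cubic c) t"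
      using nu by (simp add: lhsnorm_def remnorm_def field_simps)
    then have "dist (poly (lhsnorm j (r n)) t) (poly (rhs_coeff j * cubic c) t) \<le>
      cmod (poly (lhs_coeff j * homogenize (r n) (Q (r n) j) - rhs_coeff j * rempoly (r n) (Q (r n))) t / ?\<nu>) + cmod (poly (rhs_coeff j) t * poly (remnorm (r n) - cubic c) t)"
      unfolding dist_norm by (simp only: norm_triangle_ineq)
    also have "\<dots> = cmod (poly (lhs_coeff j * homogenize (r n) (Q (r n) j) - rhs_coeff j * rempoly (r n) (Q (r n))) t) / \<nu> (r n) + cmod (poly (rhs_coeff j) t) * cmod (poly (remnorm (r n) - cubic c) t)"
      using \<nu>_pos[of "r n"] by (simp only: norm_divide norm_mult norm_of_real abs_of_pos)
    also have "\<dots> \<le> C * q ^ r n + V * coeff_norm (remnorm (r n) - cubic c)"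
    proof (rule add_mono)
      have "cmod (poly (lhs_coeff j * homogenize (r n) (Q (r n) j) - rhs_coeff j * rempoly (r n) (Q (r n))) t) \<le> C * q ^ r n * \<nu> (r n)"
        unfolding \<nu>_def by (rule est[of "Q (r n)", OF deg deg3 j t])
      then show "cmod (poly (lhs_coeff j * homogenize (r n) (Q (r n) j) - rhs_coeff j * rempoly (r n) (Q (r n))) t) / \<nu> (r n) \<le> C * q ^ r n"
        using \<nu>_pos[of "r n"] by (simp add: divide_le_eq)
      have "degree (remnorm (r n) - cubic c) \<le> 3" using degree_remnorm degree_cubic degree_diff_le by blast
      then show "cmod (poly (rhs_coeff j) t) * cmod (poly (remnorm (r n) - cubic c) t) \<le> V * coeff_norm (remnorm (r n) - cubic c)"
        using V[OF t] V0 t1 by (intro mult_mono norm_poly_le_coeff_norm) auto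
    qed
    finally show "dist (poly (lhsnorm j (r n)) t) (poly (rhs_coeff j * cubic c) t) \<le> C * q ^ r n + V * coeff_norm (remnorm (r n) - cubic c)" .
  next
    have "(\<lambda>n. coeff_norm (remnorm (r n) - cubic c)) \<longlonglongrightarrow> 0"
    proof -
      have "(\<lambda>n. \<Sum>i\<le>3. cmod (coeff (remnorm (r n)) i - c i)) \<longlonglongrightarrow> (\<Sum>i\<le>(3::nat). cmod (c i - c i))"
        by (intro tendsto_sum tendsto_norm tendsto_diff c tendsto_const) auto
      then show ?thesis by (simp add: coeff_norm_def coeff_cubic)
    qed
    moreover have "(\<lambda>n. q ^ r n) \<longlonglongrightarrow> 0"
      using filterlim_compose[OF LIMSEQ_power_zero[of q] filterlim_subseq[OF r]] q by simp
    ultimately have "(\<lambda>n. C * q ^ r n + V * coeff_norm (remnorm (r n) - cubic c)) \<longlonglongrightarrow> C * 0 + V * 0"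
      by (intro tendsto_intros)
    then show "(\<lambda>n. C * q ^ r n + V * coeff_norm (remnorm (r n) - cubic c)) \<longlonglongrightarrow> 0" by simp
  qed
  with R show "\<exists>r'>0. cball p r' \<subseteq> \<Omega> \<and> uniform_limit (cball p r') (\<lambda>n. poly (lhsnorm j (r n))) (poly (rhs_coeff j * cubic c)) sequentially"
    by blast
qed

lemma remnorm_subseq:
  assumes "strict_mono (r :: nat \<Rightarrow> nat)"
  shows "\<exists>s c. strict_mono s \<and> (\<forall>i\<le>3. (\<lambda>n. coeff (remnorm (r (s n))) i) \<longlonglongrightarrow> c i) \<and> cubic c \<noteq> 0"
proof -
  obtain s c where s: "strict_mono s" "\<And>i. i < 4 \<Longrightarrow> (\<lambda>n. coeff (remnorm (r (s n))) i) \<longlonglongrightarrow> c i"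
    using multi_subseq[of "cball 0 1" 4 "\<lambda>i n. coeff (remnorm (r n)) i"] norm_coeff_remnorm by fastforce
  have lim: "(\<lambda>n. \<Sum>i\<le>3. cmod (coeff (remnorm (r (s n))) i)) \<longlonglongrightarrow> (\<Sum>i\<le>3. cmod (c i))"
    by (intro tendsto_sum tendsto_norm s) auto
  moreover have "(\<Sum>i\<le>3. cmod (coeff (remnorm (r (s n))) i)) = 1" for n
    using coeff_norm_remnorm[of "r (s n)"] by (simp add: coeff_norm_def)
  ultimately have "(\<Sum>i\<le>3. cmod (c i)) = 1" by (simp add: LIMSEQ_const_iff)
  then have "cubic c \<noteq> 0" using coeff_cubic[of c] by (metis (no_types, lifting) atMost_iff coeff_0 norm_zero sum.neutral zero_neq_one)
  with s show ?thesis by (intro exI[of _ s] exI[of _ c]) auto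
qed

text \<open>
  If more zeros than the degree of \<open>rhs_coeff j\<close> times a cubic stayed away from the boundary for
  infinitely many \<open>n\<close>, then by compactness they would have limit points in \<open>\<Omega>\<close> along a subsequence,
  and these would be zeros of a nonzero limit of that degree.
\<close>

lemma attracts:
  assumes j: "j \<le> 3"
  shows "attracts_almost_all_zeros (boundary_34 A B) (\<lambda>n. Q n j)"
  unfolding attracts_almost_all_zeros_def
proof (rule exI[of _ "degree (rhs_coeff j) + 3"], intro allI impI, elim conjE)
  define len where "len = Suc (degree (rhs_coeff j) + 3)"
  fix U assume U: "openin riemann_sphere U" "boundary_34 A B \<subseteq> U"
  let ?M = "\<lambda>n. {#z \<in># proots (Q n j). Some z \<notin> U#}"
  have K: "- U \<subseteq> zproj ` \<Omega>" using U(2) boundary_eq by blast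
  have "closedin riemann_sphere (- U)" using U(1) by (simp add: closedin_def flip: Compl_eq_Diff_UNIV)
  moreover have "compact_space riemann_sphere" by (simp add: riemann_sphere_def)
  ultimately have cK: "compactin riemann_sphere (- U)" by (rule closedin_compact_space[rotated])
  note T0 = compact_tau_image[OF cK K]
  obtain p0 where p0: "p0 \<in> \<Omega>" using Omega_nonempty by blast
  \<comment> \<open>The extra point \<open>p0\<close> serves the case \<open>Q n j = 0\<close>, where every point is a zero, even if \<open>U\<close> is
    the whole sphere.\<close>
  define T where "T = insert p0 (tau ` (- U))"
  have T: "compact T" "T \<subseteq> \<Omega>" using T0 p0 by (auto simp: T_def)
  show "\<forall>\<^sub>F n in sequentially. Q n j \<noteq> 0 \<and> size (?M n) \<le> degree (rhs_coeff j) + 3"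
  proof (rule ccontr)
    assume "\<not> ?thesis"
    then have "\<exists>\<^sub>F n in sequentially. Q n j = 0 \<or> size (?M n) \<ge> len"
      unfolding frequently_def
      by (rule contrapos_nn) (auto elim!: eventually_mono simp: len_def not_less_eq_eq)
    then have inf: "infinite {n. Q n j = 0 \<or> size (?M n) \<ge> len}" (is "infinite ?B")
      by (simp only: frequently_sequentially infinite_nat_iff_unbounded_le mem_Collect_eq simp_thms)
    define r where "r = enumerate ?B"
    have r: "strict_mono r" unfolding r_def using inf by (rule strict_mono_enumerate)
    have rB: "Q (r n) j = 0 \<or> size (?M (r n)) \<ge> len" for n
      using enumerate_in_set[OF inf] by (auto simp: r_def)
    have "\<exists>t. (\<forall>i<len. t i \<in> T) \<and> (\<Prod>i<len. [:- t i, 1:]) dvd homogenize (r n) (Q (r n) j)" for n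
    proof (cases "Q (r n) j = 0")
      case True
      then show ?thesis by (intro exI[of _ "\<lambda>_. p0"]) (simp add: T_def homogenize_def)
    next
      case False
      then have "len \<le> size (?M (r n))" using rB[of n] by blast
      then have "\<exists>t. (\<forall>i<len. t i \<in> (\<lambda>z. tau (Some z)) ` set_mset (?M (r n))) \<and> (\<Prod>i<len. [:- t i, 1:]) dvd homogenize (r n) (Q (r n) j)"
        using K by (intro zeros_lift False deg j) auto
      moreover have "(\<lambda>z. tau (Some z)) ` set_mset (?M (r n)) \<subseteq> T" by (auto simp: T_def)
      ultimately show ?thesis by blast
    qed
    then have "\<forall>n. \<exists>t. (\<forall>i<len. t i \<in> T) \<and> (\<Prod>i<len. [:- t i, 1:]) dvd homogenize (r n) (Q (r n) j)" ..
    from choice[OF this] obtain t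
      where "\<forall>n. (\<forall>i<len. t n i \<in> T) \<and> (\<Prod>i<len. [:- t n i, 1:]) dvd homogenize (r n) (Q (r n) j)" ..
    then have t: "\<And>n i. i < len \<Longrightarrow> t n i \<in> T"
      "\<And>n. (\<Prod>i<len. [:- t n i, 1:]) dvd homogenize (r n) (Q (r n) j)" by simp_all
    obtain s l where s: "strict_mono s" and l: "\<And>i. i < len \<Longrightarrow> l i \<in> T \<and> (\<lambda>n. t (s n) i) \<longlonglongrightarrow> l i"
      using multi_subseq[OF T(1), of len "\<lambda>i n. t n i"] t(1) by blast
    have rs: "strict_mono (\<lambda>n. r (s n))" using r s by (simp add: strict_mono_def)
    obtain s' c where s': "strict_mono s'" and c: "\<And>i. i \<le> 3 \<Longrightarrow> (\<lambda>n. coeff (remnorm (r (s (s' n)))) i) \<longlonglongrightarrow> c i"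
      and cnz: "cubic c \<noteq> 0"
      using remnorm_subseq[OF rs] by blast
    have rss: "strict_mono (\<lambda>n. r (s (s' n)))" using rs s' by (simp add: strict_mono_def)
    have "(\<Prod>i<len. [:- l i, 1:]) dvd rhs_coeff j * cubic c"
    proof (rule loc_unif_roots[OF lhsnorm_loc_unif[OF rss c j]])
      fix i assume "i < len"
      then show "(\<lambda>n. t (s (s' n)) i) \<longlonglongrightarrow> l i \<and> l i \<in> \<Omega>"
        using l T(2) LIMSEQ_subseq_LIMSEQ[OF _ s', of "\<lambda>n. t (s n) i" "l i"] by (auto simp: o_def)
    next
      fix n show "(\<Prod>i<len. [:- t (s (s' n)) i, 1:]) dvd lhsnorm j (r (s (s' n)))"
        unfolding lhsnorm_def using t(2)[of "s (s' n)"] by (intro dvd_smult dvd_mult)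
    qed
    moreover have "rhs_coeff j * cubic c \<noteq> 0" using rhs_coeff_nz cnz by simp
    ultimately have "degree (\<Prod>i<len. [:- l i, 1:]) \<le> degree (rhs_coeff j * cubic c)" by (rule dvd_imp_degree_le)
    also have "\<dots> \<le> degree (rhs_coeff j) + 3" using degree_mult_le[of "rhs_coeff j" "cubic c"] degree_cubic[of c] by linarith
    finally show False by (simp add: degree_prod_eq_sum_degree len_def)
  qed
qed

definition Qhom :: "nat \<Rightarrow> nat \<Rightarrow> complex \<Rightarrow> complex" where "Qhom n j t = poly (homogenize n (Q n j)) t"

text \<open>
  Here \<open>g\<close> is a coordinate on the sphere. Away from the zeros of the limit \<open>V\<close> the normalized
  left-hand sides for \<open>j = 2\<close> and \<open>j = 3\<close> have the same nonvanishing limit, and their quotient is the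
  quotient of the coefficients divided by \<open>F\<close>.
\<close>

lemma capacity_bad_set:
  assumes T: "compact T" "T \<subseteq> \<Omega>" and g: "continuous_on T g" and \<epsilon>: "\<epsilon> > 0"
    and B: "\<And>n. Bd n \<subseteq> {t \<in> T. \<epsilon> \<le> cmod (Qhom n 2 t / Qhom n 3 t - F t)}"
  shows "(\<lambda>n. log_capacity (g ` Bd n)) \<longlonglongrightarrow> 0"
proof -
  have "bounded (g ` T)" using T(1) g by (intro compact_imp_bounded compact_continuous_image)
  then obtain R where R: "g ` T \<subseteq> cball 0 R" unfolding bounded_iff by (auto simp: subset_iff)
  have T1: "cmod t < 1" if "t \<in> T" for t using that T(2) by (auto simp: \<Omega>_def)
  have tsq: "t\<^sup>2 \<noteq> 1" if "t \<in> T" for t using T1[OF that] by (auto simp: power2_eq_1_iff)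
  show ?thesis
  proof (rule log_capacity_tendsto_0)
    fix n show "g ` Bd n \<subseteq> cball 0 R" using B R by blast
  next
    fix r :: "nat \<Rightarrow> nat" assume r: "strict_mono r"
    obtain s c where s: "strict_mono s" and c: "\<And>i. i \<le> 3 \<Longrightarrow> (\<lambda>n. coeff (remnorm (r (s n))) i) \<longlonglongrightarrow> c i"
      and cnz: "cubic c \<noteq> 0"
      using remnorm_subseq[OF r] by blast
    have rs: "strict_mono (\<lambda>n. r (s n))" using r s by (simp add: strict_mono_def)
    define V where "V = yp * cubic c"
    have rhs_coeff23: "rhs_coeff 2 = yp" "rhs_coeff 3 = yp" by (simp_all add: rhs_coeff_def)
    have u2: "uniform_limit T (\<lambda>n. poly (lhsnorm 2 (r (s n)))) (poly V) sequentially"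
      and u3: "uniform_limit T (\<lambda>n. poly (lhsnorm 3 (r (s n)))) (poly V) sequentially"
      using loc_unif_compact[OF lhsnorm_loc_unif[OF rs c, of 2] T] loc_unif_compact[OF lhsnorm_loc_unif[OF rs c, of 3] T]
      by (simp_all add: V_def rhs_coeff23)
    define G where "G = lhs_coeff 3 * V"
    have Gnz: "G \<noteq> 0" using lhs_coeff_nz cnz yp_nz by (simp add: G_def V_def)
    define Z where "Z = g ` {t \<in> T. poly G t = 0}"
    have "finite {t \<in> T. poly G t = 0}" by (rule finite_subset[OF _ poly_roots_finite[OF Gnz]]) auto
    then have Zfin: "finite Z" by (simp add: Z_def)
    have "\<forall>\<^sub>F n in sequentially. g ` Bd (r (s n)) \<subseteq> (\<Union>z\<in>Z. cball z \<delta>)" if \<delta>: "\<delta> > 0" for \<delta>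
    proof -
      \<comment> \<open>The part of \<open>T\<close> outside the small discs, where the limit \<open>V\<close> is bounded away from 0.\<close>
      define T' where "T' = T \<inter> g -` (\<Inter>z\<in>Z. - ball z \<delta>)"
      have "compact T'"
      proof -
        have "closedin (top_of_set T) T'" unfolding T'_def
          by (rule continuous_closedin_preimage[OF g]) (auto intro!: closed_INT closed_Compl)
        then show ?thesis using T(1) closedin_compact by blast
      qed
      have G0: "poly G t \<noteq> 0" if "t \<in> T'" for t
        using that \<delta> by (auto simp: T'_def Z_def)
      obtain c1 where c1: "c1 > 0" "\<And>t. t \<in> T' \<Longrightarrow> c1 \<le> cmod (poly V t)"
      proof (cases "T' = {}")
        case True then show ?thesis by (intro that[of 1]) auto
      next
        case False
        have "continuous_on T' (\<lambda>t. cmod (poly V t))" by (intro continuous_intros)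
        then obtain t0 where t0: "t0 \<in> T'" "\<And>t. t \<in> T' \<Longrightarrow> cmod (poly V t0) \<le> cmod (poly V t)"
          using continuous_attains_inf[OF \<open>compact T'\<close> False] by blast
        then show ?thesis using G0[OF t0(1)] by (intro that[of "cmod (poly V t0)"]) (auto simp: G_def)
      qed
      obtain f1 where f1: "f1 > 0" "\<And>t. t \<in> T \<Longrightarrow> cmod (F t) \<le> f1"
      proof -
        have "continuous_on T F" unfolding F_def[abs_def]
          by (intro continuous_intros continuous_on_N) (use tsq in auto)
        then have "bounded (F ` T)" using T(1) by (intro compact_imp_bounded compact_continuous_image)
        then show ?thesis using that unfolding bounded_pos by (metis imageI)
      qed
      \<comment> \<open>With an error below \<open>\<eta>\<close> the denominator is at least \<open>c1 / 2\<close> and the quotient is off by at most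
        \<open>f1 * 2 \<eta> / (c1 / 2) \<le> \<epsilon> / 2\<close>.\<close>
      define \<eta> where "\<eta> = min (c1 / 2) (\<epsilon> * c1 / (8 * f1))"
      have \<eta>: "\<eta> > 0" "\<eta> \<le> c1 / 2" "f1 * (2 * \<eta>) \<le> \<epsilon> * c1 / 4"
      proof -
        show "\<eta> > 0" "\<eta> \<le> c1 / 2" using c1 f1 \<epsilon> by (auto simp: \<eta>_def)
        have "\<eta> \<le> \<epsilon> * c1 / (8 * f1)" by (simp add: \<eta>_def)
        then show "f1 * (2 * \<eta>) \<le> \<epsilon> * c1 / 4" using f1(1) by (simp add: field_simps)
      qed
      have "\<forall>\<^sub>F n in sequentially. (\<forall>t\<in>T. dist (poly (lhsnorm 2 (r (s n))) t) (poly V t) < \<eta>) \<and>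
         (\<forall>t\<in>T. dist (poly (lhsnorm 3 (r (s n))) t) (poly V t) < \<eta>)"
        using u2 u3 \<eta>(1) unfolding uniform_limit_iff by (intro eventually_conj) auto
      then show ?thesis
      proof eventually_elim
        case (elim n)
        let ?n = "r (s n)"
        have good: "cmod (Qhom ?n 2 t / Qhom ?n 3 t - F t) < \<epsilon>" if t: "t \<in> T'" for t
        proof -
          have tT: "t \<in> T" using t by (simp add: T'_def)
          define x2 x3 where "x2 = poly (lhsnorm 2 ?n) t" and "x3 = poly (lhsnorm 3 ?n) t"
          have d: "cmod (x2 - poly V t) < \<eta>" "cmod (x3 - poly V t) < \<eta>"
            using elim tT by (auto simp: x2_def x3_def dist_norm)
          have "cmod (poly V t) \<le> cmod x3 + cmod (x3 - poly V t)"
            using norm_triangle_sub[of "poly V t" x3] by (simp add: norm_minus_commute)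
          then have x3: "cmod x3 \<ge> c1 / 2" using d(2) c1(2)[OF t] \<eta>(2) by linarith
          have "cmod (x2 - x3) \<le> cmod (x2 - poly V t) + cmod (x3 - poly V t)"
            using norm_triangle_ineq4[of "x2 - poly V t" "x3 - poly V t"] by simp
          then have d23: "cmod (x2 - x3) < 2 * \<eta>" using d by linarith
          have lhs_coeff3: "poly (lhs_coeff 3) t \<noteq> 0" using G0[OF t] by (auto simp: G_def)
          have lhs_coeff: "poly (lhs_coeff 3) t = F t * poly (lhs_coeff 2) t"
            using tsq[OF tT]
            by (simp add: lhs_coeff_def F_def power2_eq_square[symmetric] del: mult_pCons_left mult_pCons_right)
          have x30: "x3 \<noteq> 0" using x3 c1(1) by auto
          have nu: "complex_of_real (\<nu> ?n) \<noteq> 0" using \<nu>_pos[of ?n] by simp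
          have "Qhom ?n 2 t / Qhom ?n 3 t - F t = F t * (x2 - x3) / x3"
          proof -
            have x: "x2 = poly (lhs_coeff 2) t * Qhom ?n 2 t / \<nu> ?n" "x3 = F t * poly (lhs_coeff 2) t * Qhom ?n 3 t / \<nu> ?n"
              by (simp_all add: x2_def x3_def lhsnorm_def Qhom_def lhs_coeff)
            have F0: "F t \<noteq> 0" "poly (lhs_coeff 2) t \<noteq> 0" using lhs_coeff3 lhs_coeff by auto
            have "x2 / x3 = Qhom ?n 2 t / (F t * Qhom ?n 3 t)"
              unfolding x using nu F0 by simp
            then have "F t * (x2 / x3) = Qhom ?n 2 t / Qhom ?n 3 t" using F0 by simp
            moreover have "F t * (x2 - x3) / x3 = F t * (x2 / x3) - F t"
              using x30 by (simp add: right_diff_distrib diff_divide_distrib)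
            ultimately show ?thesis by simp
          qed
          then have "cmod (Qhom ?n 2 t / Qhom ?n 3 t - F t) = cmod (F t) * cmod (x2 - x3) / cmod x3"
            by (simp add: norm_mult norm_divide)
          also have "\<dots> \<le> f1 * (2 * \<eta>) / (c1 / 2)"
            using f1(2)[OF tT] d23 x3 c1(1) f1(1) \<eta>(1) by (intro frac_le mult_mono) auto
          also have "\<dots> \<le> (\<epsilon> * c1 / 4) / (c1 / 2)" using \<eta>(3) c1(1) by (intro divide_right_mono) auto
          also have "\<dots> = \<epsilon> / 2" using c1(1) by simp
          also have "\<dots> < \<epsilon>" using \<epsilon> by simp
          finally show ?thesis .
        qed
        show ?case
        proof
          fix w assume "w \<in> g ` Bd ?n"
          then obtain t where t: "w = g t" "t \<in> T" "\<epsilon> \<le> cmod (Qhom ?n 2 t / Qhom ?n 3 t - F t)" using B by blast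
          then have "t \<notin> T'" using good[of t] by auto
          then obtain z where "z \<in> Z" "dist z (g t) < \<delta>" using t by (auto simp: T'_def)
          then show "w \<in> (\<Union>z\<in>Z. cball z \<delta>)" unfolding t(1) by (intro UN_I[of z]) auto
        qed
      qed
    qed
    with s Zfin show "\<exists>s Z. strict_mono s \<and> finite Z \<and>
        (\<forall>\<delta>>0. \<forall>\<^sub>F n in sequentially. g ` Bd (r (s n)) \<subseteq> (\<Union>z\<in>Z. cball z \<delta>))" by blast
  qed
qed

lemma converges:
  "converges_in_capacity (zproj ` \<Omega>) (\<lambda>n z. poly (Q n 2) z / poly (Q n 3) z) (\<lambda>p. F (tau p))"
  unfolding converges_in_capacity_def Let_def
proof (intro allI impI, elim conjE)
  fix K and \<epsilon> :: real assume K: "compactin riemann_sphere K" "K \<subseteq> zproj ` \<Omega>" and \<epsilon>: "\<epsilon> > 0"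
  define T where "T = tau ` K"
  have T: "compact T" "T \<subseteq> \<Omega>" unfolding T_def using compact_tau_image[OF K] by auto
  define bad where "bad n = {z. Some z \<in> K \<and> \<epsilon> \<le> cmod (poly (Q n 2) z / poly (Q n 3) z - F (tau (Some z)))}" for n
  define Bd where "Bd n = {t \<in> T. m t \<noteq> 0 \<and> \<epsilon> \<le> cmod (Qhom n 2 t / Qhom n 3 t - F t)}" for n
  have B: "Bd n \<subseteq> {t \<in> T. \<epsilon> \<le> cmod (Qhom n 2 t / Qhom n 3 t - F t)}" for n by (auto simp: Bd_def)
  have ratio: "Qhom n 2 t / Qhom n 3 t = poly (Q n 2) (X t / m t) / poly (Q n 3) (X t / m t)" if "m t \<noteq> 0" for n t
    using that poly_homogenize[OF deg that, of 2 n] poly_homogenize[OF deg that, of 3 n] by (simp add: Qhom_def)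
  have zprojK: "zproj t \<in> K" if "t \<in> T" for t using that K(2) zproj_tau by (auto simp: T_def)
  have bad: "bad n = (\<lambda>t. X t / m t) ` Bd n" for n
  proof
    show "bad n \<subseteq> (\<lambda>t. X t / m t) ` Bd n"
    proof
      fix z assume z: "z \<in> bad n"
      define t where "t = tau (Some z)"
      have "Some z \<in> K" using z by (simp add: bad_def)
      then have "zproj t = Some z" "t \<in> T" using K(2) zproj_tau by (auto simp: t_def T_def)
      then have "m t \<noteq> 0" "X t / m t = z" by (auto simp: zproj_def split: if_splits)
      then have "t \<in> Bd n" using z \<open>t \<in> T\<close> ratio by (simp add: Bd_def bad_def t_def)
      then show "z \<in> (\<lambda>t. X t / m t) ` Bd n" using \<open>X t / m t = z\<close> by blast
    qed
    show "(\<lambda>t. X t / m t) ` Bd n \<subseteq> bad n"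
    proof
      fix z assume "z \<in> (\<lambda>t. X t / m t) ` Bd n"
      then obtain t where t: "t \<in> T" "m t \<noteq> 0" "\<epsilon> \<le> cmod (Qhom n 2 t / Qhom n 3 t - F t)" "z = X t / m t"
        by (auto simp: Bd_def)
      have "zproj t = Some z" using t by (simp add: zproj_def)
      moreover have "tau (zproj t) = t" using t(1) T(2) tau_zproj by blast
      ultimately show "z \<in> bad n" using t zprojK[OF t(1)] ratio[OF t(2)] by (simp add: bad_def)
    qed
  qed
  have "(\<lambda>n. log_capacity (bad n)) \<longlonglongrightarrow> 0" if "None \<notin> K"
    unfolding bad
  proof (rule capacity_bad_set[OF T _ \<epsilon> B])
    have "m t \<noteq> 0" if "t \<in> T" for t using zprojK[OF that] \<open>None \<notin> K\<close> by (auto simp: zproj_def split: if_splits)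
    then show "continuous_on T (\<lambda>t. X t / m t)" by (intro continuous_intros continuous_on_X continuous_on_m) auto
  qed
  moreover have "(\<lambda>n. log_capacity ((\<lambda>z. 1 / z) ` bad n)) \<longlonglongrightarrow> 0" if "Some 0 \<notin> K"
  proof -
    have "(\<lambda>z. 1 / z) ` bad n = (\<lambda>t. m t / X t) ` Bd n" for n
      unfolding bad image_image by simp
    then show ?thesis
    proof (simp only:, rule_tac capacity_bad_set[OF T _ \<epsilon> B])
      have "X t \<noteq> 0" if "t \<in> T" for t
        using zprojK[OF that] \<open>Some 0 \<notin> K\<close> X_m_not_both_0[of t] by (auto simp: zproj_def split: if_splits)
      then show "continuous_on T (\<lambda>t. m t / X t)" by (intro continuous_intros continuous_on_X continuous_on_m) auto
    qed
  qed
  ultimately show "(None \<notin> K \<longrightarrow> (\<lambda>n. log_capacity {z. Some z \<in> K \<and> \<epsilon> \<le> cmod (poly (Q n 2) z / poly (Q n 3) z - F (tau (Some z)))}) \<longlonglongrightarrow> 0) \<and>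
      (Some 0 \<notin> K \<longrightarrow> (\<lambda>n. log_capacity ((\<lambda>z. 1 / z) ` {z. Some z \<in> K \<and> \<epsilon> \<le> cmod (poly (Q n 2) z / poly (Q n 3) z - F (tau (Some z)))})) \<longlonglongrightarrow> 0)"
    unfolding bad_def by blast
qed

end

text \<open>
  The continuous extension is \<open>- F \<circ> tau\<close>, as \<open>tau\<close> is a homeomorphism and \<open>F\<close> has its poles on the
  unit circle.
\<close>

lemma (in four_sheets) sheets_sum:
  assumes br: "\<And>t. t \<noteq> 0 \<Longrightarrow> N t \<noteq> 0 \<Longrightarrow> cmod t < 1 \<Longrightarrow> f_tilde (Some (zeta t)) = - F t"
  shows "is_first_three_sheets_sum A B f_tilde (\<lambda>p. - F (tau p))"
  unfolding is_first_three_sheets_sum_def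
proof (intro conjI allI impI)
  have "- boundary_34 A B = zproj ` \<Omega>" by (simp add: boundary_eq)
  moreover have "continuous_on \<Omega> F"
    unfolding F_def[abs_def] by (intro continuous_intros continuous_on_N) (auto simp: \<Omega>_def power2_eq_1_iff)
  then have "continuous_on \<Omega> (\<lambda>t. - F t)" by (rule continuous_on_minus)
  then have "continuous_map (top_of_set \<Omega>) euclidean (\<lambda>t. - F t)"
    by (simp only: continuous_map_iff_continuous)
  then have "continuous_map (subtopology riemann_sphere (zproj ` \<Omega>)) euclidean ((\<lambda>t. - F t) \<circ> tau)"
    by (rule continuous_map_compose[OF continuous_map_tau])
  ultimately show "continuous_map (subtopology riemann_sphere (- boundary_34 A B)) euclidean (\<lambda>p. - F (tau p))"
    by (simp add: o_def)
next
  fix z p1 p2 p3 p4 assume "sheet_points A B z [p1, p2, p3, p4]"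
  then obtain t where "t \<in> \<Omega>" "zproj t = Some z"
    "surface_f f_tilde p1 + surface_f f_tilde p2 + surface_f f_tilde p3 = - F t"
    using sheet_sum[of f_tilde, OF br] by blast
  then show "- F (tau (Some z)) = surface_f f_tilde p1 + surface_f f_tilde p2 + surface_f f_tilde p3"
    using tau_zproj by force
qed

theorem theorem4:
  fixes A B :: complex
    and f f_tilde :: "complex option \<Rightarrow> complex"
    and Q :: "nat \<Rightarrow> nat \<Rightarrow> complex poly"
  assumes "A \<noteq> B" and "cmod A > 1" and "cmod B > 1"
    and "0 \<notin> closed_segment (1 / A) (1 / B)"
    and "branch_off_interval A B f"
    and "branch_off_cut A B f f_tilde"
    and "\<And>n j. j \<le> 3 \<Longrightarrow> degree (Q n j) \<le> n"
    and "\<And>n. \<exists>j\<le>3. Q n j \<noteq> 0"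
    and "\<And>n. (\<lambda>z. \<Sum>j\<le>3. poly (Q n j) z * f (Some z) ^ j)
               \<in> O[at_infinity](\<lambda>z. 1 / z ^ (3 * n + 3))"
  shows "(\<forall>j\<le>3. attracts_almost_all_zeros (boundary_34 A B) (\<lambda>n. Q n j)) \<and>
    (\<exists>h. is_first_three_sheets_sum A B f_tilde h \<and>
       converges_in_capacity (- boundary_34 A B)
         (\<lambda>n z. poly (Q n 2) z / poly (Q n 3) z) (\<lambda>z. - h z))"
proof -
  define k0 where "k0 = 1 / csqrt (A * B)"
  have AB: "A \<noteq> 0" "B \<noteq> 0" using assms(2,3) by auto
  have k0: "k0\<^sup>2 * (A * B) = 1" using AB by (simp add: k0_def power_divide)
  interpret S0: four_sheets A B k0 by unfold_locales (fact assms(1-4) k0)+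
  obtain \<sigma> where \<sigma>: "\<sigma>\<^sup>2 = 1"
    "\<And>t. t \<noteq> 0 \<Longrightarrow> S0.N t \<noteq> 0 \<Longrightarrow> cmod t < 1 \<Longrightarrow> f_tilde (Some (S0.zeta t)) = \<sigma> * S0.F t"
    using S0.branch_sign[OF assms(6)] by blast
  \<comment> \<open>This choice of the root makes \<open>F\<close> the branch \<open>f\<close> on the first copy.\<close>
  define k where "k = - \<sigma> * k0"
  have k: "k\<^sup>2 * (A * B) = 1" using k0 \<sigma>(1) by (simp add: k_def power_mult_distrib)
  interpret S: four_sheets A B k by unfold_locales (fact assms(1-4) k)+
  have br: "f_tilde (Some (S.zeta t)) = - S.F t" if "t \<noteq> 0" "S.N t \<noteq> 0" "cmod t < 1" for t
  proof -
    have "f_tilde (Some (S.zeta t)) = \<sigma> * (k0 * S.N t / (t\<^sup>2 - 1))"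
      using \<sigma>(2)[OF that] by (simp only: S0.F_def)
    also have "\<dots> = - (k * S.N t / (t\<^sup>2 - 1))" by (simp add: k_def)
    also have "\<dots> = - S.F t" by (simp only: S.F_def)
    finally show ?thesis .
  qed
  interpret H: hermite_pade A B k Q
    by unfold_locales (use assms(7,8) in auto, rule S.degree_rempoly[OF assms(7) assms(6) br assms(9)])
  have "- boundary_34 A B = S.zproj ` S.\<Omega>" by (simp add: S.boundary_eq)
  then have "converges_in_capacity (- boundary_34 A B)
         (\<lambda>n z. poly (Q n 2) z / poly (Q n 3) z) (\<lambda>p. - (- S.F (S.tau p)))"
    using H.converges by simp
  with S.sheets_sum[OF br] H.attracts show ?thesis by blast
qed

end
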